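(* For each $s>0$ and $r>0$ there exists a constant $C=C(r,s)>0$, depending only on $s$ and $r$, such that $$\left|M_{W_\lambda}(-s,-r)-e^{\frac12\Sigma_{\alpha_1}(s,r)}\right|\le C(r,s)\,n^{-1/6}$$ holds for every $n\ge 1$ and every conjugacy class $\mathcal{C}_\lambda$ of $S_n$, where $\alpha_1=\alpha_1(\lambda)$.
   Context: For $\pi\in S_n$, a descent is a position $i\in\{1,\dots,n-1\}$ with $\pi(i)>\pi(i+1)$; $d(\pi)$ is the number of descents of $\pi$ plus $1$, and $\mathrm{maj}(\pi)$ is the sum of the positions at which $\pi$ has a descent. A partition $\lambda$ of $n$ is recorded by multiplicities: $\lambda_k$ is the number of parts equal to $k$, so $\sum_k k\lambda_k=n$. $\mathcal{C}_\lambda$ is the set of $\pi\in S_n$ having exactly $\lambda_k$ cycles of length $k$ for every $k\in\{1,\dots,n\}$; $\alpha_1(\lambda)=\lambda_1/n$. Define $$W_{\lambda}=\left(\frac{d(\pi)-\frac{1-\alpha_1^2}{2}n}{n^{1/2}},\ \frac{\mathrm{maj}(\pi)-\frac{1-\alpha_1^2}{4}n^2}{n^{3/2}}\right)$$ with $\pi$ uniformly random in $\mathcal{C}_\lambda$. For a random vector $X$ in $\mathbb{R}^2$, $M_X(x)=\mathbf{E}[e^{\langle x,X\rangle}]$. For $\alpha\in[0,1]$, $$\Sigma_\alpha=\begin{pmatrix}\frac1{12}(1-4\alpha^3+3\alpha^4)&\frac1{24}(1-4\alpha^3+3\alpha^4)\\ \frac1{24}(1-4\alpha^3+3\alpha^4)&\frac1{36}(1-\alpha^3)\end{pmatrix},$$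 and $\Sigma_\alpha(s,r)$ denotes the quadratic form $x^{\mathsf T}\Sigma_\alpha x$ at $x=(s,r)^{\mathsf T}$. *)

theory Defs
  imports "HOL-Analysis.Analysis" "HOL-Probability.Probability" "HOL-Combinatorics.Combinatorics"
begin

text \<open>Permutations of \<open>n\<close> letters are functions \<open>p\<close> with \<open>p permutes {1..n}\<close>.\<close>

definition descents :: "nat \<Rightarrow> (nat \<Rightarrow> nat) \<Rightarrow> nat set" where
  "descents n p = {i \<in> {1..<n}. p i > p (i + 1)}"

definition des :: "nat \<Rightarrow> (nat \<Rightarrow> nat) \<Rightarrow> nat" where
  "des n p = card (descents n p) + 1"

definition maj :: "nat \<Rightarrow> (nat \<Rightarrow> nat) \<Rightarrow> nat" where
  "maj n p = (\<Sum>i\<in>descents n p. i)"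

text \<open>A partition is recorded by its multiplicities: \<open>l k\<close> is the number of parts equal
  to \<open>k\<close>.\<close>

definition partition_of :: "nat \<Rightarrow> (nat \<Rightarrow> nat) \<Rightarrow> bool" where
  "partition_of n l \<longleftrightarrow> (\<forall>k. k \<notin> {1..n} \<longrightarrow> l k = 0) \<and> (\<Sum>k=1..n. k * l k) = n"

text \<open>Cycles are identified with their supports; a fixed point is a cycle of length 1.\<close>

definition cycles_of_length :: "nat \<Rightarrow> (nat \<Rightarrow> nat) \<Rightarrow> nat \<Rightarrow> nat set set" where
  "cycles_of_length n p k = {c. c \<subseteq> {1..n} \<and> cyclic_on p c \<and> card c = k}"

definition conj_class :: "nat \<Rightarrow> (nat \<Rightarrow> nat) \<Rightarrow> (nat \<Rightarrow> nat) set" where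
  "conj_class n l = {p. p permutes {1..n} \<and> (\<forall>k\<in>{1..n}. card (cycles_of_length n p k) = l k)}"

definition alpha1 :: "nat \<Rightarrow> (nat \<Rightarrow> nat) \<Rightarrow> real" where
  "alpha1 n l = real (l 1) / real n"

definition W :: "nat \<Rightarrow> (nat \<Rightarrow> nat) \<Rightarrow> (nat \<Rightarrow> nat) \<Rightarrow> real^2" where
  "W n l p = vector
     [(real (des n p) - (1 - (alpha1 n l)\<^sup>2) / 2 * real n) / real n powr (1/2),
      (real (maj n p) - (1 - (alpha1 n l)\<^sup>2) / 4 * (real n)\<^sup>2) / real n powr (3/2)]"

definition mgf :: "'a measure \<Rightarrow> ('a \<Rightarrow> 'b::real_inner) \<Rightarrow> 'b \<Rightarrow> real" where
  "mgf M X x = (LINT \<omega>|M. exp (x \<bullet> X \<omega>))"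

definition Sigma_mat :: "real \<Rightarrow> real^2^2" where
  "Sigma_mat a = vector
     [vector [1/12 * (1 - 4 * a^3 + 3 * a^4), 1/24 * (1 - 4 * a^3 + 3 * a^4)],
      vector [1/24 * (1 - 4 * a^3 + 3 * a^4), 1/36 * (1 - a^3)]]"

definition Sigma_form :: "real \<Rightarrow> real \<Rightarrow> real \<Rightarrow> real" where
  "Sigma_form a s r = (let x = vector [s, r] in x \<bullet> (Sigma_mat a *v x))"

end

(*
Put t = exp (-s / sqrt n) and q = exp (-r / n^(3/2)).  Expanding t^des q^maj as a P-partition
series and summing over all conjugates of a permutation p turns the moment generating function into

  (t;q)_(n+1) / n! * Sum_a t^a S(a),

where S(a) sums, over all letterings x of {1..n} with a letters and weight q^(sum of x), the number
of linear orders that sort x weakly decreasingly and break every tie between u and v in the same way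
as the pair p u, p v is ordered (this is the Gessel-Reutenauer correspondence in labelled form).
Such an order is almost determined by x; only the fixed points of p are freely ordered within a
letter.  For a of order n^(3/2) this gives, with m the number of fixed points and h_m the Gaussian
binomial sum, S(a) = m! h_m(a) (1 + ... + q^(a-1))^(n-m) (1 + O(n^(-1/2))).

By the q-binomial theorem the weights (t;q)_(n+1) t^a h_n(a+1) sum to 1, and the same theorem with
t replaced by t e^theta gives their moment generating function as a product.  The quotient of
S(a) / n! by h_n(a) is exp of an affine function of the normalised a up to a small error, hence the
whole sum is asymptotically a value of that product.  The trivial estimate handles small n, and the
error obtained is in fact O(n^(-1/2)).
*)

theory Submission
  imports Defs "HOL-Real_Asymp.Real_Asymp"
begin

section \<open>Generating functions of compatible sequences\<close>

text \<open>The weights (t;q)_(n+1) t^a h_n(a+1) are the law of a sum of n + 1 independent geometric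
  variables with parameters t q^i, which is why their generating function factorises. Such a sum has
  mean close to y0 n^(3/2) / r with y0 = ln (1 + r / s), and variance close to n^2 / (s (s + r)). To
  leading order the logarithm of S(a) / (n! h_n(a)) is sqrt n times a function of q^a. Expanded at
  the mean, its value cancels the contribution of the centring of W, its derivative is the slope
  integrated against the limiting Gaussian, and its second-order term has size n^(-1/2). The class
  enters only through its fraction of fixed points. The obstacle is uniformity in a. The affine
  approximation has an error quadratic in the normalised a, and the estimates of S(a) are too weak
  for small a, where letters collide too often. The quadratic error is absorbed by moving the slope
  one unit up and down; below a fixed multiple of n^(3/2), monotonicity in a and a Chernoff bound
  replace the expansion.\<close>

definition wt :: "real \<Rightarrow> 'a set \<Rightarrow> ('a \<Rightarrow> nat) \<Rightarrow> real" where
  "wt q B x = (\<Prod>u\<in>B. q ^ x u)"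

text \<open>Bounded P-partitions: strictness at a descent is encoded by adding 1 in the natural
  numbers. Extensional functions make the set finite and give every sequence a single
  representative.\<close>

definition compat :: "nat \<Rightarrow> (nat \<Rightarrow> nat) \<Rightarrow> nat \<Rightarrow> (nat \<Rightarrow> nat) set" where
  "compat n p a = {f \<in> {1..n} \<rightarrow>\<^sub>E {..<a}. \<forall>i\<in>{1..<n}. f (i + 1) + of_bool (p (i + 1) < p i) \<le> f i}"

definition pgf :: "nat \<Rightarrow> (nat \<Rightarrow> nat) \<Rightarrow> real \<Rightarrow> nat \<Rightarrow> real" where
  "pgf n p q a = (\<Sum>f\<in>compat n p a. wt q {1..n} f)"

text \<open>The identity has no descent, so all weakly decreasing sequences of length
  \<open>n\<close> over \<open>a\<close> letters are counted, and \<open>hgf n q a\<close> is the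
  Gaussian binomial coefficient of \<open>n + a - 1\<close> over \<open>n\<close>. Since
  \<open>a\<close> counts letters, generating functions start at \<open>Suc a\<close>.\<close>

definition hgf :: "nat \<Rightarrow> real \<Rightarrow> nat \<Rightarrow> real" where
  "hgf n = pgf n id"

lemma compat_less: "f \<in> compat n p a \<Longrightarrow> i \<in> {1..n} \<Longrightarrow> f i < a"
  unfolding compat_def using PiE_mem by fastforce

lemma compat_step: "f \<in> compat n p a \<Longrightarrow> i \<in> {1..<n} \<Longrightarrow> f (i + 1) + of_bool (p (i + 1) < p i) \<le> f i"
  unfolding compat_def by blast

lemma finite_compat [simp]: "finite (compat n p a)"
  unfolding compat_def by (rule finite_subset[OF _ finite_PiE[of "{1..n}" "\<lambda>_. {..<a}"]]) auto

lemma compat_mono: "a \<le> b \<Longrightarrow> compat n p a \<subseteq> compat n p b"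
  using PiE_mono[of "{1..n}" "\<lambda>_. {..<a}" "\<lambda>_. {..<b}"] unfolding compat_def by auto

lemma wt_nonneg: "0 \<le> q \<Longrightarrow> 0 \<le> wt q B x"
  by (simp add: wt_def prod_nonneg)

lemma wt_le_1: "0 \<le> q \<Longrightarrow> q \<le> 1 \<Longrightarrow> wt q B x \<le> 1"
  unfolding wt_def by (intro prod_le_1) (auto simp: power_le_one)

lemma wt_cong: "(\<And>u. u \<in> B \<Longrightarrow> x u = y u) \<Longrightarrow> wt q B x = wt q B y"
  unfolding wt_def by simp

lemma wt_Un: "finite B \<Longrightarrow> finite C \<Longrightarrow> B \<inter> C = {} \<Longrightarrow> wt q (B \<union> C) x = wt q B x * wt q C x"
  unfolding wt_def by (rule prod.union_disjoint)

lemma pgf_nonneg: "0 \<le> q \<Longrightarrow> 0 \<le> pgf n p q a"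
  unfolding pgf_def by (intro sum_nonneg wt_nonneg)

lemma pgf_mono: "0 \<le> q \<Longrightarrow> a \<le> b \<Longrightarrow> pgf n p q a \<le> pgf n p q b"
  unfolding pgf_def by (intro sum_mono2 compat_mono wt_nonneg) auto

lemma pgf_0 [simp]: "pgf 0 p q a = 1"
  by (simp add: pgf_def compat_def wt_def)

lemma compat_empty: "compat (Suc n) p 0 = {}"
  by (auto simp: compat_def PiE_def Pi_def)

lemma pgf_Suc_0 [simp]: "pgf (Suc n) p q 0 = 0"
  by (simp add: pgf_def compat_empty)

lemma hgf_0 [simp]: "hgf 0 q a = 1" and hgf_Suc_0 [simp]: "hgf (Suc n) q 0 = 0"
  by (simp_all add: hgf_def del: id_apply)

lemma hgf_nonneg: "0 \<le> q \<Longrightarrow> 0 \<le> hgf n q a"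
  unfolding hgf_def by (rule pgf_nonneg)

text \<open>The q-Pascal rule, by the last and hence smallest entry: a zero is deleted, and if the
  entry is positive then all \<open>n + 1\<close> entries are lowered by 1, at the price
  \<open>q ^ Suc n\<close>.\<close>

lemma hgf_Suc_Suc: "hgf (Suc n) q (Suc a) = hgf n q (Suc a) + q ^ Suc n * hgf (Suc n) q a"
proof -
  let ?S = "compat (Suc n) id (Suc a)"
  have split: "?S = {f \<in> ?S. f (Suc n) = 0} \<union> {f \<in> ?S. f (Suc n) > 0}" by auto
  have A: "(\<Sum>f\<in>{f \<in> ?S. f (Suc n) = 0}. wt q {1..Suc n} f) = hgf n q (Suc a)"
    unfolding hgf_def pgf_def
  proof (rule sum.reindex_bij_witness[where i = "\<lambda>f. f(Suc n := 0)" and j = "\<lambda>f. f(Suc n := undefined)"])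
    fix f assume f: "f \<in> {f \<in> ?S. f (Suc n) = 0}"
    then show "(f(Suc n := undefined))(Suc n := 0) = f" by auto
    show "f(Suc n := undefined) \<in> compat n id (Suc a)"
      using f by (auto simp: compat_def PiE_def Pi_def extensional_def)
    show "wt q {1..n} (f(Suc n := undefined)) = wt q {1..Suc n} f"
      using f by (simp add: wt_def)
  next
    fix f assume f: "f \<in> compat n id (Suc a)"
    then show "(f(Suc n := 0))(Suc n := undefined) = f" 
      by (auto simp: compat_def PiE_def extensional_def)
    show "f(Suc n := 0) \<in> {f \<in> ?S. f (Suc n) = 0}"
      using f by (auto simp: compat_def PiE_def Pi_def extensional_def)
  qed
  have B: "(\<Sum>f\<in>{f \<in> ?S. f (Suc n) > 0}. wt q {1..Suc n} f) = q ^ Suc n * hgf (Suc n) q a"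
    unfolding hgf_def pgf_def sum_distrib_left
  proof (rule sum.reindex_bij_witness[where i = "\<lambda>f. \<lambda>i\<in>{1..Suc n}. f i + 1" and j = "\<lambda>f. \<lambda>i\<in>{1..Suc n}. f i - 1"])
    fix f assume f: "f \<in> {f \<in> ?S. f (Suc n) > 0}"
    have pos: "f i > 0" if "i \<in> {1..Suc n}" for i
    proof -
      have "i \<le> Suc n" using that by simp
      then show ?thesis using that
      proof (induction rule: inc_induct)
        case base
        then show ?case using f by simp
      next
        case (step k)
        have "f (k + 1) \<le> f k" using f step by (auto simp: compat_def)
        with step show ?case by auto
      qed
    qed
    show "(\<lambda>i\<in>{1..Suc n}. (\<lambda>i\<in>{1..Suc n}. f i - 1) i + 1) = f"
      using f pos by (fastforce simp: compat_def PiE_def extensional_def restrict_def)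
    have b: "f i - 1 < a" if "i \<in> {1..Suc n}" for i
      using f pos[OF that] that by (fastforce simp: compat_def PiE_def Pi_def)
    have c: "f (Suc i) - 1 \<le> f i - 1" if "i \<in> {1..<Suc n}" for i
      using f that by (auto simp: compat_def intro!: diff_le_mono)
    show "(\<lambda>i\<in>{1..Suc n}. f i - 1) \<in> compat (Suc n) id a"
      using b c unfolding compat_def by auto
    have "wt q {1..Suc n} f = (\<Prod>i\<in>{1..Suc n}. q * q ^ (f i - 1))"
      unfolding wt_def by (rule prod.cong[OF refl]) (metis One_nat_def Suc_pred pos power_Suc)
    also have "\<dots> = q ^ Suc n * (\<Prod>i\<in>{1..Suc n}. q ^ (f i - 1))"
      by (simp add: prod.distrib)
    finally show "q ^ Suc n * wt q {1..Suc n} (\<lambda>i\<in>{1..Suc n}. f i - 1) = wt q {1..Suc n} f"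
      by (simp add: wt_def del: prod.cl_ivl_Suc)
  next
    fix f assume f: "f \<in> compat (Suc n) id a"
    show "(\<lambda>i\<in>{1..Suc n}. (\<lambda>i\<in>{1..Suc n}. f i + 1) i - 1) = f"
      using f by (fastforce simp: compat_def PiE_def extensional_def restrict_def)
    show "(\<lambda>i\<in>{1..Suc n}. f i + 1) \<in> {f \<in> ?S. f (Suc n) > 0}"
      using f by (auto simp: compat_def PiE_def Pi_def)
  qed
  have "hgf (Suc n) q (Suc a) = (\<Sum>f\<in>{f \<in> ?S. f (Suc n) = 0}. wt q {1..Suc n} f)
      + (\<Sum>f\<in>{f \<in> ?S. f (Suc n) > 0}. wt q {1..Suc n} f)"
    unfolding hgf_def pgf_def by (subst split, rule sum.union_disjoint) auto
  then show ?thesis using A B by simp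
qed

lemma hgf_eq_prod:
  assumes "0 < q" "q < 1"
  shows "hgf n q a = (\<Prod>j<n. (1 - q ^ (a + j)) / (1 - q ^ Suc j))"
proof (induction n arbitrary: a)
  case 0
  then show ?case by simp
next
  case outer: (Suc n)
  let ?P = "\<lambda>n a. \<Prod>j<n. (1 - q ^ (a + j)) / (1 - q ^ Suc j)"
  have ne: "1 - q ^ Suc j \<noteq> 0" for j
    using assms power_Suc_less_one[of q j] by simp
  show ?case
  proof (induction a)
    case 0
    have "?P (Suc n) 0 = 0" by (rule prod_zero) (auto intro!: bexI[of _ 0])
    then show ?case by simp
  next
    case (Suc a)
    have "(\<Prod>j<Suc n. 1 - q ^ (a + j)) = (1 - q ^ a) * (\<Prod>j<n. 1 - q ^ (Suc a + j))"
      by (subst prod.lessThan_Suc_shift) simp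
    then have sh: "?P (Suc n) a = (1 - q ^ a) / (1 - q ^ Suc n) * ?P n (Suc a)"
      unfolding prod_dividef by (simp add: field_simps)
    have "hgf (Suc n) q (Suc a) = ?P n (Suc a) + q ^ Suc n * ?P (Suc n) a"
      unfolding hgf_Suc_Suc[of n q a] outer Suc ..
    also have "\<dots> = ?P n (Suc a) * (1 + q ^ Suc n * ((1 - q ^ a) / (1 - q ^ Suc n)))"
      unfolding sh by (simp add: algebra_simps)
    also have "1 + q ^ Suc n * ((1 - q ^ a) / (1 - q ^ Suc n)) = (1 - q ^ (Suc a + n)) / (1 - q ^ Suc n)"
      using ne[of n] by (simp add: field_simps power_add)
    finally show ?case by simp
  qed
qed

text \<open>The q-binomial theorem. Summing the q-Pascal rule against \<open>t ^ a\<close> gives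
  \<open>H(n + 1) = H(n) + t * q ^ Suc n * H(n + 1)\<close> for the sums \<open>H\<close>, so each
  step contributes one further factor.\<close>

lemma hgf_sums:
  assumes "0 < q" "q < 1" "0 \<le> t" "t < 1"
  shows "(\<lambda>a. t ^ a * hgf n q (Suc a)) sums (1 / (\<Prod>i\<le>n. 1 - t * q ^ i))"
proof -
  have summ: "summable (\<lambda>a. t ^ a * hgf n q (Suc a))" for n
  proof (rule summable_comparison_test)
    have "norm (t ^ a * hgf n q (Suc a)) \<le> t ^ a * (\<Prod>j<n. 1 / (1 - q ^ Suc j))" for a
    proof -
      have "hgf n q (Suc a) \<le> (\<Prod>j<n. 1 / (1 - q ^ Suc j))"
        unfolding hgf_eq_prod[OF assms(1,2)]
        using assms power_Suc_less_one[of q] by (intro prod_mono) (auto simp: divide_simps power_le_one mult_le_one)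
      then show ?thesis using assms hgf_nonneg[of q n "Suc a"] 
        by (simp add: abs_mult mult_left_mono)
    qed
    then show "\<exists>N. \<forall>k\<ge>N. norm (t ^ k * hgf n q (Suc k)) \<le> t ^ k * (\<Prod>j<n. 1 / (1 - q ^ Suc j))" by blast
    show "summable (\<lambda>k. t ^ k * (\<Prod>j<n. 1 / (1 - q ^ Suc j)))"
      using assms by (intro summable_mult2 summable_geometric) auto
  qed
  have "suminf (\<lambda>a. t ^ a * hgf n q (Suc a)) = 1 / (\<Prod>i\<le>n. 1 - t * q ^ i)"
  proof (induction n)
    case 0
    show ?case using assms by (simp add: suminf_geometric)
  next
    case (Suc n)
    have lt1: "t * q ^ Suc n < 1"
    proof -
      have "t * q ^ Suc n \<le> t * 1" using assms by (intro mult_left_mono power_le_one) auto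
      then show ?thesis using assms by linarith
    qed
    let ?H = "\<lambda>n. suminf (\<lambda>a. t ^ a * hgf n q (Suc a))"
    have "?H (Suc n) = suminf (\<lambda>a. t ^ a * hgf n q (Suc a) + q ^ Suc n * (t ^ a * hgf (Suc n) q a))"
      by (simp add: hgf_Suc_Suc algebra_simps)
    also have s0: "summable (\<lambda>a. t ^ a * hgf (Suc n) q a)"
      using summable_mult[OF summ[of "Suc n"], of t] 
      by (subst summable_Suc_iff[symmetric]) (simp add: mult_ac)
    have "suminf (\<lambda>a. t ^ a * hgf n q (Suc a) + q ^ Suc n * (t ^ a * hgf (Suc n) q a))
      = ?H n + q ^ Suc n * suminf (\<lambda>a. t ^ a * hgf (Suc n) q a)"
      using summ s0 by (simp add: suminf_add[symmetric] suminf_mult summable_mult del: power_Suc)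
    \<comment> \<open>The term at \<open>a = 0\<close> vanishes, because there is no letter;
      shifting the index therefore costs exactly one factor \<open>t\<close>.\<close>
    also have "suminf (\<lambda>a. t ^ a * hgf (Suc n) q a) = t * ?H (Suc n)"
      using suminf_split_head[OF s0] suminf_mult[OF summ[of "Suc n"], of t] by (simp add: mult_ac)
    finally have "?H (Suc n) * (1 - t * q ^ Suc n) = ?H n" by (simp add: algebra_simps)
    then have "?H (Suc n) = (1 / (\<Prod>i\<le>n. 1 - t * q ^ i)) / (1 - t * q ^ Suc n)"
      unfolding Suc using lt1 by (metis diff_gt_0_iff_gt less_irrefl nonzero_eq_divide_eq)
    then show ?case by simp
  qed
  then show ?thesis using summ sums_iff by blast
qed

section \<open>Compatible sequences and the major index\<close>

lemma finite_descents [simp]: "finite (descents n p)"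
  by (simp add: descents_def)

text \<open>Double counting: \<open>j\<close> is counted once for each \<open>i\<close> in
  \<open>{1..j}\<close>. For the descent set this turns the total amount subtracted from a sequence
  into the major index.\<close>

lemma sum_card_ge:
  fixes D :: "nat set"
  assumes "D \<subseteq> {1..n}"
  shows "(\<Sum>i\<in>{1..n}. card {j \<in> D. i \<le> j}) = \<Sum>D"
proof -
  have fin: "finite D" using assms finite_subset by blast
  have "(\<Sum>i\<in>{1..n}. card {j \<in> D. i \<le> j}) = (\<Sum>i\<in>{1..n}. \<Sum>j\<in>D. of_bool (i \<le> j))"
    using fin by (simp add: Int_def)
  also have "\<dots> = (\<Sum>j\<in>D. \<Sum>i\<in>{1..n}. of_bool (i \<le> j))" by (rule sum.swap)
  also have "\<dots> = (\<Sum>j\<in>D. j)"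
  proof (rule sum.cong[OF refl])
    fix j assume "j \<in> D"
    then have "{1..n} \<inter> {i. i \<le> j} = {1..j}" using assms by auto
    then show "(\<Sum>i\<in>{1..n}. of_bool (i \<le> j)) = j" by simp
  qed
  finally show ?thesis by simp
qed

text \<open>Subtracting from \<open>f i\<close> the number of descents at positions \<open>\<ge> i\<close> leaves an arbitrary
  weakly decreasing sequence; the total amount subtracted is the major index.\<close>

lemma pgf_eq:
  "pgf n p q a = q ^ maj n p * hgf n q (a - card (descents n p))"
proof (cases "n = 0")
  case True
  then show ?thesis by (simp add: maj_def descents_def)
next
  case False
  let ?D = "descents n p"
  define d where "d i = card {j \<in> ?D. i \<le> j}" for i
  have d_rec: "d i = d (i + 1) + of_bool (p (i + 1) < p i)" if "i \<in> {1..<n}" for i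
  proof (cases "i \<in> ?D")
    case True
    then have "{j \<in> ?D. i \<le> j} = insert i {j \<in> ?D. i + 1 \<le> j}" by auto
    then show ?thesis using True unfolding d_def by (simp add: descents_def)
  next
    case False
    then have "{j \<in> ?D. i \<le> j} = {j \<in> ?D. i + 1 \<le> j}" 
      by (auto simp: not_less_eq_eq le_less Suc_le_eq)
    then show ?thesis using False that unfolding d_def by (simp add: descents_def)
  qed
  have dn: "d n = 0" by (auto simp: d_def descents_def)
  have d1: "d 1 = card ?D" unfolding d_def by (rule arg_cong[where f = card]) (auto simp: descents_def)
  have d_le: "d i \<le> d 1" if "1 \<le> i" for i
    unfolding d_def by (rule card_mono) (use that in auto)
  have sumd: "(\<Sum>i\<in>{1..n}. d i) = maj n p"
    unfolding d_def maj_def by (rule sum_card_ge) (auto simp: descents_def)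
  have le1: "f i \<le> f (1::nat)" if f: "\<forall>i\<in>{1..<n}. f (i + 1) \<le> (f i :: nat)" and i: "i \<in> {1..n}" for f i
  proof -
    have "1 \<le> i" using i by simp
    then show ?thesis using i
    proof (induction rule: dec_induct)
      case (step k)
      then have "f (k + 1) \<le> f k" using f by auto
      with step show ?case by auto
    qed simp
  qed
  have ge: "d i \<le> f i" if f: "f \<in> compat n p a" and i: "i \<in> {1..n}" for f i
  proof -
    have "i \<le> n" using i by simp
    then show ?thesis using i
    proof (induction rule: inc_induct)
      case base
      then show ?case using dn by simp
    next
      case (step k)
      then have "f (k + 1) + of_bool (p (k + 1) < p k) \<le> f k" using f by (auto simp: compat_def)
      with step d_rec[of k] show ?case by auto
    qed
  qed
  show ?thesis unfolding hgf_def pgf_def sum_distrib_left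
  proof (rule sum.reindex_bij_witness[where i = "\<lambda>f. \<lambda>i\<in>{1..n}. f i + d i" and j = "\<lambda>f. \<lambda>i\<in>{1..n}. f i - d i"])
    fix f assume f: "f \<in> compat n p a"
    show "(\<lambda>i\<in>{1..n}. (\<lambda>i\<in>{1..n}. f i - d i) i + d i) = f"
      using f ge[OF f] by (fastforce simp: compat_def PiE_def extensional_def restrict_def)
    have c: "f (i + 1) - d (i + 1) \<le> f i - d i" if "i \<in> {1..<n}" for i
    proof -
      have "d (i + 1) \<le> f (i + 1)" using ge[OF f, of "i + 1"] that by auto
      then show ?thesis using compat_step[OF f that] d_rec[OF that] by linarith
    qed
    \<comment> \<open>The differences are weakly decreasing, so only the first entry has to be
      bounded; there \<open>d 1\<close> is the number of all descents.\<close>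
    have b: "f i - d i < a - card ?D" if "i \<in> {1..n}" for i
    proof -
      have "f i - d i \<le> f 1 - d 1" using le1[of "\<lambda>i. f i - d i", OF _ that] c by simp
      moreover have "f 1 < a" "d 1 \<le> f 1" using compat_less[OF f, of 1] False ge[OF f, of 1] by simp_all
      ultimately show ?thesis using d1 by linarith
    qed
    show "(\<lambda>i\<in>{1..n}. f i - d i) \<in> compat n id (a - card ?D)"
      using b c unfolding compat_def by auto
    have "wt q {1..n} f = (\<Prod>i\<in>{1..n}. q ^ d i * q ^ (f i - d i))"
      unfolding wt_def using ge[OF f] by (intro prod.cong) (auto simp: power_add[symmetric])
    also have "\<dots> = q ^ maj n p * (\<Prod>i\<in>{1..n}. q ^ (f i - d i))"
      unfolding sumd[symmetric] by (simp add: prod.distrib power_sum)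
    finally show "q ^ maj n p * wt q {1..n} (\<lambda>i\<in>{1..n}. f i - d i) = wt q {1..n} f"
      by (simp add: wt_def)
  next
    fix f assume f: "f \<in> compat n id (a - card ?D)"
    show "(\<lambda>i\<in>{1..n}. (\<lambda>i\<in>{1..n}. f i + d i) i - d i) = f"
      using f by (fastforce simp: compat_def PiE_def extensional_def restrict_def)
    have b: "f i + d i < a" if "i \<in> {1..n}" for i
    proof -
      have "f i < a - card ?D" using compat_less[OF f that] .
      moreover have "d i \<le> card ?D" using d_le[of i] d1 that by auto
      ultimately show ?thesis by linarith
    qed
    have c: "f (i + 1) + d (i + 1) + of_bool (p (i + 1) < p i) \<le> f i + d i" if "i \<in> {1..<n}" for i
      using compat_step[OF f that] d_rec[OF that] by simp
    show "(\<lambda>i\<in>{1..n}. f i + d i) \<in> compat n p a"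
      using b c unfolding compat_def by auto
  qed
qed

text \<open>For \<open>n > 0\<close>, truncated subtraction makes the last argument of
  \<open>hgf\<close> zero when \<open>a < card (descents n p)\<close>, so the series starts late,
  and the shift produces the power \<open>t ^ card (descents n p)\<close>.\<close>

lemma pgf_sums:
  assumes q: "0 < q" "q < 1" and t: "0 \<le> t" "t < 1"
  shows "(\<lambda>a. t ^ a * pgf n p q (Suc a)) sums
    (t ^ card (descents n p) * q ^ maj n p / (\<Prod>i\<le>n. 1 - t * q ^ i))"
proof (cases "n = 0")
  case True
  then show ?thesis using t geometric_sums[of t] by (simp add: descents_def maj_def)
next
  case False
  let ?c = "card (descents n p)"
  have "(\<lambda>a. t ^ (a + ?c) * pgf n p q (Suc (a + ?c))) sums
     (q ^ maj n p * t ^ ?c * (1 / (\<Prod>i\<le>n. 1 - t * q ^ i)))"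
  proof (rule sums_cong[THEN iffD1, OF _ sums_mult[OF hgf_sums[OF q t, of n], of "q ^ maj n p * t ^ ?c"]])
    fix a
    have "Suc (a + ?c) - ?c = Suc a" by simp
    then show "q ^ maj n p * t ^ ?c * (t ^ a * hgf n q (Suc a)) = t ^ (a + ?c) * pgf n p q (Suc (a + ?c))"
      by (simp only: pgf_eq) (simp add: power_add)
  qed
  moreover have "t ^ a * pgf n p q (Suc a) = 0" if "a < ?c" for a
    using that False by (cases n) (simp_all add: pgf_eq)
  ultimately show ?thesis
    using sums_zero_iff_shift[of ?c "\<lambda>a. t ^ a * pgf n p q (Suc a)"] by (simp add: mult_ac)
qed

section \<open>Letterings and their compatible orders\<close>

text \<open>Labels with the same letter are ordered like their images, so by iteration labels are ordered
  like the infinite words read off along their orbits.\<close>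

definition valid :: "'a set \<Rightarrow> ('a \<Rightarrow> 'a) \<Rightarrow> ('a \<Rightarrow> nat) \<Rightarrow> ('a \<times> 'a) set set" where
  "valid B \<sigma> x = {R. R \<subseteq> B \<times> B \<and> irrefl R \<and> trans R \<and> total_on B R \<and>
     (\<forall>(u, v)\<in>R. x v \<le> x u \<and> (x u = x v \<longrightarrow> (\<sigma> u, \<sigma> v) \<in> R))}"

text \<open>The sum S(a), for an arbitrary label set \<open>B\<close>: orbits can then be added one
  at a time, and the fixed points form a label set of their own.\<close>

definition vgf :: "'a set \<Rightarrow> ('a \<Rightarrow> 'a) \<Rightarrow> real \<Rightarrow> nat \<Rightarrow> real" where
  "vgf B \<sigma> q a = (\<Sum>x\<in>B \<rightarrow>\<^sub>E {..<a}. wt q B x * card (valid B \<sigma> x))"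

lemma finite_valid: "finite B \<Longrightarrow> finite (valid B \<sigma> x)"
  by (rule finite_subset[of _ "Pow (B \<times> B)"]) (auto simp: valid_def)

text \<open>The conditions on neighbouring positions propagate by transitivity to all pairs,
  injectivity turning the absence of a descent into a strict ascent. Only the pairwise form survives
  a relabelling, which destroys adjacency.\<close>

lemma compat_iff:
  assumes "inj_on p {1..n}"
  shows "f \<in> compat n p a \<longleftrightarrow> f \<in> {1..n} \<rightarrow>\<^sub>E {..<a} \<and>
    (\<forall>i\<in>{1..n}. \<forall>j\<in>{1..n}. i < j \<longrightarrow> f j \<le> f i \<and> (f i = f j \<longrightarrow> p i < p j))"
    (is "?L \<longleftrightarrow> ?R")
proof
  assume L: ?L
  have "f j \<le> f i \<and> (f i = f j \<longrightarrow> p i < p j)" if "1 \<le> i" "Suc i \<le> j" "j \<le> n" for i j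
    using that(2,3)
  proof (induction rule: dec_induct)
    case base
    have s: "f (i + 1) + of_bool (p (i + 1) < p i) \<le> f i" using compat_step[OF L, of i] that base by simp
    moreover have "p i \<noteq> p (i + 1)" using inj_onD[OF assms, of i "i + 1"] that base by auto
    ultimately show ?case by (cases "p (i + 1) < p i") auto
  next
    case (step j)
    have "f (j + 1) + of_bool (p (j + 1) < p j) \<le> f j" using compat_step[OF L, of j] that step by simp
    moreover have "p j \<noteq> p (j + 1)" using inj_onD[OF assms, of j "j + 1"] that step by auto
    moreover have "f j \<le> f i \<and> (f i = f j \<longrightarrow> p i < p j)" using step by simp
    ultimately show ?case by (cases "p (j + 1) < p j") auto
  qed
  then show ?R using L unfolding compat_def by (simp add: Suc_le_eq)
next
  assume R: ?R
  have "f (i + 1) + of_bool (p (i + 1) < p i) \<le> f i" if "i \<in> {1..<n}" for i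
  proof -
    have "f (i + 1) \<le> f i \<and> (f i = f (i + 1) \<longrightarrow> p i < p (i + 1))" using R that by simp
    then show ?thesis by (cases "p (i + 1) < p i") auto
  qed
  then show ?L using R unfolding compat_def by blast
qed

lemma pgf_cong:
  assumes "\<And>i. i \<in> {1..n} \<Longrightarrow> p i = p' i"
  shows "pgf n p q a = pgf n p' q a"
proof -
  have "compat n p a = compat n p' a" unfolding compat_def using assms by auto
  then show ?thesis by (simp add: pgf_def)
qed

section \<open>Relabellings as linear orders\<close>

definition rank_order :: "'a set \<Rightarrow> ('a \<Rightarrow> nat) \<Rightarrow> ('a \<times> 'a) set" where
  "rank_order B h = {(u, v) \<in> B \<times> B. h u < h v}"

text \<open>Counting predecessors recovers a ranking from the order it induces, so different
  relabellings give different orders.\<close>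

lemma card_rank_order:
  assumes "bij_betw h B {1..n}" "u \<in> B"
  shows "h u = Suc (card {v \<in> B. (v, u) \<in> rank_order B h})"
proof -
  have "h ` {v \<in> B. (v, u) \<in> rank_order B h} = {1..<h u}" (is "?L = ?R")
  proof
    show "?L \<subseteq> ?R" using assms bij_betwE[OF assms(1)] by (auto simp: rank_order_def Suc_le_eq)
    show "?R \<subseteq> ?L"
    proof
      fix i assume i: "i \<in> ?R"
      have "h u \<in> {1..n}" using bij_betwE[OF assms(1)] assms(2) by blast
      then have "i \<in> {1..n}" using i by auto
      then obtain v where "v \<in> B" "h v = i" using bij_betw_imp_surj_on[OF assms(1)] by (metis imageE)
      then have "v \<in> {v \<in> B. (v, u) \<in> rank_order B h}" "i = h v" using i assms(2) by (simp_all add: rank_order_def)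
      then show "i \<in> ?L" by (rule rev_image_eqI)
    qed
  qed
  moreover have "inj_on h {v \<in> B. (v, u) \<in> rank_order B h}"
    by (rule inj_on_subset[OF bij_betw_imp_inj_on[OF assms(1)]]) blast
  ultimately have "card {v \<in> B. (v, u) \<in> rank_order B h} = card {1..<h u}"
    using card_image by metis
  then have "Suc (card {v \<in> B. (v, u) \<in> rank_order B h}) = Suc (h u - 1)" by simp
  moreover have "h u \<ge> 1" using bij_betwE[OF assms(1)] assms(2) by auto
  ultimately show ?thesis by simp
qed

text \<open>In a finite strict linear order the number of predecessors increases strictly along the
  order, so it enumerates \<open>B\<close> and induces the given order again. Every order thus comes
  from a relabelling.\<close>

lemma linear_order_rank:
  assumes fin: "finite B" and n: "card B = n" and R: "R \<subseteq> B \<times> B" "irrefl R" "trans R" "total_on B R"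
  defines "h \<equiv> \<lambda>u. Suc (card {v \<in> B. (v, u) \<in> R})"
  shows "bij_betw h B {1..n}" and "rank_order B h = R"
proof -
  have less: "h u < h v" if "(u, v) \<in> R" for u v
  proof -
    have sub: "{w \<in> B. (w, u) \<in> R} \<subset> {w \<in> B. (w, v) \<in> R}"
    proof
      show "{w \<in> B. (w, u) \<in> R} \<subseteq> {w \<in> B. (w, v) \<in> R}" using R(3) that by (auto dest: transD)
      have "u \<in> {w \<in> B. (w, v) \<in> R}" using that R(1) by auto
      moreover have "u \<notin> {w \<in> B. (w, u) \<in> R}" using R(2) by (auto simp: irrefl_def)
      ultimately show "{w \<in> B. (w, u) \<in> R} \<noteq> {w \<in> B. (w, v) \<in> R}" by blast
    qed
    then show ?thesis unfolding h_def using psubset_card_mono[OF _ sub] fin by simp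
  qed
  show eq: "rank_order B h = R"
  proof
    show "R \<subseteq> rank_order B h" using less R(1) unfolding rank_order_def by blast
    show "rank_order B h \<subseteq> R"
    proof clarify
      fix u v assume "(u, v) \<in> rank_order B h"
      then have uv: "u \<in> B" "v \<in> B" "h u < h v" by (simp_all add: rank_order_def)
      then have "u \<noteq> v" "(v, u) \<notin> R" using less[of v u] by auto
      then show "(u, v) \<in> R" using R(4) uv unfolding total_on_def by blast
    qed
  qed
  have inj: "inj_on h B"
  proof (rule inj_onI, rule ccontr)
    fix u v assume uv: "u \<in> B" "v \<in> B" "h u = h v" "u \<noteq> v"
    then have "(u, v) \<in> R \<or> (v, u) \<in> R" using R(4) unfolding total_on_def by blast
    then show False using less[of u v] less[of v u] uv(3) by linarith
  qed
  have "h ` B \<subseteq> {1..n}"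
  proof clarify
    fix u assume u: "u \<in> B"
    have "{v \<in> B. (v, u) \<in> R} \<subset> B" using u R(2) by (auto simp: irrefl_def)
    then have "card {v \<in> B. (v, u) \<in> R} < n" using psubset_card_mono fin n by metis
    then show "h u \<in> {1..n}" by (auto simp: h_def)
  qed
  then have "h ` B = {1..n}"
    using card_image[OF inj] n by (intro card_subset_eq) auto
  then show "bij_betw h B {1..n}" using inj by (simp add: bij_betw_def)
qed

text \<open>Pairs of a lettering and a compatible order are counted through the enumeration of
  \<open>B\<close> that the order defines. A relabelling \<open>\<rho>\<close> encodes the order, a
  sequence \<open>f\<close> lists the letters by position, and breaking ties as at the images says
  exactly that \<open>f\<close> is compatible with \<open>\<sigma>\<close> transported to positions.
  The enumeration \<open>g\<close> is arbitrary so that the set of fixed points can be treated as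
  well.\<close>

lemma vgf_eq_sum_pgf:
  fixes B :: "'a set"
  assumes g: "bij_betw g B {1..n}" and \<sigma>: "\<sigma> ` B \<subseteq> B" "inj_on \<sigma> B"
  shows "vgf B \<sigma> q a = (\<Sum>\<rho> | \<rho> permutes {1..n}. pgf n (\<lambda>i. \<rho> (g (\<sigma> (inv_into B g (inv \<rho> i))))) q a)"
proof -
  \<comment> \<open>\<open>k \<rho> i\<close> is the label in position \<open>i\<close>, and
    \<open>p \<rho>\<close> is the action of \<open>\<sigma>\<close> on positions.\<close>
  define k where "k \<rho> i = inv_into B g (inv \<rho> i)" for \<rho> :: "nat \<Rightarrow> nat" and i
  define p where "p \<rho> i = \<rho> (g (\<sigma> (k \<rho> i)))" for \<rho> i
  define I where "I = {1..n}"
  have finB: "finite B" using g bij_betw_finite by blast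
  have cardB: "card B = n" using bij_betw_same_card[OF g] by simp
  have h: "bij_betw (\<rho> \<circ> g) B I" if "\<rho> permutes I" for \<rho>
    using bij_betw_trans[OF g[folded I_def]] permutes_imp_bij[OF that] by blast
  have kin: "k \<rho> i \<in> B" and hk: "\<rho> (g (k \<rho> i)) = i" if "\<rho> permutes I" "i \<in> I" for \<rho> i
  proof -
    have *: "inv \<rho> i \<in> I" using permutes_in_image[OF permutes_inv[OF that(1)]] that by simp
    then show "k \<rho> i \<in> B" unfolding k_def using g by (auto simp: bij_betw_def I_def inv_into_into)
    have "g (k \<rho> i) = inv \<rho> i" unfolding k_def using g * by (auto simp: bij_betw_def I_def f_inv_into_f)
    then show "\<rho> (g (k \<rho> i)) = i" using permutes_inverses(1)[OF that(1)] by simp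
  qed
  have kh: "k \<rho> (\<rho> (g u)) = u" and hin: "\<rho> (g u) \<in> I" if "\<rho> permutes I" "u \<in> B" for \<rho> u
  proof -
    have *: "g u \<in> I" using g that by (auto simp: bij_betw_def I_def)
    then show "\<rho> (g u) \<in> I" using permutes_in_image[OF that(1)] by simp
    show "k \<rho> (\<rho> (g u)) = u" unfolding k_def using permutes_inverses(2)[OF that(1)] g that(2)
      by (auto simp: bij_betw_def inv_into_f_f)
  qed
  have injp: "inj_on (p \<rho>) I" if r: "\<rho> permutes I" for \<rho>
  proof (rule inj_onI)
    fix i j assume ij: "i \<in> I" "j \<in> I" "p \<rho> i = p \<rho> j"
    then have "g (\<sigma> (k \<rho> i)) = g (\<sigma> (k \<rho> j))" unfolding p_def using permutes_inj[OF r] by (auto dest: injD)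
    then have "\<sigma> (k \<rho> i) = \<sigma> (k \<rho> j)" using g \<sigma>(1) kin[OF r] ij unfolding bij_betw_def inj_on_def by blast
    then have "k \<rho> i = k \<rho> j" using \<sigma>(2) kin[OF r] ij unfolding inj_on_def by blast
    then show "i = j" using hk[OF r] ij by metis
  qed
  have valid_iff: "rank_order B (\<rho> \<circ> g) \<in> valid B \<sigma> x \<longleftrightarrow> (\<lambda>i\<in>I. x (k \<rho> i)) \<in> compat n (p \<rho>) a"
    if r: "\<rho> permutes I" and x: "x \<in> B \<rightarrow>\<^sub>E {..<a}" for \<rho> x
  proof -
    have lin: "rank_order B (\<rho> \<circ> g) \<subseteq> B \<times> B" "irrefl (rank_order B (\<rho> \<circ> g))" "trans (rank_order B (\<rho> \<circ> g))"
      by (auto simp: rank_order_def irrefl_def trans_def)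
    have tot: "total_on B (rank_order B (\<rho> \<circ> g))"
    proof (rule total_onI)
      fix u v assume uv: "u \<in> B" "v \<in> B" "u \<noteq> v"
      then have "(\<rho> \<circ> g) u \<noteq> (\<rho> \<circ> g) v" using inj_onD[OF bij_betw_imp_inj_on[OF h[OF r]], of u v] by blast
      then show "(u, v) \<in> rank_order B (\<rho> \<circ> g) \<or> (v, u) \<in> rank_order B (\<rho> \<circ> g)"
        using uv by (simp add: rank_order_def nat_neq_iff)
    qed
    have "rank_order B (\<rho> \<circ> g) \<in> valid B \<sigma> x \<longleftrightarrow> (\<forall>(u, v)\<in>rank_order B (\<rho> \<circ> g). x v \<le> x u \<and>
        (x u = x v \<longrightarrow> (\<sigma> u, \<sigma> v) \<in> rank_order B (\<rho> \<circ> g)))"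
      unfolding valid_def using lin tot by simp
    also have "\<dots> \<longleftrightarrow> (\<forall>u\<in>B. \<forall>v\<in>B. \<rho> (g u) < \<rho> (g v) \<longrightarrow>
        x v \<le> x u \<and> (x u = x v \<longrightarrow> \<rho> (g (\<sigma> u)) < \<rho> (g (\<sigma> v))))"
      using \<sigma>(1) unfolding rank_order_def by auto
    also have "\<dots> \<longleftrightarrow> (\<forall>i\<in>I. \<forall>j\<in>I. i < j \<longrightarrow>
        x (k \<rho> j) \<le> x (k \<rho> i) \<and> (x (k \<rho> i) = x (k \<rho> j) \<longrightarrow> p \<rho> i < p \<rho> j))" (is "?A \<longleftrightarrow> ?B")
    proof
      assume ?A
      then show ?B unfolding p_def using kin[OF r] hk[OF r] by metis
    next
      assume ?B
      then show ?A unfolding p_def using kh[OF r] hin[OF r] by metis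
    qed
    also have "\<dots> \<longleftrightarrow> (\<lambda>i\<in>I. x (k \<rho> i)) \<in> compat n (p \<rho>) a"
    proof -
      have "(\<lambda>i\<in>I. x (k \<rho> i)) \<in> I \<rightarrow>\<^sub>E {..<a}" using x kin[OF r] by auto
      then show ?thesis unfolding compat_iff[OF injp[OF r, unfolded I_def]] I_def by simp
    qed
    finally show ?thesis .
  qed
  have cardv: "card (valid B \<sigma> x) = card {\<rho>. \<rho> permutes I \<and> (\<lambda>i\<in>I. x (k \<rho> i)) \<in> compat n (p \<rho>) a}"
    (is "_ = card ?P") if x: "x \<in> B \<rightarrow>\<^sub>E {..<a}" for x
  proof -
    have "bij_betw (\<lambda>\<rho>. rank_order B (\<rho> \<circ> g)) ?P (valid B \<sigma> x)"
      unfolding bij_betw_def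
    proof
      show "inj_on (\<lambda>\<rho>. rank_order B (\<rho> \<circ> g)) ?P"
      proof (rule inj_onI)
        fix \<rho> \<rho>' assume a: "\<rho> \<in> ?P" "\<rho>' \<in> ?P" "rank_order B (\<rho> \<circ> g) = rank_order B (\<rho>' \<circ> g)"
        have eq: "\<rho> (g u) = \<rho>' (g u)" if "u \<in> B" for u
          using card_rank_order[OF h[unfolded I_def] that, of \<rho>] card_rank_order[OF h[unfolded I_def] that, of \<rho>'] a 
          by (simp add: I_def)
        show "\<rho> = \<rho>'"
        proof
          fix i
          show "\<rho> i = \<rho>' i"
          proof (cases "i \<in> I")
            case True
            then obtain u where "u \<in> B" "g u = i" using bij_betw_imp_surj_on[OF g] unfolding I_def by (metis imageE)
            then show ?thesis using eq by blast
          next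
            case False
            then show ?thesis using a(1,2) by (auto simp: permutes_not_in)
          qed
        qed
      qed
      show "(\<lambda>\<rho>. rank_order B (\<rho> \<circ> g)) ` ?P = valid B \<sigma> x"
      proof
        show "(\<lambda>\<rho>. rank_order B (\<rho> \<circ> g)) ` ?P \<subseteq> valid B \<sigma> x"
          using valid_iff x by auto
        show "valid B \<sigma> x \<subseteq> (\<lambda>\<rho>. rank_order B (\<rho> \<circ> g)) ` ?P"
        proof
          fix R assume R: "R \<in> valid B \<sigma> x"
          then have lin: "R \<subseteq> B \<times> B" "irrefl R" "trans R" "total_on B R" unfolding valid_def by auto
          define r where "r = (\<lambda>u. Suc (card {v \<in> B. (v, u) \<in> R}))"
          have r: "bij_betw r B I" "rank_order B r = R"
            using linear_order_rank[OF finB cardB lin] unfolding r_def I_def by auto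
          define \<rho> where "\<rho> i = (if i \<in> I then r (inv_into B g i) else i)" for i
          have "bij_betw (r \<circ> inv_into B g) I I"
            using bij_betw_trans[OF bij_betw_inv_into[OF g[folded I_def]] r(1)] .
          then have "bij_betw \<rho> I I" by (rule bij_betw_cong[THEN iffD1, rotated]) (simp add: \<rho>_def)
          then have perm: "\<rho> permutes I" by (rule bij_imp_permutes) (simp add: \<rho>_def)
          have "\<rho> (g u) = r u" if "u \<in> B" for u
            using g that bij_betwE[OF g] unfolding \<rho>_def I_def by (simp add: bij_betw_def inv_into_f_f)
          then have "rank_order B (\<rho> \<circ> g) = rank_order B r" by (auto simp: rank_order_def)
          then have "rank_order B (\<rho> \<circ> g) = R" using r by simp
          then show "R \<in> (\<lambda>\<rho>. rank_order B (\<rho> \<circ> g)) ` ?P"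
            using perm valid_iff[OF perm x] R by auto
        qed
      qed
    qed
    from bij_betw_same_card[OF this] show ?thesis by (rule sym)
  qed
  have finI: "finite {\<rho>. \<rho> permutes I}" unfolding I_def by (intro finite_permutations) simp
  have "vgf B \<sigma> q a = (\<Sum>x\<in>B \<rightarrow>\<^sub>E {..<a}. \<Sum>\<rho> | \<rho> permutes I. if (\<lambda>i\<in>I. x (k \<rho> i)) \<in> compat n (p \<rho>) a then wt q B x else 0)"
    unfolding vgf_def
  proof (rule sum.cong[OF refl])
    fix x assume x: "x \<in> B \<rightarrow>\<^sub>E {..<a}"
    show "wt q B x * card (valid B \<sigma> x) = (\<Sum>\<rho> | \<rho> permutes I. if (\<lambda>i\<in>I. x (k \<rho> i)) \<in> compat n (p \<rho>) a then wt q B x else 0)"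
      using finI by (simp add: cardv[OF x] sum.If_cases Int_def mult.commute)
  qed
  also have "\<dots> = (\<Sum>\<rho> | \<rho> permutes I. \<Sum>x\<in>B \<rightarrow>\<^sub>E {..<a}. if (\<lambda>i\<in>I. x (k \<rho> i)) \<in> compat n (p \<rho>) a then wt q B x else 0)"
    by (rule sum.swap)
  also have "\<dots> = (\<Sum>\<rho> | \<rho> permutes I. pgf n (p \<rho>) q a)"
  proof (rule sum.cong[OF refl])
    fix \<rho> assume "\<rho> \<in> {\<rho>. \<rho> permutes I}"
    then have r: "\<rho> permutes I" by simp
    have "(\<Sum>x\<in>B \<rightarrow>\<^sub>E {..<a}. if (\<lambda>i\<in>I. x (k \<rho> i)) \<in> compat n (p \<rho>) a then wt q B x else 0)
      = (\<Sum>x\<in>{x \<in> B \<rightarrow>\<^sub>E {..<a}. (\<lambda>i\<in>I. x (k \<rho> i)) \<in> compat n (p \<rho>) a}. wt q B x)"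
      by (rule sum.inter_filter[symmetric]) (simp add: finB finite_PiE)
    also have "\<dots> = pgf n (p \<rho>) q a"
      unfolding pgf_def
    proof (rule sum.reindex_bij_witness[where j = "\<lambda>x. \<lambda>i\<in>I. x (k \<rho> i)" and i = "\<lambda>f. \<lambda>u\<in>B. f (\<rho> (g u))"])
      fix x assume x: "x \<in> {x \<in> B \<rightarrow>\<^sub>E {..<a}. (\<lambda>i\<in>I. x (k \<rho> i)) \<in> compat n (p \<rho>) a}"
      show "(\<lambda>u\<in>B. (\<lambda>i\<in>I. x (k \<rho> i)) (\<rho> (g u))) = x"
        using x hin[OF r] kh[OF r] by (auto simp: PiE_def extensional_def restrict_def)
      show "(\<lambda>i\<in>I. x (k \<rho> i)) \<in> compat n (p \<rho>) a" using x by blast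
      have "wt q I (\<lambda>i\<in>I. x (k \<rho> i)) = (\<Prod>i\<in>I. q ^ x (k \<rho> i))" unfolding wt_def by simp
      also have "\<dots> = wt q B x"
        unfolding wt_def by (rule prod.reindex_bij_witness[where j = "k \<rho>" and i = "\<lambda>u. \<rho> (g u)"])
          (auto simp: hk[OF r] kh[OF r] kin[OF r] hin[OF r])
      finally show "wt q {1..n} (\<lambda>i\<in>I. x (k \<rho> i)) = wt q B x" by (simp add: I_def)
    next
      fix f assume f: "f \<in> compat n (p \<rho>) a"
      have *: "(\<lambda>i\<in>I. (\<lambda>u\<in>B. f (\<rho> (g u))) (k \<rho> i)) = f"
        using f hk[OF r] kin[OF r] by (auto simp: compat_def I_def PiE_def extensional_def restrict_def)
      then show "(\<lambda>i\<in>I. (\<lambda>u\<in>B. f (\<rho> (g u))) (k \<rho> i)) = f" .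
      have "(\<lambda>u\<in>B. f (\<rho> (g u))) \<in> B \<rightarrow>\<^sub>E {..<a}"
        using compat_less[OF f] hin[OF r] by (auto simp: I_def)
      then show "(\<lambda>u\<in>B. f (\<rho> (g u))) \<in> {x \<in> B \<rightarrow>\<^sub>E {..<a}. (\<lambda>i\<in>I. x (k \<rho> i)) \<in> compat n (p \<rho>) a}"
        using f * by simp
    qed
    finally show "(\<Sum>x\<in>B \<rightarrow>\<^sub>E {..<a}. if (\<lambda>i\<in>I. x (k \<rho> i)) \<in> compat n (p \<rho>) a then wt q B x else 0) = pgf n (p \<rho>) q a" .
  qed
  finally show ?thesis unfolding p_def k_def I_def .
qed

lemma vgf_permutes:
  assumes "\<sigma> permutes {1..n}"
  shows "vgf {1..n} \<sigma> q a = (\<Sum>\<rho> | \<rho> permutes {1..n}. pgf n (\<rho> \<circ> \<sigma> \<circ> inv \<rho>) q a)"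
proof -
  have "vgf {1..n} \<sigma> q a = (\<Sum>\<rho> | \<rho> permutes {1..n}. pgf n (\<lambda>i. \<rho> (id (\<sigma> (inv_into {1..n} id (inv \<rho> i))))) q a)"
    using permutes_image[OF assms] permutes_inj_on[OF assms] by (intro vgf_eq_sum_pgf bij_betw_id) auto
  also have "\<dots> = (\<Sum>\<rho> | \<rho> permutes {1..n}. pgf n (\<rho> \<circ> \<sigma> \<circ> inv \<rho>) q a)"
  proof (intro sum.cong[OF refl] pgf_cong)
    fix \<rho> i assume "\<rho> \<in> {\<rho>. \<rho> permutes {1..n}}" "i \<in> {1..n}"
    then have "inv \<rho> i \<in> {1..n}" using permutes_in_image[OF permutes_inv[of \<rho> "{1..n}"]] by simp
    then have "inv_into {1..n} id (inv \<rho> i) = inv \<rho> i" using inv_into_f_f[of id "{1..n}" "inv \<rho> i"] by simp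
    then show "\<rho> (id (\<sigma> (inv_into {1..n} id (inv \<rho> i)))) = (\<rho> \<circ> \<sigma> \<circ> inv \<rho>) i" by simp
  qed
  finally show ?thesis .
qed

text \<open>Every relabelling conjugates the identity to itself, so all \<open>fact (card B)\<close>
  summands are the same.\<close>

lemma vgf_fixed:
  assumes fin: "finite B" and \<sigma>: "\<And>u. u \<in> B \<Longrightarrow> \<sigma> u = u"
  shows "vgf B \<sigma> q a = fact (card B) * hgf (card B) q a"
proof -
  let ?n = "card B"
  obtain g where "bij_betw g B {0..<?n}" using ex_bij_betw_finite_nat[OF fin] by blast
  moreover have "bij_betw Suc {0..<?n} {1..?n}" by (rule bij_betwI[where g = "\<lambda>i. i - 1"]) auto
  ultimately have g: "bij_betw (Suc \<circ> g) B {1..?n}" by (rule bij_betw_trans)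
  let ?g = "Suc \<circ> g"
  have "vgf B \<sigma> q a = (\<Sum>\<rho> | \<rho> permutes {1..?n}. pgf ?n (\<lambda>i. \<rho> (?g (\<sigma> (inv_into B ?g (inv \<rho> i))))) q a)"
    using \<sigma> by (intro vgf_eq_sum_pgf g) (auto simp: inj_on_def)
  also have "\<dots> = (\<Sum>\<rho> | \<rho> permutes {1..?n}. hgf ?n q a)"
    unfolding hgf_def
  proof (intro sum.cong[OF refl] pgf_cong)
    fix \<rho> i assume r: "\<rho> \<in> {\<rho>. \<rho> permutes {1..?n}}" "i \<in> {1..?n}"
    then have *: "inv \<rho> i \<in> ?g ` B" using permutes_in_image[OF permutes_inv[of \<rho> "{1..?n}"]] g by (simp add: bij_betw_def)
    then have "\<sigma> (inv_into B ?g (inv \<rho> i)) = inv_into B ?g (inv \<rho> i)" using \<sigma> inv_into_into by metis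
    then have "?g (\<sigma> (inv_into B ?g (inv \<rho> i))) = inv \<rho> i" using f_inv_into_f[OF *] by simp
    then show "\<rho> (?g (\<sigma> (inv_into B ?g (inv \<rho> i)))) = id i" using r permutes_inverses(1)[of \<rho>] by simp
  qed
  also have "\<dots> = fact ?n * hgf ?n q a" using card_permutations[of "{1..?n}" ?n] by simp
  finally show ?thesis .
qed

section \<open>Comparison of infinite words along orbits\<close>

lemma validD:
  assumes "R \<in> valid B \<sigma> x"
  shows "R \<subseteq> B \<times> B" "irrefl R" "trans R" "total_on B R"
    and "\<And>u v. (u, v) \<in> R \<Longrightarrow> x v \<le> x u"
    and "\<And>u v. (u, v) \<in> R \<Longrightarrow> x u = x v \<Longrightarrow> (\<sigma> u, \<sigma> v) \<in> R"
  using assms unfolding valid_def by auto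

lemma valid_asym: "R \<in> valid B \<sigma> x \<Longrightarrow> (u, v) \<in> R \<Longrightarrow> (v, u) \<notin> R"
  using validD(2,3)[of R B \<sigma> x] unfolding irrefl_def trans_def by blast

lemma valid_total: "R \<in> valid B \<sigma> x \<Longrightarrow> u \<in> B \<Longrightarrow> v \<in> B \<Longrightarrow> u \<noteq> v \<Longrightarrow> (u, v) \<in> R \<or> (v, u) \<in> R"
  using validD(4) unfolding total_on_def by metis

lemma funpow_closed: "\<sigma> ` B \<subseteq> B \<Longrightarrow> u \<in> B \<Longrightarrow> (\<sigma> ^^ k) u \<in> B"
  by (induction k) auto

text \<open>Equal letters pass the comparison on to the images. Totality and asymmetry give the
  reverse direction, so agreement on the first \<open>K\<close> letters preserves the order both
  ways.\<close>

lemma valid_funpow_iff: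
  assumes R: "R \<in> valid B \<sigma> x" and \<sigma>: "inj \<sigma>" "\<sigma> ` B \<subseteq> B" and vw: "v \<in> B" "w \<in> B" "v \<noteq> w"
    and eq: "\<And>k. k < K \<Longrightarrow> x ((\<sigma> ^^ k) v) = x ((\<sigma> ^^ k) w)"
  shows "((\<sigma> ^^ K) v, (\<sigma> ^^ K) w) \<in> R \<longleftrightarrow> (v, w) \<in> R"
  using eq
proof (induction K)
  case 0
  then show ?case by simp
next
  case (Suc K)
  let ?v = "(\<sigma> ^^ K) v" and ?w = "(\<sigma> ^^ K) w"
  have IH: "(?v, ?w) \<in> R \<longleftrightarrow> (v, w) \<in> R" using Suc by simp
  have in_B: "?v \<in> B" "?w \<in> B" using funpow_closed[OF \<sigma>(2)] vw by auto
  have ne: "?v \<noteq> ?w" using inj_fn[OF \<sigma>(1), of K] vw(3) by (auto dest: injD)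
  have eq: "x ?v = x ?w" using Suc.prems by simp
  have "(\<sigma> ?v, \<sigma> ?w) \<in> R" if "(?v, ?w) \<in> R" using validD(6)[OF R that eq] .
  moreover have "(\<sigma> ?w, \<sigma> ?v) \<in> R" if "(?w, ?v) \<in> R" using validD(6)[OF R that eq[symmetric]] .
  moreover have "(?v, ?w) \<in> R \<or> (?w, ?v) \<in> R" using valid_total[OF R in_B ne] .
  ultimately have "(\<sigma> ?v, \<sigma> ?w) \<in> R \<longleftrightarrow> (?v, ?w) \<in> R" using valid_asym[OF R] by blast
  then show ?case using IH by simp
qed

text \<open>The order of \<open>v\<close> and \<open>w\<close> is decided at the first place where
  their words differ, by the letters alone.\<close>

lemma valid_determined:
  assumes R: "R \<in> valid B \<sigma> x" "R' \<in> valid B \<sigma> x" and \<sigma>: "inj \<sigma>" "\<sigma> ` B \<subseteq> B" and vw: "v \<in> B" "w \<in> B"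
    and ne: "x ((\<sigma> ^^ k) v) \<noteq> x ((\<sigma> ^^ k) w)"
  shows "(v, w) \<in> R \<longleftrightarrow> (v, w) \<in> R'"
proof -
  define K where "K = (LEAST k. x ((\<sigma> ^^ k) v) \<noteq> x ((\<sigma> ^^ k) w))"
  let ?v = "(\<sigma> ^^ K) v" and ?w = "(\<sigma> ^^ K) w"
  have neK: "x ?v \<noteq> x ?w" unfolding K_def using ne by (rule LeastI)
  have eq: "x ((\<sigma> ^^ k) v) = x ((\<sigma> ^^ k) w)" if "k < K" for k
    using not_less_Least[of k "\<lambda>k. x ((\<sigma> ^^ k) v) \<noteq> x ((\<sigma> ^^ k) w)"] that unfolding K_def by blast
  have vw': "v \<noteq> w" using ne by auto
  have in_B: "?v \<in> B" "?w \<in> B" using funpow_closed[OF \<sigma>(2)] vw by auto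
  have "(v, w) \<in> S \<longleftrightarrow> x ?w < x ?v" if S: "S \<in> valid B \<sigma> x" for S
  proof -
    have "(v, w) \<in> S \<longleftrightarrow> (?v, ?w) \<in> S" using valid_funpow_iff[OF S \<sigma> vw vw' eq] by simp
    also have "\<dots> \<longleftrightarrow> x ?w < x ?v"
      using validD(5)[OF S, of ?v ?w] validD(5)[OF S, of ?w ?v] neK valid_total[OF S in_B] by fastforce
    finally show ?thesis .
  qed
  then show ?thesis using R by blast
qed

text \<open>A word with a proper period admits no compatible order: if \<open>v\<close> and its
  \<open>j\<close>-th image read the same word, their comparison repeats along all further shifts by
  \<open>j\<close>, and as \<open>\<sigma>\<close> has finite order the resulting monotone chain
  returns to \<open>v\<close>.\<close>

lemma valid_primitive:
  assumes R: "R \<in> valid B \<sigma> x" and \<sigma>: "permutation \<sigma>" "\<sigma> ` B \<subseteq> B" and v: "v \<in> B" "(\<sigma> ^^ j) v \<noteq> v"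
  shows "\<exists>k. x ((\<sigma> ^^ k) v) \<noteq> x ((\<sigma> ^^ k) ((\<sigma> ^^ j) v))"
proof (rule ccontr)
  assume "\<not> ?thesis"
  then have eq: "x ((\<sigma> ^^ k) v) = x ((\<sigma> ^^ k) ((\<sigma> ^^ j) v))" for k by simp
  have inj: "inj \<sigma>" using \<sigma>(1) by (simp add: permutation_bijective bij_is_inj)
  let ?s = "\<sigma> ^^ j"
  obtain N where N: "N > 0" "?s ^^ N = id"
    using permutation_is_nilpotent[OF permutation_funpow[OF \<sigma>(1), of j]] by blast
  have w: "?s v \<in> B" using funpow_closed[OF \<sigma>(2) v(1)] .
  have step: "((?s ^^ i) v, (?s ^^ Suc i) v) \<in> R \<longleftrightarrow> (v, ?s v) \<in> R" 
       "((?s ^^ Suc i) v, (?s ^^ i) v) \<in> R \<longleftrightarrow> (?s v, v) \<in> R" for i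
  proof -
    have e: "(\<sigma> ^^ (j * i)) (?s v) = (?s ^^ Suc i) v" "(\<sigma> ^^ (j * i)) v = (?s ^^ i) v"
      using funpow_add[of "j * i" j \<sigma>] by (simp_all add: funpow_mult add.commute)
    have "((\<sigma> ^^ (j * i)) v, (\<sigma> ^^ (j * i)) (?s v)) \<in> R \<longleftrightarrow> (v, ?s v) \<in> R"
      using valid_funpow_iff[OF R inj \<sigma>(2) v(1) w] v(2) eq by metis
    then show "((?s ^^ i) v, (?s ^^ Suc i) v) \<in> R \<longleftrightarrow> (v, ?s v) \<in> R"
      unfolding e .
    have "((\<sigma> ^^ (j * i)) (?s v), (\<sigma> ^^ (j * i)) v) \<in> R \<longleftrightarrow> (?s v, v) \<in> R"
      using valid_funpow_iff[OF R inj \<sigma>(2) w v(1)] v(2) eq by metis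
    then show "((?s ^^ Suc i) v, (?s ^^ i) v) \<in> R \<longleftrightarrow> (?s v, v) \<in> R"
      unfolding e .
  qed
  have tr: "trans R" and irr: "irrefl R" using validD[OF R] by auto
  have "(v, ?s v) \<in> R \<or> (?s v, v) \<in> R" using valid_total[OF R v(1) w] v(2) by auto
  then show False
  proof
    assume a: "(v, ?s v) \<in> R"
    have "(v, (?s ^^ Suc i) v) \<in> R" for i
    proof (induction i)
      case (Suc i)
      then show ?case using step(1)[of "Suc i"] a tr unfolding trans_def by blast
    qed (use a in simp)
    from this[of "N - 1"] have "(v, v) \<in> R" using N by simp
    then show False using irr by (simp add: irrefl_def)
  next
    assume a: "(?s v, v) \<in> R"
    have "((?s ^^ Suc i) v, v) \<in> R" for i
    proof (induction i)
      case (Suc i)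
      then show ?case using step(2)[of "Suc i"] a tr unfolding trans_def by blast
    qed (use a in simp)
    from this[of "N - 1"] have "(v, v) \<in> R" using N by simp
    then show False using irr by (simp add: irrefl_def)
  qed
qed

lemma valid_cong:
  assumes "\<And>u. u \<in> B \<Longrightarrow> x u = y u"
  shows "valid B \<sigma> x = valid B \<sigma> y"
proof -
  have "(\<forall>(u, v)\<in>R. x v \<le> x u \<and> (x u = x v \<longrightarrow> (\<sigma> u, \<sigma> v) \<in> R)) \<longleftrightarrow>
     (\<forall>(u, v)\<in>R. y v \<le> y u \<and> (y u = y v \<longrightarrow> (\<sigma> u, \<sigma> v) \<in> R))" if "R \<subseteq> B \<times> B" for R
    using that assms by (intro ball_cong refl) auto
  then show ?thesis unfolding valid_def by blast
qed

lemma valid_restrict: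
  assumes R: "R \<in> valid B \<sigma> x" and B': "B' \<subseteq> B" "\<sigma> ` B' \<subseteq> B'"
  shows "R \<inter> B' \<times> B' \<in> valid B' \<sigma> x"
  using validD[OF R] B' unfolding valid_def irrefl_def trans_def total_on_def by auto blast+

text \<open>Given the order on \<open>B'\<close>, the order on \<open>B' \<union> orbit \<sigma> u\<close> is determined by the place of \<open>u\<close>
  among the elements of \<open>B'\<close> that read the same infinite word as \<open>u\<close>.\<close>

lemma card_valid_orbit:
  assumes fin: "finite B" and \<sigma>: "permutation \<sigma>" "\<sigma> ` B \<subseteq> B" and B: "B = B' \<union> orbit \<sigma> u"
    and B': "\<sigma> ` B' \<subseteq> B'" "B' \<inter> orbit \<sigma> u = {}"
  shows "card (valid B \<sigma> x) \<le> card (valid B' \<sigma> x) * (1 + card {v \<in> B'. \<forall>k. x ((\<sigma> ^^ k) v) = x ((\<sigma> ^^ k) u)})"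
proof -
  define E where "E = {v \<in> B'. \<forall>k. x ((\<sigma> ^^ k) v) = x ((\<sigma> ^^ k) u)}"
  define cut where "cut R = {v \<in> E. (v, u) \<in> R}" for R
  have finE: "finite E" using fin B unfolding E_def by auto
  have inj: "inj \<sigma>" using \<sigma>(1) by (simp add: permutation_bijective bij_is_inj)
  have uB: "u \<in> B" and uB': "u \<notin> B'" using permutation_self_in_orbit[OF \<sigma>(1)] B B' by auto
  have EB: "E \<subseteq> B" using B by (auto simp: E_def)
  \<comment> \<open>\<open>cut R\<close> consists of the labels of \<open>B'\<close> that read the
    word of \<open>u\<close> and are placed before \<open>u\<close>. By transitivity it is an
    initial segment of \<open>E\<close> in the order on \<open>B'\<close>, so its size determines
    it.\<close>
  have "inj_on (\<lambda>R. (R \<inter> B' \<times> B', card (cut R))) (valid B \<sigma> x)"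
  proof (rule inj_onI)
    fix R R' assume R: "R \<in> valid B \<sigma> x" and R': "R' \<in> valid B \<sigma> x"
      and "(R \<inter> B' \<times> B', card (cut R)) = (R' \<inter> B' \<times> B', card (cut R'))"
    then have eq: "R \<inter> B' \<times> B' = R' \<inter> B' \<times> B'" and card_eq: "card (cut R) = card (cut R')" by auto
    have down: "v \<in> cut S" if S: "S \<in> valid B \<sigma> x" and "w \<in> cut S" "v \<in> E" "(v, w) \<in> S" for S v w
      using that validD(3)[OF S] unfolding cut_def trans_def by blast
    have "cut R \<subseteq> cut R' \<or> cut R' \<subseteq> cut R"
    proof (rule ccontr)
      assume "\<not> ?thesis"
      then obtain v w where vw: "v \<in> cut R" "v \<notin> cut R'" "w \<in> cut R'" "w \<notin> cut R" by blast
      then have in_E: "v \<in> E" "w \<in> E" by (auto simp: cut_def)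
      then have "v \<in> B'" "w \<in> B'" "v \<noteq> w" using vw by (auto simp: E_def)
      moreover from this have "(v, w) \<in> R \<or> (w, v) \<in> R" using validD(4)[OF R] B unfolding total_on_def by blast
      ultimately show False using down[OF R] down[OF R'] vw in_E eq by blast
    qed
    moreover have "finite (cut R)" "finite (cut R')" using finE by (auto simp: cut_def)
    ultimately have cut_eq: "cut R = cut R'" using card_eq card_subset_eq by metis
    \<comment> \<open>If the words agree, moving both labels along until \<open>w\<close> reaches
      \<open>u\<close> takes \<open>v\<close> to a label of \<open>E\<close>, whose place relative
      to \<open>u\<close> is known from the cut.\<close>
    have cross: "(v, w) \<in> R \<longleftrightarrow> (v, w) \<in> R'" if v: "v \<in> B'" and w: "w \<in> orbit \<sigma> u" for v w
    proof (cases "\<forall>k. x ((\<sigma> ^^ k) v) = x ((\<sigma> ^^ k) w)")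
      case False
      then show ?thesis using valid_determined[OF R R' inj \<sigma>(2)] v w B by blast
    next
      case True
      have "u \<in> orbit \<sigma> w" using orbit_swap[OF permutation_self_in_orbit[OF \<sigma>(1)] w] .
      then obtain j where j: "u = (\<sigma> ^^ j) w" unfolding orbit_altdef by blast
      let ?v = "(\<sigma> ^^ j) v"
      have vB: "?v \<in> B'" using funpow_closed[OF B'(1) v] .
      have "x ((\<sigma> ^^ k) ?v) = x ((\<sigma> ^^ k) u)" for k
        using True[rule_format, of "k + j"] unfolding j by (simp add: funpow_add)
      then have "?v \<in> E" using vB by (simp add: E_def)
      then have "(?v, u) \<in> R \<longleftrightarrow> (?v, u) \<in> R'" using cut_eq unfolding cut_def by blast
      moreover have vw: "v \<in> B" "w \<in> B" "v \<noteq> w" using v w B B' by auto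
      have "(?v, u) \<in> S \<longleftrightarrow> (v, w) \<in> S" if "S \<in> valid B \<sigma> x" for S
        unfolding j using valid_funpow_iff[OF that inj \<sigma>(2) vw] True by blast
      ultimately show ?thesis using R R' by blast
    qed
    have cross': "(w, v) \<in> R \<longleftrightarrow> (w, v) \<in> R'" if v: "v \<in> B'" and w: "w \<in> orbit \<sigma> u" for v w
    proof -
      have vw: "v \<in> B" "w \<in> B" "v \<noteq> w" using v w B B' by auto
      then have "(w, v) \<in> S \<longleftrightarrow> (v, w) \<notin> S" if S: "S \<in> valid B \<sigma> x" for S
        using valid_asym[OF S, of v w] validD(4)[OF S] unfolding total_on_def by blast
      then show ?thesis using cross[OF v w] R R' by blast
    qed
    \<comment> \<open>Within one orbit different labels read different words, because compatible
      orders exist only for primitive words.\<close>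
    have same: "(v, w) \<in> R \<longleftrightarrow> (v, w) \<in> R'" if v: "v \<in> orbit \<sigma> u" and w: "w \<in> orbit \<sigma> u" for v w
    proof (cases "v = w")
      case True
      then show ?thesis using validD(2)[OF R] validD(2)[OF R'] by (simp add: irrefl_def)
    next
      case False
      have "w \<in> orbit \<sigma> v" using orbit_swap[OF permutation_self_in_orbit[OF \<sigma>(1)] v] w orbit_trans by metis
      then obtain j where j: "w = (\<sigma> ^^ j) v" unfolding orbit_altdef by blast
      have vB: "v \<in> B" "w \<in> B" using v w B by auto
      obtain k where "x ((\<sigma> ^^ k) v) \<noteq> x ((\<sigma> ^^ k) w)"
        using valid_primitive[OF R \<sigma> vB(1), of j] False unfolding j by auto
      then show ?thesis using valid_determined[OF R R' inj \<sigma>(2) vB] by blast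
    qed
    show "R = R'"
    proof -
      have "(v, w) \<in> R \<longleftrightarrow> (v, w) \<in> R'" if vw: "v \<in> B" "w \<in> B" for v w
      proof -
        consider "v \<in> B'" "w \<in> B'" | "v \<in> B'" "w \<in> orbit \<sigma> u" | "v \<in> orbit \<sigma> u" "w \<in> B'" | "v \<in> orbit \<sigma> u" "w \<in> orbit \<sigma> u"
          using vw B by blast
        then show ?thesis
          by cases (use eq in blast, use cross in blast, use cross' in blast, use same in blast)
      qed
      then show ?thesis using validD(1)[OF R] validD(1)[OF R'] by blast
    qed
  qed
  moreover have "(\<lambda>R. (R \<inter> B' \<times> B', card (cut R))) ` valid B \<sigma> x \<subseteq> valid B' \<sigma> x \<times> {..card E}"
    using valid_restrict[OF _ _ B'(1)] B card_mono[OF finE, of "cut _"] by (auto simp: cut_def)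
  moreover have "finite (valid B' \<sigma> x \<times> {..card E})" using finite_valid[of B'] fin B by simp
  ultimately have "card (valid B \<sigma> x) \<le> card (valid B' \<sigma> x \<times> {..card E})"
    by (rule card_inj_on_le)
  then show ?thesis by (simp add: card_cartesian_product E_def)
qed

section \<open>Counting compatible orders\<close>

lemma sum_PiE_Un:
  assumes "B \<inter> C = {}"
  shows "(\<Sum>x\<in>(B \<union> C) \<rightarrow>\<^sub>E A. f x) = (\<Sum>x\<in>B \<rightarrow>\<^sub>E A. \<Sum>z\<in>C \<rightarrow>\<^sub>E A. f (merge B C (x, z)))"
proof -
  have "(\<Sum>x\<in>B \<rightarrow>\<^sub>E A. \<Sum>z\<in>C \<rightarrow>\<^sub>E A. f (merge B C (x, z))) = (\<Sum>p\<in>(B \<rightarrow>\<^sub>E A) \<times> (C \<rightarrow>\<^sub>E A). f (merge B C p))"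
    by (simp add: sum.cartesian_product)
  also have "\<dots> = (\<Sum>x\<in>(B \<union> C) \<rightarrow>\<^sub>E A. f x)"
  proof (rule sum.reindex_bij_witness[where j = "merge B C" and i = "\<lambda>x. (restrict x B, restrict x C)"])
    fix p assume "p \<in> (B \<rightarrow>\<^sub>E A) \<times> (C \<rightarrow>\<^sub>E A)"
    then obtain x z where p: "p = (x, z)" "x \<in> B \<rightarrow>\<^sub>E A" "z \<in> C \<rightarrow>\<^sub>E A" by auto
    have r: "restrict x B = x" "restrict z C = z" using p by (auto simp: PiE_def extensional_restrict)
    show "(restrict (merge B C p) B, restrict (merge B C p) C) = p" 
      using assms r by (simp add: p(1))
    show "merge B C p \<in> (B \<union> C) \<rightarrow>\<^sub>E A" using p assms by (auto simp: PiE_def Pi_def extensional_def merge_def)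
  next
    fix x assume x: "x \<in> (B \<union> C) \<rightarrow>\<^sub>E A"
    then show "merge B C (restrict x B, restrict x C) = x" by (auto simp: merge_def PiE_def extensional_def fun_eq_iff)
    show "(restrict x B, restrict x C) \<in> (B \<rightarrow>\<^sub>E A) \<times> (C \<rightarrow>\<^sub>E A)" using x by (auto simp: PiE_def Pi_def)
  qed simp
  finally show ?thesis by simp
qed

lemma sum_wt: "finite C \<Longrightarrow> (\<Sum>z\<in>C \<rightarrow>\<^sub>E {..<a}. wt q C z) = (\<Sum>y<a. q ^ y) ^ card C"
  unfolding wt_def using prod_sum_PiE[of C "\<lambda>_. {..<a}" "\<lambda>_ y. q ^ y"] by simp

text \<open>Each weight is at most 1, so a letter that is a function of the others contributes a
  factor 1 instead of the geometric sum.\<close>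

lemma sum_wt_determined:
  assumes fin: "finite C" and D: "D \<subseteq> C" and Z: "Z \<subseteq> C \<rightarrow>\<^sub>E {..<a}" and q: "0 \<le> q" "q \<le> 1"
    and inj: "inj_on (\<lambda>z. restrict z (C - D)) Z"
  shows "(\<Sum>z\<in>Z. wt q C z) \<le> (\<Sum>y<a. q ^ y) ^ (card C - card D)"
proof -
  have finD: "finite D" using fin D finite_subset by blast
  have "(\<Sum>z\<in>Z. wt q C z) \<le> (\<Sum>z\<in>Z. wt q (C - D) (restrict z (C - D)))"
  proof (rule sum_mono)
    fix z assume "z \<in> Z"
    have "wt q C z = wt q (C - D) z * wt q D z"
      using wt_Un[of "C - D" D q z] fin finD D by (simp add: Un_absorb2 Diff_disjoint[of D C, unfolded Int_commute[of D]])
    also have "\<dots> \<le> wt q (C - D) z" using wt_nonneg[OF q(1)] wt_le_1[OF q] by (intro mult_left_le) auto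
    also have "\<dots> = wt q (C - D) (restrict z (C - D))" by (rule wt_cong) simp
    finally show "wt q C z \<le> wt q (C - D) (restrict z (C - D))" .
  qed
  also have "\<dots> = (\<Sum>y\<in>(\<lambda>z. restrict z (C - D)) ` Z. wt q (C - D) y)"
    using inj by (simp add: sum.reindex)
  also have "\<dots> \<le> (\<Sum>y\<in>(C - D) \<rightarrow>\<^sub>E {..<a}. wt q (C - D) y)"
    using Z fin by (intro sum_mono2 finite_PiE wt_nonneg q) (auto simp: PiE_def Pi_def)
  also have "\<dots> = (\<Sum>y<a. q ^ y) ^ (card C - card D)"
    using fin D finD by (simp add: sum_wt card_Diff_subset)
  finally show ?thesis .
qed

lemma vgf_nonneg: "0 \<le> q \<Longrightarrow> 0 \<le> vgf B \<sigma> q a"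
  unfolding vgf_def by (intro sum_nonneg mult_nonneg_nonneg wt_nonneg) auto

lemma wt_merge:
  assumes "finite B" "finite C" "B \<inter> C = {}"
  shows "wt q (B \<union> C) (merge B C (x, z)) = wt q B x * wt q C z"
proof -
  have "wt q B (merge B C (x, z)) = wt q B x" "wt q C (merge B C (x, z)) = wt q C z"
    using assms(3) by (auto intro!: wt_cong simp: merge_def)
  then show ?thesis using wt_Un[OF assms] by simp
qed

text \<open>Without coincidences the orbit contributes its free letters, which gives the power of
  the geometric sum. Each \<open>v\<close> in \<open>B'\<close> adds a possible place for
  \<open>u\<close> only if the orbit reads the word of \<open>v\<close>; this fixes every letter of
  the orbit, so it adds at most 1 to the factor.\<close>

lemma vgf_orbit_le:
  assumes fin: "finite B'" and \<sigma>: "permutation \<sigma>" "\<sigma> ` B' \<subseteq> B'" "B' \<inter> orbit \<sigma> u = {}" and q: "0 \<le> q" "q \<le> 1"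
  shows "vgf (B' \<union> orbit \<sigma> u) \<sigma> q a \<le> vgf B' \<sigma> q a * ((\<Sum>y<a. q ^ y) ^ card (orbit \<sigma> u) + card B')"
proof -
  define C where "C = orbit \<sigma> u"
  define P where "P = (\<Sum>y<a. q ^ y)"
  define A where "A = {..<a}"
  have u: "u \<in> C" unfolding C_def using permutation_self_in_orbit[OF \<sigma>(1)] .
  have finC: "finite C" unfolding C_def using finite_orbit[OF permutation_self_in_orbit[OF \<sigma>(1)]] .
  have disj: "B' \<inter> C = {}" using \<sigma>(3) by (simp add: C_def)
  have clC: "\<sigma> ` C \<subseteq> C" unfolding C_def by (auto intro: orbit.step)
  have clB: "\<sigma> ` (B' \<union> C) \<subseteq> B' \<union> C" using clC \<sigma>(2) by blast
  have C_iter: "w \<in> C \<longleftrightarrow> (\<exists>k. w = (\<sigma> ^^ k) u)" for w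
    unfolding C_def orbit_altdef_permutation[OF \<sigma>(1)] by auto
  define M where "M x v = {z \<in> C \<rightarrow>\<^sub>E A. \<forall>k. x ((\<sigma> ^^ k) v) = z ((\<sigma> ^^ k) u)}" for x v
  have finA: "finite (C \<rightarrow>\<^sub>E A)" using finC by (simp add: A_def finite_PiE)
  have M_le: "(\<Sum>z\<in>M x v. wt q C z) \<le> 1" for x v
  proof -
    have "inj_on (\<lambda>z. restrict z (C - C)) (M x v)"
    proof (rule inj_onI)
      fix z z' assume z: "z \<in> M x v" "z' \<in> M x v"
      have "z w = z' w" if "w \<in> C" for w
      proof -
        obtain k where "w = (\<sigma> ^^ k) u" using \<open>w \<in> C\<close> C_iter by blast
        then show ?thesis using z by (auto simp: M_def)
      qed
      then show "z = z'" using z by (auto simp: M_def intro: PiE_ext)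
    qed
    then show ?thesis using sum_wt_determined[OF finC, of C "M x v" a q] q by (auto simp: M_def A_def)
  qed
  have "vgf (B' \<union> C) \<sigma> q a = (\<Sum>x\<in>B' \<rightarrow>\<^sub>E A. \<Sum>z\<in>C \<rightarrow>\<^sub>E A.
      wt q B' x * wt q C z * card (valid (B' \<union> C) \<sigma> (merge B' C (x, z))))"
    unfolding vgf_def A_def[symmetric] sum_PiE_Un[OF disj] wt_merge[OF fin finC disj] ..
  also have "\<dots> \<le> (\<Sum>x\<in>B' \<rightarrow>\<^sub>E A. \<Sum>z\<in>C \<rightarrow>\<^sub>E A.
      wt q B' x * card (valid B' \<sigma> x) * (wt q C z * (1 + (\<Sum>v\<in>B'. of_bool (z \<in> M x v)))))"
  proof (intro sum_mono)
    fix x z assume x: "x \<in> B' \<rightarrow>\<^sub>E A" and z: "z \<in> C \<rightarrow>\<^sub>E A"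
    let ?m = "merge B' C (x, z)"
    have mC: "?m w = z w" if "w \<in> C" for w using that disj by (auto simp: merge_def)
    have mB: "?m w = x w" if "w \<in> B'" for w using that disj by (auto simp: merge_def)
    have "(\<forall>k. ?m ((\<sigma> ^^ k) v) = ?m ((\<sigma> ^^ k) u)) \<longleftrightarrow> z \<in> M x v" if v: "v \<in> B'" for v
      using mB[OF funpow_closed[OF \<sigma>(2) v]] mC[OF funpow_closed[OF clC u]] z by (simp add: M_def)
    then have E: "{v \<in> B'. \<forall>k. ?m ((\<sigma> ^^ k) v) = ?m ((\<sigma> ^^ k) u)} = {v \<in> B'. z \<in> M x v}" by auto
    have "card (valid (B' \<union> C) \<sigma> ?m) \<le> card (valid B' \<sigma> ?m) * (1 + card {v \<in> B'. z \<in> M x v})"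
      unfolding E[symmetric] using \<sigma> fin finC clB by (intro card_valid_orbit) (auto simp: C_def)
    also have "valid B' \<sigma> ?m = valid B' \<sigma> x" using mB by (rule valid_cong)
    finally have "real (card (valid (B' \<union> C) \<sigma> ?m)) \<le> real (card (valid B' \<sigma> x) * (1 + card {v \<in> B'. z \<in> M x v}))"
      by (rule of_nat_mono)
    also have "\<dots> = real (card (valid B' \<sigma> x)) * (1 + (\<Sum>v\<in>B'. of_bool (z \<in> M x v)))"
      using fin by (simp add: Int_def distrib_left)
    finally have "wt q B' x * wt q C z * real (card (valid (B' \<union> C) \<sigma> ?m))
      \<le> wt q B' x * wt q C z * (real (card (valid B' \<sigma> x)) * (1 + (\<Sum>v\<in>B'. of_bool (z \<in> M x v))))"
      by (rule mult_left_mono) (intro mult_nonneg_nonneg wt_nonneg q)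
    then show "wt q B' x * wt q C z * card (valid (B' \<union> C) \<sigma> ?m)
      \<le> wt q B' x * card (valid B' \<sigma> x) * (wt q C z * (1 + (\<Sum>v\<in>B'. of_bool (z \<in> M x v))))"
      by (simp only: mult_ac)
  qed
  also have "\<dots> = (\<Sum>x\<in>B' \<rightarrow>\<^sub>E A. wt q B' x * card (valid B' \<sigma> x) * (\<Sum>z\<in>C \<rightarrow>\<^sub>E A. 
      wt q C z * (1 + (\<Sum>v\<in>B'. of_bool (z \<in> M x v)))))"
    by (simp add: sum_distrib_left)
  also have "\<dots> \<le> (\<Sum>x\<in>B' \<rightarrow>\<^sub>E A. wt q B' x * card (valid B' \<sigma> x) * (P ^ card C + card B'))"
  proof (intro sum_mono mult_left_mono mult_nonneg_nonneg wt_nonneg q)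
    fix x
    have "(\<Sum>z\<in>C \<rightarrow>\<^sub>E A. wt q C z * (1 + (\<Sum>v\<in>B'. of_bool (z \<in> M x v))))
       = (\<Sum>z\<in>C \<rightarrow>\<^sub>E A. wt q C z) + (\<Sum>z\<in>C \<rightarrow>\<^sub>E A. \<Sum>v\<in>B'. wt q C z * of_bool (z \<in> M x v))"
      by (simp add: distrib_left sum.distrib sum_distrib_left)
    also have "(\<Sum>z\<in>C \<rightarrow>\<^sub>E A. \<Sum>v\<in>B'. wt q C z * of_bool (z \<in> M x v)) = (\<Sum>v\<in>B'. \<Sum>z\<in>C \<rightarrow>\<^sub>E A. wt q C z * of_bool (z \<in> M x v))"
      by (rule sum.swap)
    also have "\<dots> = (\<Sum>v\<in>B'. \<Sum>z\<in>M x v. wt q C z)"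
    proof (rule sum.cong[OF refl])
      fix v
      have "M x v = {z \<in> C \<rightarrow>\<^sub>E A. z \<in> M x v}" by (auto simp: M_def)
      then have "(\<Sum>z\<in>M x v. wt q C z) = (\<Sum>z\<in>C \<rightarrow>\<^sub>E A. if z \<in> M x v then wt q C z else 0)"
        using sum.inter_filter[OF finA, of "wt q C" "\<lambda>z. z \<in> M x v"] by metis
      also have "\<dots> = (\<Sum>z\<in>C \<rightarrow>\<^sub>E A. wt q C z * of_bool (z \<in> M x v))"
        by (intro sum.cong) auto
      finally show "(\<Sum>z\<in>C \<rightarrow>\<^sub>E A. wt q C z * of_bool (z \<in> M x v)) = (\<Sum>z\<in>M x v. wt q C z)" ..
    qed
    also have "\<dots> \<le> (\<Sum>v\<in>B'. 1)" by (intro sum_mono M_le)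
    finally show "(\<Sum>z\<in>C \<rightarrow>\<^sub>E A. wt q C z * (1 + (\<Sum>v\<in>B'. of_bool (z \<in> M x v)))) \<le> P ^ card C + card B'"
      using sum_wt[OF finC, of q a] by (simp add: P_def A_def)
  qed auto
  also have "\<dots> = vgf B' \<sigma> q a * (P ^ card C + card B')"
    unfolding vgf_def A_def by (simp add: sum_distrib_right)
  finally show ?thesis unfolding C_def P_def .
qed

section \<open>Bounds on S(a) relative to the fixed points\<close>

lemma orbit_Diff_closed:
  assumes "permutation \<sigma>" "\<sigma> ` B \<subseteq> B"
  shows "\<sigma> ` (B - orbit \<sigma> u) \<subseteq> B - orbit \<sigma> u"
proof clarify
  fix v assume v: "v \<in> B" "v \<notin> orbit \<sigma> u"
  have "\<sigma> v \<notin> orbit \<sigma> u"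
  proof
    assume "\<sigma> v \<in> orbit \<sigma> u"
    moreover have "\<sigma> v \<in> orbit \<sigma> v" by (rule orbit.base)
    then have "v \<in> orbit \<sigma> (\<sigma> v)" using orbit_swap[OF permutation_self_in_orbit[OF assms(1)]] by metis
    ultimately have "v \<in> orbit \<sigma> u" using orbit_trans by metis
    then show False using v by blast
  qed
  then show "\<sigma> v \<in> B - orbit \<sigma> u" using assms v by blast
qed

text \<open>The nontrivial orbits are removed one at a time. Each has length at least 2, so its
  additive error is at most the fraction \<open>n / P\<^sup>2\<close> of its main term; raising the
  factor \<open>1 + n / P\<^sup>2\<close> to the orbit length makes the bound
  multiplicative.\<close>

lemma vgf_le:
  fixes a :: nat
  assumes \<sigma>: "permutation \<sigma>" and q: "0 \<le> q" "q \<le> 1" and a: "1 \<le> a"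
    and B: "finite B" "\<sigma> ` B \<subseteq> B" "card B \<le> n"
  defines "P \<equiv> \<Sum>y<a. q ^ y"
  shows "vgf B \<sigma> q a \<le> vgf {u \<in> B. \<sigma> u = u} \<sigma> q a * (P * (1 + n / P\<^sup>2)) ^ card {u \<in> B. \<sigma> u \<noteq> u}"
  using B
proof (induction "card B" arbitrary: B rule: less_induct)
  case (less B)
  have P1: "1 \<le> P"
  proof -
    have "(\<Sum>y<1. q ^ y) \<le> P" unfolding P_def using a q by (intro sum_mono2) auto
    then show ?thesis by simp
  qed
  show ?case
  proof (cases "\<forall>u\<in>B. \<sigma> u = u")
    case True
    then have F: "{u \<in> B. \<sigma> u = u} = B" and N: "{u \<in> B. \<sigma> u \<noteq> u} = {}" by auto
    show ?thesis unfolding F N by simp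
  next
    case False
    then obtain u where u: "u \<in> B" "\<sigma> u \<noteq> u" by blast
    let ?C = "orbit \<sigma> u"
    let ?B = "B - ?C"
    have C: "?C \<subseteq> B" using orbit_altdef[of \<sigma> u] funpow_closed[OF less.prems(2) u(1)] by auto
    have finC: "finite ?C" using C less.prems(1) finite_subset by blast
    have uC: "u \<in> ?C" "\<sigma> u \<in> ?C" using permutation_self_in_orbit[OF \<sigma>] by (auto intro: orbit.base)
    have cl: "\<sigma> ` ?B \<subseteq> ?B" using orbit_Diff_closed[OF \<sigma> less.prems(2)] .
    have card_lt: "card ?B < card B" using u uC less.prems(1) by (intro psubset_card_mono) auto
    have card_C: "2 \<le> card ?C" using card_mono[OF finC, of "{u, \<sigma> u}"] uC u(2) by simp
    have C_nofix: "\<sigma> v \<noteq> v" if "v \<in> ?C" for v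
    proof
      assume "\<sigma> v = v"
      then have "orbit \<sigma> v = {v}" by (simp add: orbit_eq_singleton_iff)
      moreover have "u \<in> orbit \<sigma> v" using orbit_swap[OF permutation_self_in_orbit[OF \<sigma>] that] .
      ultimately show False using u(2) \<open>\<sigma> v = v\<close> by auto
    qed
    then have F: "{v \<in> ?B. \<sigma> v = v} = {v \<in> B. \<sigma> v = v}" by auto
    have N: "{v \<in> B. \<sigma> v \<noteq> v} = {v \<in> ?B. \<sigma> v \<noteq> v} \<union> ?C" using C C_nofix by auto
    have card_N: "card {v \<in> B. \<sigma> v \<noteq> v} = card {v \<in> ?B. \<sigma> v \<noteq> v} + card ?C"
      unfolding N using less.prems(1) finC by (intro card_Un_disjoint) auto
    let ?Q = "P * (1 + n / P\<^sup>2)"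
    have "P ^ card ?C + card ?B \<le> P ^ card ?C + P ^ card ?C * (n / P\<^sup>2)"
    proof -
      have "P\<^sup>2 \<le> P ^ card ?C" using card_C P1 by (rule power_increasing)
      then have "1 \<le> P ^ card ?C / P\<^sup>2" using P1 by (simp add: field_simps)
      then have "1 * real (card ?B) \<le> P ^ card ?C / P\<^sup>2 * n"
        using card_lt less.prems(3) by (intro mult_mono) auto
      then show ?thesis by simp
    qed
    also have "\<dots> = P ^ card ?C * (1 + n / P\<^sup>2) ^ 1" by (simp add: algebra_simps)
    also have "\<dots> \<le> P ^ card ?C * (1 + n / P\<^sup>2) ^ card ?C"
      using P1 card_C by (intro mult_left_mono power_increasing) auto
    finally have fac: "P ^ card ?C + card ?B \<le> ?Q ^ card ?C" by (simp add: power_mult_distrib)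
    have "vgf B \<sigma> q a = vgf (?B \<union> ?C) \<sigma> q a" using C by (simp add: Un_absorb2)
    also have "\<dots> \<le> vgf ?B \<sigma> q a * (P ^ card ?C + card ?B)"
      unfolding P_def using less.prems(1) \<sigma> cl q by (intro vgf_orbit_le) auto
    also have "\<dots> \<le> vgf ?B \<sigma> q a * ?Q ^ card ?C"
      using fac vgf_nonneg[OF q(1)] by (intro mult_left_mono) auto
    also have "\<dots> \<le> (vgf {u \<in> B. \<sigma> u = u} \<sigma> q a * ?Q ^ card {v \<in> ?B. \<sigma> v \<noteq> v}) * ?Q ^ card ?C"
      using less.hyps[OF card_lt _ cl] less.prems card_lt P1 unfolding F by (intro mult_right_mono) auto
    finally show ?thesis unfolding card_N by (simp add: power_add mult_ac)
  qed
qed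

text \<open>If the pairs \<open>(x u, x (\<sigma> u))\<close> are distinct apart from fixed points, ordering the labels
  lexicographically by these pairs extends any order of the fixed points.\<close>

lemma card_valid_ge:
  fixes B :: "'a set"
  assumes fin: "finite B" and \<sigma>: "inj \<sigma>" "\<sigma> ` B \<subseteq> B"
    and good: "\<And>u v. u \<in> B \<Longrightarrow> \<sigma> u \<noteq> u \<Longrightarrow> v \<in> B \<Longrightarrow> u \<noteq> v \<Longrightarrow> \<not> (x u = x v \<and> x (\<sigma> u) = x (\<sigma> v))"
  shows "card (valid {u \<in> B. \<sigma> u = u} \<sigma> x) \<le> card (valid B \<sigma> x)"
proof (rule card_inj_on_le)
  let ?F = "{u \<in> B. \<sigma> u = u}"
  define lex where "lex u v \<longleftrightarrow> x v < x u \<or> (x u = x v \<and> x (\<sigma> v) < x (\<sigma> u))" for u v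
  define tie where "tie u v \<longleftrightarrow> x u = x v \<and> x (\<sigma> u) = x (\<sigma> v)" for u v
  define ext where "ext R = {(u, v) \<in> B \<times> B. lex u v \<or> (tie u v \<and> (u, v) \<in> R)}" for R :: "('a \<times> 'a) set"
  have tie_fixed: "\<sigma> u = u \<and> \<sigma> v = v" if "tie u v" "u \<noteq> v" "u \<in> B" "v \<in> B" for u v
    using good[of u v] good[of v u] that unfolding tie_def by metis
  have lex_cases: "lex u v \<or> lex v u \<or> tie u v" for u v unfolding lex_def tie_def by auto
  show "finite (valid B \<sigma> x)" using finite_valid fin by blast
  show "ext ` valid ?F \<sigma> x \<subseteq> valid B \<sigma> x"
  proof clarify
    fix R assume R: "R \<in> valid ?F \<sigma> x"
    show "ext R \<in> valid B \<sigma> x"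
      unfolding valid_def
    proof (intro CollectI conjI)
      show "ext R \<subseteq> B \<times> B" by (auto simp: ext_def)
      show "irrefl (ext R)" using validD(2)[OF R] by (auto simp: irrefl_def ext_def lex_def)
      show "trans (ext R)"
      proof (rule transI)
        fix u v w assume uvw: "(u, v) \<in> ext R" "(v, w) \<in> ext R"
        have tr: "(u, w) \<in> R" if "(u, v) \<in> R" "(v, w) \<in> R" using validD(3)[OF R] that by (rule transD)
        then show "(u, w) \<in> ext R" using uvw unfolding ext_def lex_def tie_def by auto
      qed
      show "total_on B (ext R)"
      proof (rule total_onI)
        fix u v assume uv: "u \<in> B" "v \<in> B" "u \<noteq> v"
        show "(u, v) \<in> ext R \<or> (v, u) \<in> ext R"
        proof (cases "tie u v")
          case True
          then have "(u, v) \<in> R \<or> (v, u) \<in> R"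
            using valid_total[OF R, of u v] tie_fixed[OF True uv(3,1,2)] uv by simp
          then show ?thesis using True uv by (auto simp: ext_def tie_def)
        next
          case False
          then show ?thesis using lex_cases[of u v] uv by (auto simp: ext_def)
        qed
      qed
      show "\<forall>(u, v)\<in>ext R. x v \<le> x u \<and> (x u = x v \<longrightarrow> (\<sigma> u, \<sigma> v) \<in> ext R)"
      proof clarify
        fix u v assume uv: "(u, v) \<in> ext R"
        then have B: "u \<in> B" "v \<in> B" by (auto simp: ext_def)
        have "x v \<le> x u" using uv by (auto simp: ext_def lex_def tie_def)
        moreover have "(\<sigma> u, \<sigma> v) \<in> ext R" if eq: "x u = x v"
        proof (cases "tie u v")
          case True
          then have "(u, v) \<in> R" using uv by (auto simp: ext_def lex_def tie_def)
          then have "u \<noteq> v" using validD(2)[OF R] by (auto simp: irrefl_def)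
          then have "\<sigma> u = u" "\<sigma> v = v" using tie_fixed[OF True] B by auto
          then show ?thesis using uv by simp
        next
          case False
          then have "x (\<sigma> v) < x (\<sigma> u)" using uv eq by (auto simp: ext_def lex_def)
          then show ?thesis using B \<sigma>(2) by (auto simp: ext_def lex_def)
        qed
        ultimately show "x v \<le> x u \<and> (x u = x v \<longrightarrow> (\<sigma> u, \<sigma> v) \<in> ext R)" by blast
      qed
    qed
  qed
  \<comment> \<open>Labels of \<open>?F\<close> with different letters are ordered by their letters
    in every compatible order, and those with equal letters inherit \<open>R\<close>; hence
    restriction to \<open>?F\<close> undoes \<open>ext\<close>.\<close>
  show "inj_on ext (valid ?F \<sigma> x)"
  proof (rule inj_on_inverseI)
    fix R assume R: "R \<in> valid ?F \<sigma> x"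
    have "(u, v) \<in> ext R \<longleftrightarrow> (u, v) \<in> R" if uv: "u \<in> ?F" "v \<in> ?F" for u v
    proof (cases "x u = x v")
      case True
      then show ?thesis using uv by (auto simp: ext_def lex_def tie_def)
    next
      case False
      then have "u \<noteq> v" by auto
      then have "(u, v) \<in> R \<longleftrightarrow> x v < x u"
        using False valid_total[OF R uv] validD(5)[OF R, of u v] validD(5)[OF R, of v u] by force
      then show ?thesis using uv False by (auto simp: ext_def lex_def tie_def)
    qed
    then show "ext R \<inter> ?F \<times> ?F = R" using validD(1)[OF R] by auto
  qed
qed

text \<open>The two equations determine \<open>z u\<close> and \<open>z (\<sigma> u)\<close> from the other letters, unless
  \<open>v = \<sigma> u\<close>: then \<open>\<sigma>\<close> may swap \<open>u\<close> and \<open>v\<close>, and only \<open>z u\<close> is determined.\<close>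

lemma sum_wt_coincide_le:
  fixes \<sigma> :: "'a \<Rightarrow> 'a" and a :: nat
  assumes fin: "finite N" "F \<inter> N = {}" and q: "0 \<le> q" "q \<le> 1" and \<sigma>: "inj \<sigma>" "\<sigma> ` N \<subseteq> N"
    and F: "\<And>v. v \<in> F \<Longrightarrow> \<sigma> v = v" and uv: "u \<in> N" "v \<in> F \<union> N" "u \<noteq> v" "\<sigma> u \<noteq> u"
  defines "P \<equiv> \<Sum>y<a. q ^ y"
  shows "(\<Sum>z | z \<in> N \<rightarrow>\<^sub>E {..<a} \<and> merge F N (x, z) u = merge F N (x, z) v \<and>
      merge F N (x, z) (\<sigma> u) = merge F N (x, z) (\<sigma> v). wt q N z)
    \<le> (if v = \<sigma> u then P ^ (card N - 1) else P ^ (card N - 2))"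
    (is "(\<Sum>z\<in>?Z. _) \<le> _")
proof -
  let ?m = "\<lambda>z. merge F N (x, z)"
  define D where "D = (if v = \<sigma> u then {u} else {u, \<sigma> u})"
  have su: "\<sigma> u \<in> N" using \<sigma>(2) uv(1) by blast
  have svN: "\<sigma> v \<in> N" if "v \<in> N" using \<sigma>(2) that by blast
  have sv: "\<sigma> v \<noteq> \<sigma> u" using \<sigma>(1) uv(3) by (auto dest: injD)
  have mN: "?m z w = z w" if "w \<in> N" for z w using that fin(2) by (auto simp: merge_def)
  have mF: "?m z w = x w" if "w \<in> F" for z w using that fin(2) by (auto simp: merge_def)
  have inj: "inj_on (\<lambda>z. restrict z (N - D)) ?Z"
  proof (rule inj_onI)
    fix z z' assume z: "z \<in> ?Z" "z' \<in> ?Z" and "restrict z (N - D) = restrict z' (N - D)"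
    then have off: "z w = z' w" if "w \<in> N" "w \<notin> D" for w using that by (metis DiffI restrict_apply')
    have zu: "?m z u = ?m z v" "?m z (\<sigma> u) = ?m z (\<sigma> v)" "?m z' u = ?m z' v" "?m z' (\<sigma> u) = ?m z' (\<sigma> v)"
      using z by auto
    have "z u = z' u \<and> z (\<sigma> u) = z' (\<sigma> u)"
    proof (cases "v \<in> F")
      case True
      then have "\<sigma> v = v" using F by simp
      then show ?thesis using zu mF[OF True] mN[OF su] mN[OF uv(1)] by simp
    next
      case False
      then have v: "v \<in> N" using uv by blast
      have e: "z u = z v" "z (\<sigma> u) = z (\<sigma> v)" "z' u = z' v" "z' (\<sigma> u) = z' (\<sigma> v)"
        using zu mN[OF su] mN[OF uv(1)] mN[OF v] mN[OF svN[OF v]] by simp_all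
      show ?thesis
      proof (cases "v = \<sigma> u")
        case True
        then have "z (\<sigma> u) = z' (\<sigma> u)" using off[OF su] uv(3) by (simp add: D_def)
        then show ?thesis using e True by simp
      next
        case ne: False
        then have zv: "z v = z' v" using off[OF v] uv(3) by (simp add: D_def)
        then have "z u = z' u" using e by simp
        moreover have "z (\<sigma> v) = z' (\<sigma> v)"
          using calculation off[OF svN[OF v]] ne sv by (cases "\<sigma> v = u") (auto simp: D_def)
        ultimately show ?thesis using e by simp
      qed
    qed
    then have "z w = z' w" if "w \<in> N" for w using off[OF that] by (cases "w \<in> D") (auto simp: D_def split: if_splits)
    then show "z = z'" using z by (auto intro: PiE_ext)
  qed
  have "(\<Sum>z\<in>?Z. wt q N z) \<le> P ^ (card N - card D)"
    unfolding P_def using su uv(1) by (intro sum_wt_determined fin q inj) (auto simp: D_def)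
  moreover have "card D = (if v = \<sigma> u then 1 else 2)" using uv(4) by (auto simp: D_def)
  ultimately show ?thesis by (auto split: if_splits)
qed

text \<open>A union bound over coincidences. Letterings without one keep every order of the fixed
  points. A coincidence of \<open>u\<close> and \<open>v\<close> costs a factor \<open>P\<close> if
  \<open>v = \<sigma> u\<close>, for at most \<open>n\<close> pairs, and \<open>P\<^sup>2\<close>
  otherwise, for at most \<open>n * n\<close> pairs.\<close>

lemma vgf_ge:
  fixes a :: nat
  assumes \<sigma>: "inj \<sigma>" and q: "0 \<le> q" "q \<le> 1" and a: "1 \<le> a"
    and B: "finite B" "\<sigma> ` B \<subseteq> B" "card B \<le> n"
  defines "P \<equiv> \<Sum>y<a. q ^ y"
  shows "vgf {u \<in> B. \<sigma> u = u} \<sigma> q a * P ^ card {u \<in> B. \<sigma> u \<noteq> u} * (1 - n / P - (n / P)\<^sup>2) \<le> vgf B \<sigma> q a"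
proof -
  define F where "F = {u \<in> B. \<sigma> u = u}"
  define N where "N = {u \<in> B. \<sigma> u \<noteq> u}"
  define A where "A = {..<a}"
  let ?m = "\<lambda>x z. merge F N (x, z)"
  define bad where "bad u v x \<longleftrightarrow> x u = x v \<and> x (\<sigma> u) = x (\<sigma> v)" for u v and x :: "'a \<Rightarrow> nat"
  have P1: "1 \<le> P"
  proof -
    have "(\<Sum>y<1. q ^ y) \<le> P" unfolding P_def using a q by (intro sum_mono2) auto
    then show ?thesis by simp
  qed
  have finF: "finite F" and finN: "finite N" and disj: "F \<inter> N = {}" and BFN: "B = F \<union> N"
    using B(1) by (auto simp: F_def N_def)
  have finA: "finite (N \<rightarrow>\<^sub>E A)" using finN by (simp add: A_def finite_PiE)
  have NN: "\<sigma> ` N \<subseteq> N"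
  proof clarify
    fix u assume "u \<in> N"
    then show "\<sigma> u \<in> N" using B(2) \<sigma> by (auto simp: N_def dest: injD)
  qed
  have cardN: "card N \<le> n" using B(1,3) card_mono[of B N] by (auto simp: N_def)
  define g where "g x = wt q F x * card (valid F \<sigma> x)" for x
  have g0: "0 \<le> g x" for x unfolding g_def by (intro mult_nonneg_nonneg wt_nonneg q) simp
  define X where "X = {(u, v). u \<in> N \<and> v \<in> B \<and> u \<noteq> v}"
  have finX: "finite X" using B(1) by (rule_tac finite_subset[of _ "B \<times> B"]) (auto simp: X_def N_def)
  define L where "L = vgf F \<sigma> q a"
  have L: "L = (\<Sum>x\<in>F \<rightarrow>\<^sub>E A. g x)" unfolding L_def vgf_def g_def A_def ..
  have L0: "0 \<le> L" unfolding L_def using vgf_nonneg[OF q(1)] .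
  \<comment> \<open>The factor containing the number of bad pairs is at most 0 as soon as one pair
    is bad, so the inequality is trivial there, and \<open>card_valid_ge\<close> applies
    elsewhere.\<close>
  have main: "(\<Sum>x\<in>F \<rightarrow>\<^sub>E A. \<Sum>z\<in>N \<rightarrow>\<^sub>E A. g x * (wt q N z * (1 - (\<Sum>(u, v)\<in>X. of_bool (bad u v (?m x z)))))) \<le> vgf B \<sigma> q a"
  proof -
    have "vgf B \<sigma> q a = (\<Sum>x\<in>F \<rightarrow>\<^sub>E A. \<Sum>z\<in>N \<rightarrow>\<^sub>E A. wt q F x * wt q N z * card (valid B \<sigma> (?m x z)))"
      unfolding vgf_def A_def[symmetric] BFN sum_PiE_Un[OF disj] wt_merge[OF finF finN disj] ..
    moreover have "g x * (wt q N z * (1 - (\<Sum>(u, v)\<in>X. of_bool (bad u v (?m x z))))) \<le> wt q F x * wt q N z * card (valid B \<sigma> (?m x z))"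
      (is "?L \<le> ?R") for x z
    proof (cases "\<exists>(u, v)\<in>X. bad u v (?m x z)")
      case True
      then obtain p where p: "p \<in> X" "case p of (u, v) \<Rightarrow> bad u v (?m x z)" by blast
      have "(\<Sum>p\<in>{p}. case p of (u, v) \<Rightarrow> of_bool (bad u v (?m x z))) \<le> (\<Sum>(u, v)\<in>X. of_bool (bad u v (?m x z)) :: real)"
        using p finX by (intro sum_mono2) auto
      then have "1 - (\<Sum>(u, v)\<in>X. of_bool (bad u v (?m x z))) \<le> (0 :: real)" using p(2) by (auto split: prod.splits)
      then have "?L \<le> 0" using g0[of x] wt_nonneg[OF q(1), of N z] by (simp add: mult_nonneg_nonpos)
      also have "0 \<le> ?R" by (intro mult_nonneg_nonneg wt_nonneg q) simp
      finally show ?thesis .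
    next
      case False
      have z0: "(\<Sum>(u, v)\<in>X. of_bool (bad u v (?m x z))) = (0 :: real)"
        using False by (intro sum.neutral) auto
      have "card (valid F \<sigma> (?m x z)) \<le> card (valid B \<sigma> (?m x z))"
        unfolding F_def
      proof (rule card_valid_ge[OF B(1) \<sigma> B(2)])
        fix u v assume "u \<in> B" "\<sigma> u \<noteq> u" "v \<in> B" "u \<noteq> v"
        then have "(u, v) \<in> X" by (simp add: X_def N_def)
        then have "\<not> bad u v (?m x z)" using False by blast
        then show "\<not> (merge {u \<in> B. \<sigma> u = u} N (x, z) u = merge {u \<in> B. \<sigma> u = u} N (x, z) v \<and>
           merge {u \<in> B. \<sigma> u = u} N (x, z) (\<sigma> u) = merge {u \<in> B. \<sigma> u = u} N (x, z) (\<sigma> v))"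
          by (simp add: bad_def F_def)
      qed
      moreover have "valid F \<sigma> (?m x z) = valid F \<sigma> x" using disj by (intro valid_cong) (auto simp: merge_def)
      ultimately have "real (card (valid F \<sigma> x)) \<le> real (card (valid B \<sigma> (?m x z)))" by simp
      then have "wt q F x * wt q N z * real (card (valid F \<sigma> x)) \<le> wt q F x * wt q N z * real (card (valid B \<sigma> (?m x z)))"
        by (rule mult_left_mono) (intro mult_nonneg_nonneg wt_nonneg q)
      then show ?thesis unfolding z0 g_def by (simp add: mult_ac)
    qed
    ultimately show ?thesis by (auto intro!: sum_mono)
  qed
  have inner: "(P ^ card N - (n * P ^ (card N - 1) + n * n * P ^ (card N - 2))) \<le>
    (\<Sum>z\<in>N \<rightarrow>\<^sub>E A. wt q N z * (1 - (\<Sum>(u, v)\<in>X. of_bool (bad u v (?m x z)))))" for x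
  proof -
    have eq: "(\<Sum>z\<in>N \<rightarrow>\<^sub>E A. wt q N z * (1 - (\<Sum>(u, v)\<in>X. of_bool (bad u v (?m x z)))))
      = P ^ card N - (\<Sum>z\<in>N \<rightarrow>\<^sub>E A. \<Sum>(u, v)\<in>X. wt q N z * of_bool (bad u v (?m x z)))"
      using sum_wt[OF finN, of q a] 
      by (simp add: right_diff_distrib sum_subtractf sum_distrib_left P_def A_def case_prod_unfold)
    have "(\<Sum>z\<in>N \<rightarrow>\<^sub>E A. \<Sum>(u, v)\<in>X. wt q N z * of_bool (bad u v (?m x z)))
       = (\<Sum>(u, v)\<in>X. \<Sum>z\<in>N \<rightarrow>\<^sub>E A. wt q N z * of_bool (bad u v (?m x z)))"
      unfolding case_prod_unfold by (rule sum.swap)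
    also have "\<dots> \<le> (\<Sum>(u, v)\<in>X. of_bool (v = \<sigma> u) * P ^ (card N - 1) + P ^ (card N - 2))"
    proof (rule sum_mono)
      fix p assume p: "p \<in> X"
      obtain u v where pe: "p = (u, v)" by (cases p)
      have uv: "u \<in> N" "v \<in> F \<union> N" "u \<noteq> v" "\<sigma> u \<noteq> u" using p unfolding pe BFN by (auto simp: X_def N_def F_def)
      have "(\<Sum>z\<in>N \<rightarrow>\<^sub>E A. wt q N z * of_bool (bad u v (?m x z))) = (\<Sum>z\<in>N \<rightarrow>\<^sub>E A. if bad u v (?m x z) then wt q N z else 0)"
        by (intro sum.cong) auto
      also have "\<dots> = (\<Sum>z | z \<in> N \<rightarrow>\<^sub>E A \<and> bad u v (?m x z). wt q N z)"
        by (rule sum.inter_filter[OF finA, symmetric])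
      also have "\<dots> \<le> (if v = \<sigma> u then P ^ (card N - 1) else P ^ (card N - 2))"
        unfolding bad_def P_def A_def
        by (rule sum_wt_coincide_le[OF finN disj q \<sigma> NN _ uv]) (auto simp: F_def)
      also have "\<dots> \<le> of_bool (v = \<sigma> u) * P ^ (card N - 1) + P ^ (card N - 2)" using P1 by auto
      finally show "(case p of (u, v) \<Rightarrow> \<Sum>z\<in>N \<rightarrow>\<^sub>E A. wt q N z * of_bool (bad u v (?m x z)))
        \<le> (case p of (u, v) \<Rightarrow> of_bool (v = \<sigma> u) * P ^ (card N - 1) + P ^ (card N - 2))" by (simp add: pe)
    qed
    also have "\<dots> = (\<Sum>(u, v)\<in>X. of_bool (v = \<sigma> u)) * P ^ (card N - 1) + card X * P ^ (card N - 2)"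
      by (simp add: sum.distrib sum_distrib_right case_prod_unfold)
    also have "\<dots> \<le> n * P ^ (card N - 1) + n * n * P ^ (card N - 2)"
    proof -
      have "{p \<in> X. snd p = \<sigma> (fst p)} \<subseteq> (\<lambda>u. (u, \<sigma> u)) ` N" by (auto simp: X_def)
      then have "card {p \<in> X. snd p = \<sigma> (fst p)} \<le> card N" using surj_card_le finN by blast
      then have c1: "(\<Sum>(u, v)\<in>X. of_bool (v = \<sigma> u)) \<le> real n"
        using cardN finX by (simp add: case_prod_unfold Int_def)
      have "card X \<le> card (N \<times> B)" using finN B(1) by (intro card_mono) (auto simp: X_def)
      also have "\<dots> \<le> n * n" unfolding card_cartesian_product using cardN B(3) by (rule mult_le_mono)
      finally have c2: "real (card X) \<le> real (n * n)" by (rule of_nat_mono)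
      show ?thesis by (intro add_mono mult_right_mono c1 c2) (use P1 in simp_all)
    qed
    finally show ?thesis using eq by simp
  qed
  show ?thesis
  \<comment> \<open>The exponents \<open>card N - 1\<close> and \<open>card N - 2\<close> are
    truncated unless \<open>N\<close> has two elements. A nonempty \<open>N\<close> has them: some
    \<open>u\<close> together with \<open>\<sigma> u\<close>.\<close>
  proof (cases "N = {}")
    case True
    have "0 \<le> n / P" "0 \<le> (n / P)\<^sup>2" using P1 by simp_all
    then have "L * (1 - n / P - (n / P)\<^sup>2) \<le> L * 1" by (intro mult_left_mono L0) linarith
    moreover have "vgf B \<sigma> q a = L" unfolding L_def BFN using True by simp
    ultimately show ?thesis using True unfolding F_def[symmetric] N_def[symmetric] L_def by simp
  next
    case False
    then obtain u where "u \<in> N" by blast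
    then have "card {u, \<sigma> u} \<le> card N" using NN finN by (intro card_mono) auto
    moreover have "card {u, \<sigma> u} = 2" using \<open>u \<in> N\<close> by (auto simp: N_def card_insert_if)
    ultimately have "2 \<le> card N" by simp
    from le_Suc_ex[OF this] obtain k where "card N = 2 + k" by blast
    then have "P ^ card N * (1 - n / P - (n / P)\<^sup>2) = P ^ card N - (n * P ^ (card N - 1) + n * n * P ^ (card N - 2))"
      using P1 by (simp add: field_simps power2_eq_square)
    then have "L * P ^ card N * (1 - n / P - (n / P)\<^sup>2) = L * (P ^ card N - (n * P ^ (card N - 1) + n * n * P ^ (card N - 2)))"
      by (simp add: mult.assoc)
    also have "\<dots> \<le> (\<Sum>x\<in>F \<rightarrow>\<^sub>E A. g x * (\<Sum>z\<in>N \<rightarrow>\<^sub>E A. wt q N z * (1 - (\<Sum>(u, v)\<in>X. of_bool (bad u v (?m x z))))))"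
      unfolding L sum_distrib_right by (intro sum_mono mult_left_mono inner g0)
    also have "\<dots> = (\<Sum>x\<in>F \<rightarrow>\<^sub>E A. \<Sum>z\<in>N \<rightarrow>\<^sub>E A. g x * (wt q N z * (1 - (\<Sum>(u, v)\<in>X. of_bool (bad u v (?m x z))))))"
      by (simp add: sum_distrib_left)
    also note main
    finally show ?thesis unfolding L_def F_def N_def .
  qed
qed

section \<open>Conjugacy classes\<close>

lemma exists_cyclic_permutation:
  assumes "finite D" "D \<noteq> {}"
  shows "\<exists>c. c permutes D \<and> cyclic_on c D"
proof -
  obtain xs where xs: "set xs = D" "distinct xs" using finite_distinct_list[OF assms(1)] by blast
  then have ne: "xs \<noteq> []" using assms(2) by auto
  let ?c = "cycle_of_list xs"
  have it: "(?c ^^ k) (hd xs) = xs ! k" if "k < length xs" for k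
  proof -
    have "(?c ^^ k) (hd xs) = hd (map (?c ^^ k) xs)" using ne by (simp add: hd_map)
    also have "\<dots> = hd (rotate k xs)" using cyclic_rotation[OF xs(2)] by simp
    also have "\<dots> = xs ! k" using hd_rotate_conv_nth[OF ne, of k] that by simp
    finally show ?thesis .
  qed
  have perm: "?c permutes D" using cycle_permutes[of xs] xs by simp
  then have permn: "permutation ?c" using assms(1) permutation_permutes by blast
  have "orbit ?c (hd xs) = D"
  proof
    show "orbit ?c (hd xs) \<subseteq> D" using permutes_orbit_subset[OF perm, of "hd xs"] xs ne by auto
    show "D \<subseteq> orbit ?c (hd xs)"
    proof
      fix d assume "d \<in> D"
      then obtain k where "k < length xs" "d = xs ! k" using xs(1) by (auto simp: in_set_conv_nth)
      then have "d = (?c ^^ k) (hd xs)" using it by simp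
      then show "d \<in> orbit ?c (hd xs)" unfolding orbit_altdef_permutation[OF permn] by blast
    qed
  qed
  then have "cyclic_on ?c D" using cyclic_on_orbit'[OF permn, of "hd xs"] by simp
  then show ?thesis using perm by blast
qed

text \<open>Needed because the uniform distribution makes sense only on a nonempty class. A block of
  \<open>k\<close> elements with \<open>0 < l k\<close> is split off and made into one cycle; the
  rest is handled by induction.\<close>

lemma exists_permutation_cycle_type:
  fixes l :: "nat \<Rightarrow> nat"
  assumes "finite A" "(\<Sum>k=1..n. k * l k) = card A"
  shows "\<exists>p. p permutes A \<and> (\<forall>k\<in>{1..n}. card {c. c \<subseteq> A \<and> cyclic_on p c \<and> card c = k} = l k)"
  using assms
proof (induction "card A" arbitrary: A l rule: less_induct)
  case less
  show ?case
  proof (cases "A = {}")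
    case True
    have l0: "l k = 0" if "k \<in> {1..n}" for k using True less.prems that by auto
    have c0: "{c. c \<subseteq> A \<and> cyclic_on id c \<and> card c = k} = {}" for k
      using True by (auto simp: cyclic_on_def)
    have "card {c. c \<subseteq> A \<and> cyclic_on id c \<and> card c = k} = l k" if "k \<in> {1..n}" for k
      unfolding c0 l0[OF that] by (rule card.empty)
    then show ?thesis using permutes_id by blast
  next
    case False
    then have "(\<Sum>k=1..n. k * l k) \<noteq> 0" using less.prems by simp
    then have "\<exists>k\<in>{1..n}. 0 < l k" by (rule contrapos_np) simp
    then obtain k where k: "k \<in> {1..n}" "0 < l k" by blast
    have split: "(\<Sum>j=1..n. j * l j) = k * l k + (\<Sum>j\<in>{1..n} - {k}. j * l j)"
      using k by (simp add: sum.remove)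
    have "k * 1 \<le> k * l k" using k by (intro mult_le_mono) auto
    then have "k \<le> card A" unfolding less.prems(2)[symmetric] split by linarith
    from obtain_subset_with_card_n[OF this] obtain D where D: "D \<subseteq> A" "card D = k" by blast
    have finD: "finite D" using D less.prems finite_subset by blast
    have neD: "D \<noteq> {}" using D k by auto
    define l' where "l' = l(k := l k - 1)"
    have "(\<Sum>j=1..n. j * l' j) = k * (l k - 1) + (\<Sum>j\<in>{1..n} - {k}. j * l j)"
    proof -
      have "(\<Sum>j=1..n. j * l' j) = k * l' k + (\<Sum>j\<in>{1..n} - {k}. j * l' j)"
        by (rule sum.remove) (use k in auto)
      also have "(\<Sum>j\<in>{1..n} - {k}. j * l' j) = (\<Sum>j\<in>{1..n} - {k}. j * l j)"
        by (rule sum.cong) (auto simp: l'_def)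
      finally show ?thesis by (simp add: l'_def)
    qed
    moreover have "k * (l k - 1) + k = k * l k"
    proof -
      obtain i where "l k = Suc i" using k(2) gr0_implies_Suc by blast
      then show ?thesis by simp
    qed
    ultimately have "(\<Sum>j=1..n. j * l' j) = card (A - D)"
      using split less.prems D finD by (simp add: card_Diff_subset)
    moreover have "card (A - D) < card A" using D neD less.prems(1) by (intro psubset_card_mono) auto
    ultimately have "\<exists>p. p permutes (A - D) \<and> (\<forall>j\<in>{1..n}. card {c. c \<subseteq> A - D \<and> cyclic_on p c \<and> card c = j} = l' j)"
      using less.prems(1) by (intro less.hyps) auto
    then obtain p where p: "p permutes (A - D)"
      "\<And>j. j \<in> {1..n} \<Longrightarrow> card {c. c \<subseteq> A - D \<and> cyclic_on p c \<and> card c = j} = l' j" by blast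
    obtain c where c: "c permutes D" "cyclic_on c D" using exists_cyclic_permutation[OF finD neD] by blast
    define p' where "p' = c \<circ> p"
    have p'_D: "p' u = c u" if "u \<in> D" for u unfolding p'_def using permutes_not_in[OF p(1), of u] that by simp
    have p'_A: "p' u = p u" if "u \<in> A - D" for u
      unfolding p'_def using permutes_not_in[OF c(1), of "p u"] permutes_in_image[OF p(1), of u] that by simp
    have perm: "p' permutes A" unfolding p'_def
      using permutes_compose[OF permutes_subset[OF p(1)] permutes_subset[OF c(1)]] D by auto
    have cyc_D: "cyclic_on p' D" using c(2) cyclic_cong[of D p' c] p'_D by simp
    have cyc_A: "cyclic_on p' e \<longleftrightarrow> cyclic_on p e" if "e \<subseteq> A - D" for e
      using p'_A that by (intro cyclic_cong) auto
    \<comment> \<open>A cycle that meets \<open>D\<close> equals \<open>D\<close>, since both are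
      the orbit of a common element.\<close>
    have eq: "{e. e \<subseteq> A \<and> cyclic_on p' e \<and> card e = j} =
      {e. e \<subseteq> A - D \<and> cyclic_on p e \<and> card e = j} \<union> (if j = k then {D} else {})" for j
    proof (intro equalityI subsetI)
      fix e assume "e \<in> {e. e \<subseteq> A \<and> cyclic_on p' e \<and> card e = j}"
      then have e: "e \<subseteq> A" "cyclic_on p' e" "card e = j" by auto
      show "e \<in> {e. e \<subseteq> A - D \<and> cyclic_on p e \<and> card e = j} \<union> (if j = k then {D} else {})"
      proof (cases "e \<inter> D = {}")
        case True
        then have "e \<subseteq> A - D" using e by blast
        then show ?thesis using e cyc_A by simp
      next
        case False
        then obtain u where "u \<in> e" "u \<in> D" by blast
        then have "e = D" using orbit_cyclic_eq3[OF e(2)] orbit_cyclic_eq3[OF cyc_D] by metis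
        then show ?thesis using e D by simp
      qed
    next
      fix e assume "e \<in> {e. e \<subseteq> A - D \<and> cyclic_on p e \<and> card e = j} \<union> (if j = k then {D} else {})"
      then show "e \<in> {e. e \<subseteq> A \<and> cyclic_on p' e \<and> card e = j}"
        using cyc_A cyc_D D by (auto split: if_splits)
    qed
    have "card {e. e \<subseteq> A \<and> cyclic_on p' e \<and> card e = j} = l j" if j: "j \<in> {1..n}" for j
    proof -
      let ?E = "{e. e \<subseteq> A - D \<and> cyclic_on p e \<and> card e = j}"
      have fin: "finite ?E"
        by (rule finite_subset[of _ "Pow A"]) (use less.prems(1) in auto)
      have nin: "D \<notin> ?E" using neD by auto
      show ?thesis
      proof (cases "j = k")
        case True
        then have "card (?E \<union> {D}) = Suc (l' j)" using card_insert_disjoint[OF fin nin] p(2)[OF j] by simp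
        then show ?thesis unfolding eq using True k by (simp add: l'_def)
      next
        case False
        then show ?thesis unfolding eq using p(2)[OF j] by (simp add: l'_def)
      qed
    qed
    then show ?thesis using perm by blast
  qed
qed

lemma conj_class_nonempty:
  assumes "partition_of n l"
  shows "conj_class n l \<noteq> {}"
  using exists_permutation_cycle_type[where A = "{1..n}" and n = n and l = l] assms
  unfolding partition_of_def conj_class_def cycles_of_length_def by auto

lemma finite_conj_class: "finite (conj_class n l)"
  by (rule finite_subset[OF _ finite_permutations[of "{1..n}"]]) (auto simp: conj_class_def)

text \<open>Taking images under \<open>\<rho>\<close> injects the cycles of \<open>p\<close> into
  those of the conjugate; conjugating back by the inverse gives the other inequality.\<close>

lemma card_cycles_of_length_conj:
  assumes r: "\<rho> permutes {1..n}"
  shows "card (cycles_of_length n (\<rho> \<circ> p \<circ> inv \<rho>) k) = card (cycles_of_length n p k)"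
proof -
  have sub: "(`) \<rho> ` cycles_of_length n p k \<subseteq> cycles_of_length n (\<rho> \<circ> p \<circ> inv \<rho>) k"
    if r: "\<rho> permutes {1..n}" for \<rho> p
  proof clarify
    fix c assume "c \<in> cycles_of_length n p k"
    then have c: "c \<subseteq> {1..n}" "cyclic_on p c" "card c = k" by (auto simp: cycles_of_length_def)
    have "cyclic_on (\<rho> \<circ> p \<circ> inv \<rho>) (\<rho> ` c)"
      by (rule cyclic_on_image[OF c(2)]) (simp add: permutes_inverses(2)[OF r])
    moreover have "\<rho> ` c \<subseteq> {1..n}" using c(1) permutes_in_image[OF r] by blast
    moreover have "card (\<rho> ` c) = k" using card_image[OF permutes_inj_on[OF r], of c] c(3) by simp
    ultimately show "\<rho> ` c \<in> cycles_of_length n (\<rho> \<circ> p \<circ> inv \<rho>) k" by (simp add: cycles_of_length_def)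
  qed
  have fin: "finite (cycles_of_length n p k)" for p
    by (rule finite_subset[of _ "Pow {1..n}"]) (auto simp: cycles_of_length_def)
  have le: "card (cycles_of_length n p k) \<le> card (cycles_of_length n (\<rho> \<circ> p \<circ> inv \<rho>) k)"
    if r: "\<rho> permutes {1..n}" for \<rho> p
    using card_inj_on_le[OF _ sub[OF r] fin] inj_on_image[of \<rho> "cycles_of_length n p k"] permutes_inj_on[OF r] by blast
  have "inv \<rho> \<circ> (\<rho> \<circ> p \<circ> inv \<rho>) \<circ> inv (inv \<rho>) = p"
    using permutes_inverses[OF r] by (simp add: fun_eq_iff inv_inv_eq[OF permutes_bij[OF r]])
  then show ?thesis using le[OF r, of p] le[OF permutes_inv[OF r], of "\<rho> \<circ> p \<circ> inv \<rho>"] by simp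
qed

lemma conj_class_conj:
  assumes "\<rho> permutes {1..n}" "p \<in> conj_class n l"
  shows "\<rho> \<circ> p \<circ> inv \<rho> \<in> conj_class n l"
  using assms card_cycles_of_length_conj[OF assms(1)]
  unfolding conj_class_def by (auto intro!: permutes_compose permutes_inv)

lemma sum_conj_class_conj:
  assumes r: "\<rho> permutes {1..n}"
  shows "(\<Sum>p\<in>conj_class n l. f (\<rho> \<circ> p \<circ> inv \<rho>)) = (\<Sum>p\<in>conj_class n l. f p)"
proof (rule sum.reindex_bij_witness[where i = "\<lambda>p. inv \<rho> \<circ> p \<circ> \<rho>" and j = "\<lambda>p. \<rho> \<circ> p \<circ> inv \<rho>"])
  fix p assume p: "p \<in> conj_class n l"
  show "inv \<rho> \<circ> (\<rho> \<circ> p \<circ> inv \<rho>) \<circ> \<rho> = p" "\<rho> \<circ> (inv \<rho> \<circ> p \<circ> \<rho>) \<circ> inv \<rho> = p"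
    using permutes_inverses[OF r] by (simp_all add: fun_eq_iff)
  show "\<rho> \<circ> p \<circ> inv \<rho> \<in> conj_class n l" using conj_class_conj[OF r p] .
  show "inv \<rho> \<circ> p \<circ> \<rho> \<in> conj_class n l"
    using conj_class_conj[OF permutes_inv[OF r] p] by (simp add: inv_inv_eq[OF permutes_bij[OF r]])
qed simp

text \<open>Averaging over all conjugates of each member of the class needs neither that the class is a
  single orbit under conjugation nor the size of the centralizer.\<close>

lemma conj_class_average:
  fixes f :: "(nat \<Rightarrow> nat) \<Rightarrow> real"
  assumes ne: "conj_class n l \<noteq> {}"
    and f: "\<And>p. p \<in> conj_class n l \<Longrightarrow> \<bar>(\<Sum>\<rho> | \<rho> permutes {1..n}. f (\<rho> \<circ> p \<circ> inv \<rho>)) / fact n - L\<bar> \<le> e"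
  shows "\<bar>(\<Sum>p\<in>conj_class n l. f p) / card (conj_class n l) - L\<bar> \<le> e"
proof -
  let ?C = "conj_class n l"
  have pos: "0 < real (card ?C)" using ne finite_conj_class by (simp add: card_gt_0_iff)
  have "(\<Sum>p\<in>?C. (\<Sum>\<rho> | \<rho> permutes {1..n}. f (\<rho> \<circ> p \<circ> inv \<rho>)) / fact n - L)
    = (\<Sum>\<rho> | \<rho> permutes {1..n}. \<Sum>p\<in>?C. f (\<rho> \<circ> p \<circ> inv \<rho>)) / fact n - card ?C * L"
    by (simp add: sum_subtractf sum_divide_distrib[symmetric]) (rule sum.swap)
  also have "\<dots> = (\<Sum>p\<in>?C. f p) - card ?C * L"
    using card_permutations[of "{1..n}" n] by (simp add: sum_conj_class_conj)
  finally have "\<bar>(\<Sum>p\<in>?C. f p) - card ?C * L\<bar> \<le> (\<Sum>p\<in>?C. e)"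
    using f by (metis (no_types, lifting) sum_norm_le real_norm_def)
  then show ?thesis using pos by (simp add: field_simps abs_le_iff)
qed

text \<open>Links the partition to the number of fixed points, the only datum of the class that
  enters the asymptotics.\<close>

lemma cycles_of_length_1:
  assumes "p permutes {1..n}"
  shows "card (cycles_of_length n p 1) = card {u \<in> {1..n}. p u = u}"
proof -
  have "cycles_of_length n p 1 = (\<lambda>u. {u}) ` {u \<in> {1..n}. p u = u}"
  proof (intro equalityI subsetI)
    fix c assume "c \<in> cycles_of_length n p 1"
    then have c: "c \<subseteq> {1..n}" "cyclic_on p c" "card c = 1" by (auto simp: cycles_of_length_def)
    then obtain u where u: "c = {u}" by (auto simp: card_1_singleton_iff)
    then have "orbit p u = {u}" using orbit_cyclic_eq3[OF c(2)] by simp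
    then show "c \<in> (\<lambda>u. {u}) ` {u \<in> {1..n}. p u = u}" using c u by (auto simp: orbit_eq_singleton_iff)
  next
    fix c assume "c \<in> (\<lambda>u. {u}) ` {u \<in> {1..n}. p u = u}"
    then show "c \<in> cycles_of_length n p 1"
      using orbit_eq_singleton_iff[of p] by (auto simp: cycles_of_length_def cyclic_on_def simp del: orbit_eq_singleton_iff)
  qed
  then show ?thesis by (simp add: card_image)
qed

section \<open>The generating function over conjugates\<close>

text \<open>The quotient of the main term of S(b) / n! by h_n(b), where \<open>m\<close> is the
  number of fixed points. The product form makes its logarithm a sum of small terms; it is 1 for
  \<open>m = n\<close>.\<close>

definition fixed_factor :: "nat \<Rightarrow> nat \<Rightarrow> real \<Rightarrow> nat \<Rightarrow> real" where
  "fixed_factor n m q b = (\<Prod>j=m..<n. (1 - q ^ Suc j) / (real (Suc j) * (1 - q)) * ((1 - q ^ b) / (1 - q ^ (b + j))))"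

text \<open>Raising \<open>n\<close> by 1 multiplies either side by
  \<open>(1 - q ^ b) / (1 - q)\<close>: the factors \<open>1 - q ^ (b + n)\<close> and
  \<open>1 - q ^ Suc n\<close> gained by \<open>hgf\<close> cancel against those of
  \<open>fixed_factor\<close>.\<close>

lemma hgf_fixed_factor:
  assumes q: "0 < q" "q < 1" and b: "1 \<le> b" and m: "m \<le> n"
  shows "fact m * hgf m q b * (\<Sum>y<b. q ^ y) ^ (n - m) = fact n * (hgf n q b * fixed_factor n m q b)"
proof -
  have ne: "1 - q ^ Suc j \<noteq> 0" "1 - q ^ (b + j) \<noteq> 0" for j
    using q b power_Suc_less_one[OF q, of "b + j - 1"] power_Suc_less_one[OF q, of j] by auto
  have "fact (m + k) * (hgf (m + k) q b * fixed_factor (m + k) m q b) = fact m * hgf m q b * ((1 - q ^ b) / (1 - q)) ^ k" for k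
  proof (induction k)
    case 0
    show ?case by (simp add: fixed_factor_def)
  next
    case (Suc k)
    let ?n = "m + k"
    have h: "hgf (Suc ?n) q b = hgf ?n q b * ((1 - q ^ (b + ?n)) / (1 - q ^ Suc ?n))"
      unfolding hgf_eq_prod[OF q] by simp
    have f: "fixed_factor (Suc ?n) m q b = fixed_factor ?n m q b * ((1 - q ^ Suc ?n) / (real (Suc ?n) * (1 - q)) * ((1 - q ^ b) / (1 - q ^ (b + ?n))))"
      unfolding fixed_factor_def by simp
    have c: "fact (Suc ?n) * (((1 - q ^ (b + ?n)) / (1 - q ^ Suc ?n)) * ((1 - q ^ Suc ?n) / (real (Suc ?n) * (1 - q)) * ((1 - q ^ b) / (1 - q ^ (b + ?n)))))
      = (fact ?n :: real) * ((1 - q ^ b) / (1 - q))"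
    proof -
      have aux: "(s * f) * ((X / Y) * (Y / (s * Q) * (Z / X))) = f * (Z / Q)"
        if "X \<noteq> 0" "Y \<noteq> 0" "s \<noteq> 0" for s f X Y Z Q :: real using that by simp
      show ?thesis unfolding fact_Suc by (rule aux) (use ne[of ?n] in auto)
    qed
    have "fact (m + Suc k) * (hgf (m + Suc k) q b * fixed_factor (m + Suc k) m q b)
      = hgf ?n q b * fixed_factor ?n m q b * (fact (Suc ?n) * (((1 - q ^ (b + ?n)) / (1 - q ^ Suc ?n)) * ((1 - q ^ Suc ?n) / (real (Suc ?n) * (1 - q)) * ((1 - q ^ b) / (1 - q ^ (b + ?n))))))"
      unfolding add_Suc_right h f by (simp only: mult_ac)
    also have "\<dots> = fact ?n * (hgf ?n q b * fixed_factor ?n m q b) * ((1 - q ^ b) / (1 - q))"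
      unfolding c by (simp only: mult_ac)
    also have "\<dots> = fact m * hgf m q b * ((1 - q ^ b) / (1 - q)) ^ Suc k"
      unfolding Suc by simp
    finally show ?case .
  qed
  from this[of "n - m"] show ?thesis using m q by (simp add: sum_gp_strict)
qed

lemma fixed_factor_pos:
  assumes q: "0 < q" "q < 1" and b: "1 \<le> b"
  shows "0 < fixed_factor n m q b"
  unfolding fixed_factor_def
proof (intro prod_pos ballI mult_pos_pos divide_pos_pos)
  fix j
  show "0 < 1 - q ^ Suc j" using power_Suc_less_one[OF q] by simp
  show "0 < 1 - q ^ b" "0 < 1 - q ^ (b + j)"
    using power_Suc_less_one[OF q, of "b - 1"] power_Suc_less_one[OF q, of "b + j - 1"] b by simp_all
qed (use q in auto)

lemma fixed_factor_le_1:
  assumes q: "0 < q" "q < 1" and b: "1 \<le> b"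
  shows "fixed_factor n m q b \<le> 1"
  unfolding fixed_factor_def
proof (intro prod_le_1 conjI)
  fix j
  have p: "0 < 1 - q ^ Suc j" "0 < 1 - q ^ b" "0 < 1 - q ^ (b + j)"
    using power_Suc_less_one[OF q, of "b - 1"] power_Suc_less_one[OF q, of "b + j - 1"] power_Suc_less_one[OF q, of j] b by simp_all
  show "0 \<le> (1 - q ^ Suc j) / (real (Suc j) * (1 - q)) * ((1 - q ^ b) / (1 - q ^ (b + j)))"
    using p q by (intro mult_nonneg_nonneg divide_nonneg_nonneg) auto
  have "(1 - q ^ Suc j) / (1 - q) = (\<Sum>y<Suc j. q ^ y)" using q by (simp add: sum_gp_strict del: power_Suc sum.lessThan_Suc)
  also have "\<dots> \<le> (\<Sum>y<Suc j. 1)" using q by (intro sum_mono power_le_one) auto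
  also have "\<dots> = real (Suc j)" by simp
  finally have "1 - q ^ Suc j \<le> real (Suc j) * (1 - q)" by (subst (asm) pos_divide_le_eq) (use q in auto)
  then have 1: "(1 - q ^ Suc j) / (real (Suc j) * (1 - q)) \<le> 1" by (subst divide_le_eq_1_pos) (use q in auto)
  have "q ^ (b + j) \<le> q ^ b" using q by (intro power_decreasing) auto
  then have 2: "(1 - q ^ b) / (1 - q ^ (b + j)) \<le> 1" using p by simp
  have "0 \<le> (1 - q ^ b) / (1 - q ^ (b + j))" using p by (intro divide_nonneg_nonneg) auto
  then show "(1 - q ^ Suc j) / (real (Suc j) * (1 - q)) * ((1 - q ^ b) / (1 - q ^ (b + j))) \<le> 1"
    using mult_mono[OF 1 2 zero_le_one] by (simp only: mult_1_left)
qed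

lemma vgf_sums:
  assumes \<sigma>: "\<sigma> permutes {1..n}" and q: "0 < q" "q < 1" and t: "0 < t" "t < 1"
  shows "(\<lambda>a. (\<Prod>i\<le>n. 1 - t * q ^ i) * t ^ a * (vgf {1..n} \<sigma> q (Suc a) / fact n)) sums
    ((\<Sum>\<rho> | \<rho> permutes {1..n}. t ^ card (descents n (\<rho> \<circ> \<sigma> \<circ> inv \<rho>)) * q ^ maj n (\<rho> \<circ> \<sigma> \<circ> inv \<rho>)) / fact n)"
proof -
  define D where "D = (\<Prod>i\<le>n. 1 - t * q ^ i)"
  have "D > 0" unfolding D_def
  proof (intro prod_pos ballI)
    fix i
    have "t * q ^ i \<le> t * 1" using q t by (intro mult_left_mono power_le_one) auto
    then show "0 < 1 - t * q ^ i" using t by linarith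
  qed
  have "(\<lambda>a. \<Sum>\<rho> | \<rho> permutes {1..n}. t ^ a * pgf n (\<rho> \<circ> \<sigma> \<circ> inv \<rho>) q (Suc a)) sums
    (\<Sum>\<rho> | \<rho> permutes {1..n}. t ^ card (descents n (\<rho> \<circ> \<sigma> \<circ> inv \<rho>)) * q ^ maj n (\<rho> \<circ> \<sigma> \<circ> inv \<rho>) / D)"
    unfolding D_def using q t by (intro sums_sum pgf_sums) auto
  from sums_mult[OF this, of "D / fact n"] show ?thesis
    using \<open>D > 0\<close> unfolding vgf_permutes[OF \<sigma>] D_def[symmetric]
    by (simp add: sum_distrib_left sum_divide_distrib mult_ac)
qed

context
  fixes n :: nat and \<sigma> :: "nat \<Rightarrow> nat" and q :: real and m :: nat
  assumes \<sigma>: "\<sigma> permutes {1..n}" and q: "0 < q" "q < 1"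
    and m: "m = card {u \<in> {1..n}. \<sigma> u = u}"
begin

lemma card_fixed_le: "m \<le> n"
  unfolding m by (rule order.trans[OF card_mono[of "{1..n}"]]) auto

lemma card_nonfixed: "card {u \<in> {1..n}. \<sigma> u \<noteq> u} = n - m"
proof -
  have eq: "{u \<in> {1..n}. \<sigma> u \<noteq> u} = {1..n} - {u \<in> {1..n}. \<sigma> u = u}" by auto
  show ?thesis unfolding eq m by (subst card_Diff_subset) auto
qed

lemma vgf_fixed_eq:
  assumes b: "1 \<le> b"
  shows "vgf {u \<in> {1..n}. \<sigma> u = u} \<sigma> q b * (\<Sum>y<b. q ^ y) ^ card {u \<in> {1..n}. \<sigma> u \<noteq> u} = fact n * (hgf n q b * fixed_factor n m q b)"
proof -
  have "vgf {u \<in> {1..n}. \<sigma> u = u} \<sigma> q b = fact m * hgf m q b"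
    unfolding m by (rule vgf_fixed) auto
  then show ?thesis unfolding card_nonfixed using hgf_fixed_factor[OF q b card_fixed_le] by simp
qed

text \<open>The power is at most \<open>exp (n * (n / P\<^sup>2))\<close>. Once \<open>P\<close> is
  of order \<open>n * sqrt n\<close>, the exponent \<open>(n / P)\<^sup>2\<close> is of order
  \<open>1 / n\<close>.\<close>

lemma vgf_upper:
  assumes b: "1 \<le> b"
  defines "P \<equiv> \<Sum>y<b. q ^ y"
  shows "vgf {1..n} \<sigma> q b / fact n \<le> hgf n q b * fixed_factor n m q b * exp ((n / P)\<^sup>2)"
proof -
  let ?k = "card {u \<in> {1..n}. \<sigma> u \<noteq> u}"
  have P0: "0 \<le> P" unfolding P_def using q by (intro sum_nonneg) auto
  have perm: "permutation \<sigma>" using \<sigma> permutation_permutes by blast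
  have "vgf {1..n} \<sigma> q b \<le> vgf {u \<in> {1..n}. \<sigma> u = u} \<sigma> q b * (P * (1 + n / P\<^sup>2)) ^ ?k"
    unfolding P_def using q b perm permutes_image[OF \<sigma>] by (intro vgf_le) auto
  also have "\<dots> = fact n * (hgf n q b * fixed_factor n m q b) * (1 + n / P\<^sup>2) ^ ?k"
    unfolding vgf_fixed_eq[OF b, symmetric] P_def by (simp add: power_mult_distrib)
  also have "\<dots> \<le> fact n * (hgf n q b * fixed_factor n m q b) * exp ((n / P)\<^sup>2)"
  proof (intro mult_left_mono mult_nonneg_nonneg hgf_nonneg)
    have "(1 + n / P\<^sup>2) ^ ?k \<le> exp (n / P\<^sup>2) ^ ?k"
      using P0 by (intro power_mono) (auto simp: add_nonneg_nonneg)
    also have "\<dots> = exp (?k * (n / P\<^sup>2))" by (simp only: exp_of_nat_mult)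
    also have "\<dots> \<le> exp (n * (n / P\<^sup>2))"
      unfolding exp_le_cancel_iff card_nonfixed by (intro mult_right_mono) auto
    finally show "(1 + n / P\<^sup>2) ^ ?k \<le> exp ((n / P)\<^sup>2)" by (simp add: power_divide power2_eq_square)
  qed (use q fixed_factor_pos[OF q b, of n m] in auto)
  finally show ?thesis by (simp add: field_simps)
qed

lemma vgf_lower:
  assumes b: "1 \<le> b"
  defines "P \<equiv> \<Sum>y<b. q ^ y"
  shows "hgf n q b * fixed_factor n m q b * (1 - n / P - (n / P)\<^sup>2) \<le> vgf {1..n} \<sigma> q b / fact n"
proof -
  have "fact n * (hgf n q b * fixed_factor n m q b) * (1 - n / P - (n / P)\<^sup>2) \<le> vgf {1..n} \<sigma> q b"
    unfolding vgf_fixed_eq[OF b, symmetric] P_def 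
    using q b permutes_image[OF \<sigma>] permutes_inj[OF \<sigma>] by (intro vgf_ge) auto
  then show ?thesis by (simp add: field_simps)
qed

lemma vgf_mono: "a \<le> b \<Longrightarrow> vgf {1..n} \<sigma> q a \<le> vgf {1..n} \<sigma> q b"
  unfolding vgf_permutes[OF \<sigma>] using q by (intro sum_mono pgf_mono) auto

end

section \<open>Analytic expansions\<close>

text \<open>Division by \<open>x\<close> makes the logarithm analytic at 0; the singular part
  \<open>ln x\<close> is treated apart wherever \<open>ln (1 - exp (- x))\<close> occurs.\<close>

definition lnp :: "real \<Rightarrow> real" where
  "lnp x = ln ((1 - exp (- x)) / x)"

text \<open>An explicit constant and radius replace the asymptotic statement, because the expansion
  is used at a number of arguments growing with \<open>n\<close> and the errors are summed.\<close>

lemma lnp_expansion: "\<exists>C>0. \<exists>X>0. \<forall>x. 0 < x \<and> x < X \<longrightarrow> \<bar>lnp x - (x\<^sup>2 / 24 - x / 2)\<bar> \<le> C * x ^ 3"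
proof -
  have "(\<lambda>x. lnp x - (x\<^sup>2 / 24 - x / 2)) \<in> O[at_right 0](\<lambda>x::real. x ^ 3)"
    unfolding lnp_def by real_asymp
  then obtain C where C: "C > 0" "eventually (\<lambda>x. norm (lnp x - (x\<^sup>2 / 24 - x / 2)) \<le> C * norm (x ^ 3)) (at_right 0)"
    by (elim landau_o.bigE)
  then obtain X where X: "X > 0" "\<And>x. 0 < x \<Longrightarrow> x < X \<Longrightarrow> norm (lnp x - (x\<^sup>2 / 24 - x / 2)) \<le> C * norm (x ^ 3)"
    unfolding eventually_at_right_field by auto
  have "\<bar>lnp x - (x\<^sup>2 / 24 - x / 2)\<bar> \<le> C * x ^ 3" if "0 < x" "x < X" for x
    using X(2)[OF that] that(1) by simp
  then show ?thesis using C X by blast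
qed

lemma ln_one_plus_expansion:
  "\<exists>C>0. \<exists>X>0. \<forall>z::real. \<bar>z\<bar> < X \<longrightarrow> \<bar>ln (1 + z) - (z - z\<^sup>2 / 2)\<bar> \<le> C * \<bar>z\<bar> ^ 3"
proof -
  have "(\<lambda>z. ln (1 + z) - (z - z\<^sup>2 / 2)) \<in> O[at 0](\<lambda>z::real. z ^ 3)" by real_asymp
  then obtain C where C: "C > 0" "eventually (\<lambda>z. norm (ln (1 + z) - (z - z\<^sup>2 / 2)) \<le> C * norm (z ^ 3)) (at (0::real))"
    by (elim landau_o.bigE)
  then obtain X where X: "X > 0" "\<And>z::real. z \<noteq> 0 \<Longrightarrow> \<bar>z\<bar> < X \<Longrightarrow> norm (ln (1 + z) - (z - z\<^sup>2 / 2)) \<le> C * norm (z ^ 3)"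
    unfolding eventually_at by (auto simp: dist_real_def)
  have "\<bar>ln (1 + z) - (z - z\<^sup>2 / 2)\<bar> \<le> C * \<bar>z\<bar> ^ 3" if "\<bar>z\<bar> < X" for z
    using X(2)[OF _ that] by (cases "z = 0") (simp_all add: power_abs)
  then show ?thesis using C X by blast
qed

section \<open>Elementary inequalities with explicit remainders\<close>

lemma nonneg_of_deriv:
  fixes g g' :: "real \<Rightarrow> real"
  assumes "\<And>x. 0 \<le> x \<Longrightarrow> (g has_real_derivative g' x) (at x)" "\<And>x. 0 \<le> x \<Longrightarrow> 0 \<le> g' x" "g 0 = 0" "0 \<le> x"
  shows "0 \<le> g x"
  using DERIV_nonneg_imp_nondecreasing[of 0 x g] assms by metis

lemma exp_minus_le: "0 \<le> d \<Longrightarrow> exp (- d) \<le> 1 - d + d\<^sup>2 / 2" for d :: real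
proof -
  assume d: "0 \<le> d"
  have "0 \<le> 1 - d + d\<^sup>2 / 2 - exp (- d)"
  proof (rule nonneg_of_deriv[where g' = "\<lambda>d. - 1 + d + exp (- d)", OF _ _ _ d])
    fix x :: real
    show "((\<lambda>d. 1 - d + d\<^sup>2 / 2 - exp (- d)) has_real_derivative - 1 + x + exp (- x)) (at x)"
      by (auto intro!: derivative_eq_intros)
    show "0 \<le> - 1 + x + exp (- x)" using exp_ge_add_one_self[of "- x"] by simp
  qed simp
  then show ?thesis by simp
qed

lemma exp_minus_ge: "0 \<le> d \<Longrightarrow> 1 - d + d\<^sup>2 / 2 - d ^ 3 / 6 \<le> exp (- d)" for d :: real
proof -
  assume d: "0 \<le> d"
  have "0 \<le> exp (- d) - (1 - d + d\<^sup>2 / 2 - d ^ 3 / 6)"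
  proof (rule nonneg_of_deriv[where g' = "\<lambda>d. - exp (- d) + (1 - d + d\<^sup>2 / 2)", OF _ _ _ d])
    fix x :: real
    show "((\<lambda>d. exp (- d) - (1 - d + d\<^sup>2 / 2 - d ^ 3 / 6)) has_real_derivative - exp (- x) + (1 - x + x\<^sup>2 / 2)) (at x)"
      by (auto intro!: derivative_eq_intros)
    show "0 \<le> - exp (- x) + (1 - x + x\<^sup>2 / 2)" if "0 \<le> x" using exp_minus_le[OF that] by simp
  qed simp
  then show ?thesis by simp
qed

lemma ln_one_plus_bounds:
  fixes z :: real
  assumes z: "0 \<le> z"
  shows "z - z\<^sup>2 / 2 \<le> ln (1 + z)" "ln (1 + z) \<le> z - z\<^sup>2 / 2 + z ^ 3 / 3"
proof -
  have "0 \<le> ln (1 + z) - (z - z\<^sup>2 / 2)"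
  proof (rule nonneg_of_deriv[where g' = "\<lambda>z. z\<^sup>2 / (1 + z)", OF _ _ _ z])
    fix x :: real assume "0 \<le> x"
    then show "((\<lambda>z. ln (1 + z) - (z - z\<^sup>2 / 2)) has_real_derivative x\<^sup>2 / (1 + x)) (at x)"
      by (auto intro!: derivative_eq_intros simp: field_simps power2_eq_square)
  qed auto
  then show "z - z\<^sup>2 / 2 \<le> ln (1 + z)" by simp
  have "0 \<le> (z - z\<^sup>2 / 2 + z ^ 3 / 3) - ln (1 + z)"
  proof (rule nonneg_of_deriv[where g' = "\<lambda>z. z ^ 3 / (1 + z)", OF _ _ _ z])
    fix x :: real assume "0 \<le> x"
    then show "((\<lambda>z. (z - z\<^sup>2 / 2 + z ^ 3 / 3) - ln (1 + z)) has_real_derivative x ^ 3 / (1 + x)) (at x)"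
      by (auto intro!: derivative_eq_intros simp: field_simps power2_eq_square power3_eq_cube)
  qed auto
  then show "ln (1 + z) \<le> z - z\<^sup>2 / 2 + z ^ 3 / 3" by simp
qed

text \<open>The \<open>n + 1\<close> nodes include both end points, so the sum is a left sum plus
  \<open>f 1 / n\<close> and also a right sum plus \<open>f 0 / n\<close>; for antitone
  \<open>f\<close> the left and right sums enclose the integral.\<close>

lemma riemann_sum_antimono:
  fixes f H :: "real \<Rightarrow> real" and n :: nat
  assumes H: "\<And>x. 0 \<le> x \<Longrightarrow> x \<le> 1 \<Longrightarrow> (H has_real_derivative f x) (at x)"
    and anti: "\<And>x y. 0 \<le> x \<Longrightarrow> x \<le> y \<Longrightarrow> y \<le> 1 \<Longrightarrow> f y \<le> f x"
    and nonneg: "0 \<le> f 1" and n: "1 \<le> n"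
  shows "\<bar>(\<Sum>i\<le>n. f (i / n)) / n - (H 1 - H 0)\<bar> \<le> f 0 / n"
proof -
  let ?x = "\<lambda>i::nat. real i / n"
  have step: "f (?x (Suc i)) / n \<le> H (?x (Suc i)) - H (?x i) \<and> H (?x (Suc i)) - H (?x i) \<le> f (?x i) / n"
    if i: "i < n" for i
  proof -
    have "?x i < ?x (Suc i)" using n by (simp add: divide_strict_right_mono)
    moreover have b: "0 \<le> ?x i" "?x (Suc i) \<le> 1" using i n by (auto simp: field_simps)
    ultimately obtain z where z: "?x i < z" "z < ?x (Suc i)" "H (?x (Suc i)) - H (?x i) = (?x (Suc i) - ?x i) * f z"
      using MVT2[of "?x i" "?x (Suc i)" H f] H by (metis order.trans)
    have "?x (Suc i) - ?x i = 1 / n" by (simp add: add_divide_distrib)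
    then have e: "H (?x (Suc i)) - H (?x i) = f z / n" using z(3) by simp
    have "f (?x (Suc i)) \<le> f z" by (rule anti) (use z b in linarith)+
    moreover have "f z \<le> f (?x i)" by (rule anti) (use z b in linarith)+
    ultimately show ?thesis unfolding e by (simp add: divide_right_mono)
  qed
  have tel: "(\<Sum>i<n. H (?x (Suc i)) - H (?x i)) = H 1 - H 0"
    using sum_lessThan_telescope[of "\<lambda>i. H (?x i)" n] n by simp
  have lower: "H 1 - H 0 \<le> (\<Sum>i<n. f (?x i) / n)"
    unfolding tel[symmetric] using step by (intro sum_mono) auto
  have upper: "(\<Sum>i<n. f (?x (Suc i)) / n) \<le> H 1 - H 0"
    unfolding tel[symmetric] using step by (intro sum_mono) auto
  have "(\<Sum>i\<le>n. f (?x i)) / n = (\<Sum>i\<le>n. f (?x i) / n)" by (rule sum_divide_distrib)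
  also have "\<dots> = (\<Sum>i<Suc n. f (?x i) / n)" by (simp only: lessThan_Suc_atMost)
  finally have S: "(\<Sum>i\<le>n. f (?x i)) / n = (\<Sum>i<Suc n. f (?x i) / n)" .
  have "(\<Sum>i<Suc n. f (?x i) / n) = (\<Sum>i<n. f (?x i) / n) + f 1 / n" using n by simp
  moreover have "(\<Sum>i<Suc n. f (?x i) / n) = f 0 / n + (\<Sum>i<n. f (?x (Suc i)) / n)"
    by (subst sum.lessThan_Suc_shift) simp
  moreover have "0 \<le> f 1 / n" using nonneg by simp
  ultimately show ?thesis unfolding S using lower upper by linarith
qed

text \<open>The logarithm is expanded at \<open>k * x\<close> with \<open>x = 1 - exp (- d)\<close>,
  uniformly in \<open>k \<le> K\<close>. The three terms of the constant come from the cubic error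
  of \<open>x\<close>, from replacing \<open>x\<^sup>2\<close> by \<open>d\<^sup>2\<close>, and from
  the third-order term of the logarithm.\<close>

lemma ln_occupation_expansion:
  fixes k d K :: real
  assumes k: "0 \<le> k" "k \<le> K" and d: "0 \<le> d"
  shows "\<bar>ln (1 + k * (1 - exp (- d))) - (k * d - (k + k\<^sup>2) * d\<^sup>2 / 2)\<bar> \<le> (K + K\<^sup>2 + K ^ 3) * d ^ 3"
proof -
  define x where "x = 1 - exp (- d)"
  define z where "z = k * x"
  have x0: "0 \<le> x" "x \<le> d" using d exp_ge_add_one_self[of "-d"] by (auto simp: x_def)
  have z0: "0 \<le> z" "z \<le> k * d" using x0 k by (auto simp: z_def mult_left_mono)
  have xl: "d - d\<^sup>2 / 2 \<le> x" using exp_minus_le[OF d] by (simp add: x_def)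
  have xu: "x \<le> d - d\<^sup>2 / 2 + d ^ 3 / 6" using exp_minus_ge[OF d] by (simp add: x_def)
  note L = ln_one_plus_bounds[OF z0(1)]
  have kz: "\<bar>z - k * (d - d\<^sup>2 / 2)\<bar> \<le> K * d ^ 3"
  proof -
    have "\<bar>z - k * (d - d\<^sup>2 / 2)\<bar> = k * \<bar>x - (d - d\<^sup>2 / 2)\<bar>"
      using k by (simp add: z_def abs_mult right_diff_distrib[symmetric])
    also have "\<dots> \<le> K * d ^ 3" using xl xu k d by (intro mult_mono) auto
    finally show ?thesis .
  qed
  have "d\<^sup>2 - x\<^sup>2 = (d - x) * (d + x)" by (simp add: power2_eq_square algebra_simps)
  also have "\<dots> \<le> (d\<^sup>2 / 2) * (2 * d)" using xl x0 d by (intro mult_mono) auto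
  finally have dx: "d\<^sup>2 - x\<^sup>2 \<le> d ^ 3" by (simp add: power2_eq_square power3_eq_cube)
  have dx0: "x\<^sup>2 \<le> d\<^sup>2" using x0 by (simp add: power_mono)
  have "\<bar>z\<^sup>2 - k\<^sup>2 * d\<^sup>2\<bar> = k\<^sup>2 * (d\<^sup>2 - x\<^sup>2)"
    using dx0 by (simp add: z_def power_mult_distrib abs_minus_commute right_diff_distrib[symmetric] abs_mult)
  also have "\<dots> \<le> K\<^sup>2 * d ^ 3" using dx dx0 k by (intro mult_mono power_mono) auto
  finally have z2: "\<bar>z\<^sup>2 - k\<^sup>2 * d\<^sup>2\<bar> \<le> K\<^sup>2 * d ^ 3" .
  have "z \<le> K * d" using z0 k d by (meson mult_right_mono order.trans)
  then have "z ^ 3 \<le> (K * d) ^ 3" using z0 by (intro power_mono) auto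
  then have z3: "z ^ 3 \<le> K ^ 3 * d ^ 3" by (simp add: power_mult_distrib)
  have K3: "0 \<le> K ^ 3 * d ^ 3" "0 \<le> K\<^sup>2 * d ^ 3" using k d by auto
  have "(K + K\<^sup>2 + K ^ 3) * d ^ 3 = K * d ^ 3 + K\<^sup>2 * d ^ 3 + K ^ 3 * d ^ 3" by (simp add: algebra_simps)
  moreover have "k * d - (k + k\<^sup>2) * d\<^sup>2 / 2 = k * (d - d\<^sup>2 / 2) - k\<^sup>2 * d\<^sup>2 / 2" by (simp add: algebra_simps)
  moreover have "0 \<le> z ^ 3" using z0 by simp
  ultimately show ?thesis unfolding x_def[symmetric] z_def[symmetric] using kz z2 L z3 K3 by linarith
qed

text \<open>The Bose-Einstein occupation number \<open>k\<close> satisfies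
  \<open>k' = - k * (1 + k)\<close> and \<open>k'' = k * (1 + k) * (1 + 2 * k)\<close>. It is
  therefore convex, and its second derivative is largest at the left end \<open>y1\<close>.\<close>

lemma occupation_taylor:
  fixes y y0 K :: real
  defines "k \<equiv> \<lambda>y::real. 1 / (exp y - 1)"
  assumes "0 < y0" "0 < y1" "y1 \<le> y0" "y1 \<le> y" and K: "K = k y1"
  shows "0 \<le> k y - (k y0 - k y0 * (1 + k y0) * (y - y0))"
    and "k y - (k y0 - k y0 * (1 + k y0) * (y - y0)) \<le> K * (1 + K) * (1 + 2 * K) * (y - y0)\<^sup>2"
proof -
  have kpos: "0 < k x" if "y1 \<le> x" for x using that assms(3) by (simp add: k_def)
  have kle: "k x \<le> K" if "y1 \<le> x" for x unfolding K k_def using that assms(3)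
    by (intro divide_left_mono mult_pos_pos) auto
  define k1 where "k1 x = - (k x * (1 + k x))" for x
  define k2 where "k2 x = k x * (1 + k x) * (1 + 2 * k x)" for x
  have D1: "(k has_real_derivative k1 x) (at x)" if "y1 \<le> x" for x
  proof -
    have ne: "exp x - 1 \<noteq> 0" using that assms(3) by simp
    have "(k has_real_derivative - exp x / (exp x - 1)\<^sup>2) (at x)"
      unfolding k_def using ne by (auto intro!: derivative_eq_intros simp: power2_eq_square)
    moreover have "- exp x / (exp x - 1)\<^sup>2 = k1 x"
      unfolding k1_def k_def using ne by (simp add: field_simps power2_eq_square)
    ultimately show ?thesis by simp
  qed
  have D2: "(k1 has_real_derivative k2 x) (at x)" if "y1 \<le> x" for x
  proof -
    have "(k1 has_real_derivative - (k1 x * (1 + k x) + k1 x * k x)) (at x)"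
      unfolding k1_def[abs_def] using D1[OF that] by (auto intro!: derivative_eq_intros simp: k1_def algebra_simps)
    moreover have "- (k1 x * (1 + k x) + k1 x * k x) = k2 x" unfolding k1_def k2_def by (simp add: algebra_simps)
    ultimately show ?thesis by simp
  qed
  have "\<exists>z\<ge>y1. k y - (k y0 + k1 y0 * (y - y0)) = k2 z / 2 * (y - y0)\<^sup>2"
  proof (cases "y = y0")
    case True
    then show ?thesis by auto
  next
    case False
    define diff where "diff m = (if m = 0 then k else if m = 1 then k1 else k2)" for m :: nat
    have "\<exists>z. (if y < y0 then y < z \<and> z < y0 else y0 < z \<and> z < y) \<and>
      k y = (\<Sum>m<2. (diff m y0 / fact m) * (y - y0) ^ m) + (diff 2 z / fact 2) * (y - y0) ^ 2"
    proof (rule Taylor[where a = "min y y0" and b = "max y y0"])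
      show "\<forall>m t. m < 2 \<and> min y y0 \<le> t \<and> t \<le> max y y0 \<longrightarrow> (diff m has_real_derivative diff (Suc m) t) (at t)"
        using D1 D2 assms(4,5) by (auto simp: diff_def less_2_cases_iff)
    qed (use False in \<open>auto simp: diff_def\<close>)
    then obtain z where z: "(if y < y0 then y < z \<and> z < y0 else y0 < z \<and> z < y)"
      "k y = (\<Sum>m<2. (diff m y0 / fact m) * (y - y0) ^ m) + (diff 2 z / fact 2) * (y - y0) ^ 2" by blast
    have "y1 \<le> z" using z(1) assms(4,5) by (auto split: if_splits)
    moreover have "k y = k y0 + k1 y0 * (y - y0) + k2 z / 2 * (y - y0)\<^sup>2"
      using z(2) by (simp add: diff_def numeral_2_eq_2)
    ultimately show ?thesis by (intro exI[of _ z]) simp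
  qed
  then obtain z where z: "z \<ge> y1" "k y - (k y0 + k1 y0 * (y - y0)) = k2 z / 2 * (y - y0)\<^sup>2" by blast
  have e: "k y - (k y0 - k y0 * (1 + k y0) * (y - y0)) = k2 z / 2 * (y - y0)\<^sup>2" using z(2) by (simp add: k1_def)
  have "0 \<le> k2 z" unfolding k2_def using kpos[OF z(1)] by simp
  then show "0 \<le> k y - (k y0 - k y0 * (1 + k y0) * (y - y0))" unfolding e by simp
  have "k2 z \<le> K * (1 + K) * (1 + 2 * K)"
    unfolding k2_def using kpos[OF z(1)] kle[OF z(1)] by (intro mult_mono) auto
  then have "k2 z / 2 \<le> K * (1 + K) * (1 + 2 * K)" using \<open>0 \<le> k2 z\<close> by simp
  then show "k y - (k y0 - k y0 * (1 + k y0) * (y - y0)) \<le> K * (1 + K) * (1 + 2 * K) * (y - y0)\<^sup>2"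
    unfolding e by (intro mult_right_mono) auto
qed

section \<open>The tilted weights\<close>

lemma exp_diff_le: "\<bar>exp x - exp y\<bar> \<le> exp (max x y) * \<bar>x - y\<bar>" for x y :: real
proof -
  have *: "exp b - exp a \<le> exp b * (b - a)" if "a \<le> b" for a b :: real
  proof -
    have "exp b * (1 + (a - b)) \<le> exp b * exp (a - b)" by (intro mult_left_mono) auto
    then show ?thesis by (simp add: exp_diff algebra_simps)
  qed
  show ?thesis using *[of x y] *[of y x] by (cases "x \<le> y") (auto simp: max_def)
qed

locale tilted =
  fixes s r :: real
  assumes s: "0 < s" and r: "0 < r"
begin

definition t :: "nat \<Rightarrow> real" where "t n = exp (- s / sqrt n)"

definition q :: "nat \<Rightarrow> real" where "q n = exp (- r / (n * sqrt n))"

definition u :: "nat \<Rightarrow> nat \<Rightarrow> real" where "u n i = (s + r * (i / n)) / sqrt n"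

definition w :: "nat \<Rightarrow> nat \<Rightarrow> real" where
  "w n a = (\<Prod>i\<le>n. 1 - t n * q n ^ i) * t n ^ a * hgf n (q n) (Suc a)"

text \<open>This is \<open>r\<close> times the integral of \<open>1 / (s + r * z)\<close> over the
  unit interval, so \<open>y0 / r\<close> is the mean of the geometric sum in units of
  \<open>n * sqrt n\<close>.\<close>

definition y0 :: real where "y0 = ln (1 + r / s)"

text \<open>The argument \<open>b\<close> is the number of letters, that is \<open>Suc a\<close> for
  the summand \<open>a\<close>. The scale \<open>n\<close> is the order of the standard
  deviation.\<close>

definition Z :: "nat \<Rightarrow> nat \<Rightarrow> real" where "Z n b = (b - y0 * n * sqrt n / r) / n"

lemma tq: "t n * q n ^ i = exp (- u n i)"
proof -
  have "t n * q n ^ i = exp (- s / sqrt n + i * (- r / (n * sqrt n)))"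
    unfolding t_def q_def by (simp only: exp_add exp_of_nat_mult)
  also have "- s / sqrt n + i * (- r / (n * sqrt n)) = - u n i"
    by (simp add: u_def add_divide_distrib)
  finally show ?thesis .
qed

lemma t_bounds: "1 \<le> n \<Longrightarrow> 0 < t n \<and> t n < 1"
  and q_bounds: "1 \<le> n \<Longrightarrow> 0 < q n \<and> q n < 1"
  using s r by (auto simp: t_def q_def)

lemma u_bounds:
  assumes "1 \<le> n" "i \<le> n"
  shows "s / sqrt n \<le> u n i" "u n i \<le> (s + r) / sqrt n"
proof -
  have "0 \<le> r * (i / n)" "r * (i / n) \<le> r * 1" using assms r by (auto intro!: mult_left_mono simp: field_simps)
  then show "s / sqrt n \<le> u n i" "u n i \<le> (s + r) / sqrt n"
    unfolding u_def by (auto intro!: divide_right_mono)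
qed

lemma u_pos: "1 \<le> n \<Longrightarrow> i \<le> n \<Longrightarrow> 0 < u n i"
  using u_bounds(1)[of n i] s by (smt (verit) divide_pos_pos of_nat_0_less_iff real_sqrt_gt_zero less_le_trans zero_less_one)

lemma norm_const_pos: "1 \<le> n \<Longrightarrow> 0 < (\<Prod>i\<le>n. 1 - t n * q n ^ i)"
  by (intro prod_pos) (auto simp: tq u_pos)

lemma w_nonneg: "1 \<le> n \<Longrightarrow> 0 \<le> w n a"
  unfolding w_def using norm_const_pos[of n] t_bounds[of n] hgf_nonneg[of "q n" n "Suc a"] q_bounds[of n]
  by (intro mult_nonneg_nonneg) auto

lemma w_sums:
  assumes n: "1 \<le> n" and x: "0 < x" "t n * x < 1"
  shows "(\<lambda>a. w n a * x ^ a) sums (\<Prod>i\<le>n. (1 - exp (- u n i)) / (1 - x * exp (- u n i)))"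
proof -
  have "(\<lambda>a. (t n * x) ^ a * hgf n (q n) (Suc a)) sums (1 / (\<Prod>i\<le>n. 1 - t n * x * q n ^ i))"
    using q_bounds[OF n] t_bounds[OF n] x by (intro hgf_sums) auto
  from sums_mult[OF this, of "\<Prod>i\<le>n. 1 - t n * q n ^ i"]
  have "(\<lambda>a. w n a * x ^ a) sums ((\<Prod>i\<le>n. 1 - t n * q n ^ i) / (\<Prod>i\<le>n. 1 - t n * x * q n ^ i))"
    by (simp add: w_def power_mult_distrib mult_ac)
  also have "(\<Prod>i\<le>n. 1 - t n * x * q n ^ i) = (\<Prod>i\<le>n. 1 - x * exp (- u n i))"
    by (intro prod.cong) (simp_all add: tq[symmetric] mult_ac)
  also have "(\<Prod>i\<le>n. 1 - t n * q n ^ i) = (\<Prod>i\<le>n. 1 - exp (- u n i))" by (simp add: tq)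
  finally show ?thesis by (simp add: prod_dividef)
qed

text \<open>One geometric factor, tilted by \<open>\<theta> / n\<close>. As \<open>u n i\<close> is
  of order \<open>1 / sqrt n\<close>, the relative change \<open>\<theta> / n / u n i\<close> is of
  the same order; two terms of the expansion leave an error of order
  \<open>n powr (- 3 / 2)\<close>, which can be summed over \<open>n + 1\<close> factors.\<close>

lemma mgf_term_expansion:
  "\<exists>C. \<exists>A\<ge>1. \<forall>n \<theta> i. A \<le> sqrt n \<longrightarrow> \<bar>\<theta>\<bar> \<le> K \<longrightarrow> i \<le> n \<longrightarrow>
     0 < u n i - \<theta> / n \<and>
     \<bar>ln ((1 - exp (- u n i)) / (1 - exp (- (u n i - \<theta> / n))))
       - (\<theta> / n / u n i + (\<theta> / n / u n i)\<^sup>2 / 2 - \<theta> / n / 2)\<bar> \<le> C / (n * sqrt n)"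
proof -
  obtain C0 X0 where C0: "0 < C0" "0 < X0" "\<And>x. 0 < x \<Longrightarrow> x < X0 \<Longrightarrow> \<bar>lnp x - (x\<^sup>2 / 24 - x / 2)\<bar> \<le> C0 * x ^ 3"
    using lnp_expansion by blast
  obtain C1 X1 where C1: "0 < C1" "0 < X1" "\<And>z::real. \<bar>z\<bar> < X1 \<Longrightarrow> \<bar>ln (1 + z) - (z - z\<^sup>2 / 2)\<bar> \<le> C1 * \<bar>z\<bar> ^ 3"
    using ln_one_plus_expansion by blast
  define U where "U = s + r"
  \<comment> \<open>In turn: the tilt is at most half of the lower bound \<open>s / R\<close> for
    \<open>u n i\<close>, the arguments \<open>v\<close> and \<open>v - d\<close> stay below the
    radius \<open>X0\<close>, and \<open>d / v\<close> stays below \<open>X1\<close>. The added 1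
    makes the last two conditions strict.\<close>
  define A where "A = max 1 (max (2 * \<bar>K\<bar> / s) (max (2 * U / X0 + 1) (\<bar>K\<bar> / (s * X1) + 1)))"
  \<comment> \<open>The summands come from \<open>v\<^sup>2 - (v - d)\<^sup>2\<close>, divided by
    24; from the two \<open>lnp\<close> errors with weights 1 and 8, since \<open>v - d\<close> may
    be as large as \<open>2 * U / R\<close>; and from the cubic error of
    \<open>ln (1 - d / v)\<close>.\<close>
  define C where "C = \<bar>K\<bar> * U / 8 + 9 * C0 * U ^ 3 + C1 * (\<bar>K\<bar> / s) ^ 3"
  have U: "0 < U" "s \<le> U" using s r by (auto simp: U_def)
  show ?thesis
  proof (rule exI[of _ C], rule exI[of _ A], intro conjI allI impI)
    show "1 \<le> A" by (simp add: A_def)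
    fix n i :: nat and \<theta> :: real
    assume An: "A \<le> sqrt n" and \<theta>: "\<bar>\<theta>\<bar> \<le> K" and i: "i \<le> n"
    define R where "R = sqrt n"
    define d where "d = \<theta> / n"
    define v where "v = u n i"
    have R1: "1 \<le> R" and RK: "2 * \<bar>K\<bar> / s \<le> R" and RX0: "2 * U / X0 < R" and RX1: "\<bar>K\<bar> / (s * X1) < R"
      using An by (auto simp: A_def R_def)
    have Rn: "real n = R\<^sup>2" by (simp add: R_def)
    have n: "1 \<le> n" using R1 by (simp add: R_def)
    have v: "s / R \<le> v" "v \<le> U / R" "0 < v" unfolding v_def R_def U_def using u_bounds[OF n i] u_pos[OF n i] by auto
    have d: "\<bar>d\<bar> \<le> \<bar>K\<bar> / R\<^sup>2" unfolding d_def Rn using \<theta> by (simp add: abs_divide divide_right_mono)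
    have "\<bar>K\<bar> / R\<^sup>2 = \<bar>K\<bar> / R / R" by (simp add: power2_eq_square)
    also have "\<dots> \<le> (s / 2) / R" using RK R1 s by (intro divide_right_mono) (auto simp: field_simps)
    finally have d2: "\<bar>d\<bar> \<le> s / 2 / R" using d by linarith
    have "s / 2 / R = s / R / 2" "0 < s / R" using s R1 by auto
    then have sR: "s / 2 / R < s / R" "0 < s / 2 / R" by linarith+
    have sU: "s / R \<le> U / R" using R1 U by (intro divide_right_mono) auto
    have vd: "0 < v - d" "v - d \<le> 2 * U / R"
    proof -
      show "0 < v - d" using v d2 sR by linarith
      have "v - d \<le> U / R + U / R" using v d2 sR sU by linarith
      then show "v - d \<le> 2 * U / R" by simp
    qed
    then show "0 < u n i - \<theta> / n" by (simp add: v_def d_def)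
    have X: "2 * U / R < X0" using RX0 R1 C0(2) by (simp add: field_simps)
    have vX: "v < X0"
    proof -
      have "U / R \<le> 2 * U / R" using U R1 by (simp add: divide_right_mono)
      then show ?thesis using v X by linarith
    qed
    have e1: "\<bar>lnp v - (v\<^sup>2 / 24 - v / 2)\<bar> \<le> C0 * (U ^ 3 / R ^ 3)"
    proof -
      have "C0 * v ^ 3 \<le> C0 * (U / R) ^ 3" using v C0 by (intro mult_left_mono power_mono) auto
      then show ?thesis using C0(3)[OF v(3) vX] by (simp add: power_divide)
    qed
    have e2: "\<bar>lnp (v - d) - ((v - d)\<^sup>2 / 24 - (v - d) / 2)\<bar> \<le> C0 * (8 * (U ^ 3 / R ^ 3))"
    proof -
      have "C0 * (v - d) ^ 3 \<le> C0 * (2 * U / R) ^ 3" using vd C0 by (intro mult_left_mono power_mono) auto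
      moreover have "(2 * U / R) ^ 3 = 8 * (U ^ 3 / R ^ 3)" by (simp add: power_divide power_mult_distrib)
      moreover have "v - d < X0" using vd X by linarith
      ultimately show ?thesis using C0(3)[OF vd(1)] by fastforce
    qed
    have e3: "\<bar>v\<^sup>2 - (v - d)\<^sup>2\<bar> \<le> 3 * \<bar>K\<bar> * U / R ^ 3"
    proof -
      have "\<bar>v\<^sup>2 - (v - d)\<^sup>2\<bar> = \<bar>d\<bar> * (v + (v - d))"
      proof -
        have "v\<^sup>2 - (v - d)\<^sup>2 = d * (v + (v - d))" by (simp add: power2_eq_square algebra_simps)
        moreover have "\<bar>v + (v - d)\<bar> = v + (v - d)" using v vd by simp
        ultimately show ?thesis by (simp only: abs_mult)
      qed
      also have "\<dots> \<le> (\<bar>K\<bar> / R\<^sup>2) * (U / R + 2 * U / R)"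
        using d v vd by (intro mult_mono add_mono) auto
      also have "\<dots> = 3 * \<bar>K\<bar> * U / R ^ 3" by (simp add: power2_eq_square power3_eq_cube add_divide_distrib[symmetric])
      finally show ?thesis .
    qed
    have dv: "\<bar>d / v\<bar> \<le> \<bar>K\<bar> / s / R"
    proof -
      have "\<bar>d / v\<bar> \<le> (\<bar>K\<bar> / R\<^sup>2) / (s / R)"
        unfolding abs_divide using d v s R1 by (intro frac_le) auto
      also have "\<dots> = \<bar>K\<bar> / s / R" using R1 s by (simp add: field_simps power2_eq_square)
      finally show ?thesis .
    qed
    have e4: "\<bar>ln (1 - d / v) - (- (d / v) - (d / v)\<^sup>2 / 2)\<bar> \<le> C1 * ((\<bar>K\<bar> / s) ^ 3 / R ^ 3)"
    proof -
      have "\<bar>K\<bar> / s / R < X1" using RX1 R1 s C1(2) by (simp add: field_simps)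
      then have "\<bar>- (d / v)\<bar> < X1" using dv by simp
      from C1(3)[OF this] have "\<bar>ln (1 - d / v) - (- (d / v) - (d / v)\<^sup>2 / 2)\<bar> \<le> C1 * \<bar>d / v\<bar> ^ 3" by simp
      also have "\<dots> \<le> C1 * (\<bar>K\<bar> / s / R) ^ 3" using dv C1 by (intro mult_left_mono power_mono) auto
      also have "(\<bar>K\<bar> / s / R) ^ 3 = (\<bar>K\<bar> / s) ^ 3 / R ^ 3" by (rule power_divide)
      finally show ?thesis .
    qed
    have "ln ((1 - exp (- v)) / (1 - exp (- (v - d)))) = lnp v - lnp (v - d) - ln (1 - d / v)"
    proof -
      have p: "0 < 1 - exp (- v)" "0 < 1 - exp (- (v - d))" using v vd by auto
      have "1 - d / v = (v - d) / v" using v by (simp add: diff_divide_distrib)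
      then have "ln (1 - d / v) = ln (v - d) - ln v" using v vd by (simp add: ln_div)
      then show ?thesis unfolding lnp_def using p v vd by (simp add: ln_div)
    qed
    moreover have "3 * \<bar>K\<bar> * U / R ^ 3 / 24 = \<bar>K\<bar> * U / 8 / R ^ 3" by simp
    moreover have "C / R ^ 3 = \<bar>K\<bar> * U / 8 / R ^ 3 + 9 * (C0 * (U ^ 3 / R ^ 3)) + C1 * ((\<bar>K\<bar> / s) ^ 3 / R ^ 3)"
      by (simp add: C_def add_divide_distrib)
    ultimately have "\<bar>ln ((1 - exp (- v)) / (1 - exp (- (v - d)))) - (d / v + (d / v)\<^sup>2 / 2 - d / 2)\<bar> \<le> C / R ^ 3"
      using e1 e2 e3 e4 by (simp only: abs_le_iff) argo
    moreover have "real n * sqrt n = R ^ 3" unfolding Rn by (simp add: R_def power2_eq_square power3_eq_cube)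
    ultimately show "\<bar>ln ((1 - exp (- u n i)) / (1 - exp (- (u n i - \<theta> / n))))
       - (\<theta> / n / u n i + (\<theta> / n / u n i)\<^sup>2 / 2 - \<theta> / n / 2)\<bar> \<le> C / (n * sqrt n)"
      by (simp add: v_def d_def)
  qed
qed

end

section \<open>Gaussian limit of the tilted weights\<close>

context tilted
begin

lemma pos_lin: "0 \<le> z \<Longrightarrow> 0 < s + r * z"
  using s r by (simp add: add_pos_nonneg)

text \<open>The limit \<open>y0 / r\<close> is what the centre in \<open>Z\<close> is chosen to
  match. The error must be of order \<open>1 / n\<close>, because it is later multiplied by
  \<open>sqrt n\<close>.\<close>

lemma riemann_1:
  fixes n :: nat
  assumes n: "1 \<le> n"
  shows "\<bar>(\<Sum>i\<le>n. 1 / (s + r * (i / n))) / n - y0 / r\<bar> \<le> 1 / s / n"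
proof -
  have "\<bar>(\<Sum>i\<le>n. 1 / (s + r * (i / n))) / n - (ln (s + r * 1) / r - ln (s + r * 0) / r)\<bar> \<le> (1 / (s + r * 0)) / n"
  proof (rule riemann_sum_antimono)
    fix z :: real assume "0 \<le> z"
    then show "((\<lambda>z. ln (s + r * z) / r) has_real_derivative 1 / (s + r * z)) (at z)"
      using pos_lin[of z] r by (auto intro!: derivative_eq_intros)
  next
    fix z z' :: real assume "0 \<le> z" "z \<le> z'"
    then have "0 < s + r * z" "0 < s + r * z'" "s + r * z \<le> s + r * z'"
      using pos_lin[of z] pos_lin[of z'] r by auto
    then show "1 / (s + r * z') \<le> 1 / (s + r * z)" by (intro divide_left_mono mult_pos_pos) auto
  next
    show "0 \<le> 1 / (s + r * 1)" using pos_lin[of 1] by simp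
  qed (use n in auto)
  moreover have "ln (s + r * 1) / r - ln (s + r * 0) / r = y0 / r"
  proof -
    have "1 + r / s = (s + r) / s" using s by (simp add: field_simps)
    then show ?thesis unfolding y0_def using s r by (simp add: ln_div diff_divide_distrib)
  qed
  ultimately show ?thesis by simp
qed

text \<open>The limit \<open>1 / (s * (s + r))\<close> becomes the variance of \<open>Z\<close>
  under the weights \<open>w\<close>.\<close>

lemma riemann_2:
  fixes n :: nat
  assumes n: "1 \<le> n"
  shows "\<bar>(\<Sum>i\<le>n. 1 / (s + r * (i / n))\<^sup>2) / n - 1 / (s * (s + r))\<bar> \<le> 1 / s\<^sup>2 / n"
proof -
  define H where "H z = - (1 / r) * inverse (s + r * z)" for z
  have "\<bar>(\<Sum>i\<le>n. 1 / (s + r * (i / n))\<^sup>2) / n - (H 1 - H 0)\<bar> \<le> (1 / (s + r * 0)\<^sup>2) / n"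
  proof (rule riemann_sum_antimono)
    fix z :: real assume "0 \<le> z"
    then have ne: "s + r * z \<noteq> 0" "r \<noteq> 0" using pos_lin[of z] r by auto
    have "(H has_real_derivative - (1 / r) * - (inverse (s + r * z) * r * inverse (s + r * z))) (at z)"
      unfolding H_def using ne by (auto intro!: derivative_eq_intros)
    moreover have "- (1 / r) * - (inverse (s + r * z) * r * inverse (s + r * z)) = 1 / (s + r * z)\<^sup>2"
      using ne by (simp add: power2_eq_square inverse_eq_divide)
    ultimately show "(H has_real_derivative 1 / (s + r * z)\<^sup>2) (at z)" by simp
  next
    fix z z' :: real assume "0 \<le> z" "z \<le> z'"
    then have p: "0 < s + r * z" "0 < s + r * z'" "s + r * z \<le> s + r * z'"
      using pos_lin[of z] pos_lin[of z'] r by auto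
    then have "(s + r * z)\<^sup>2 \<le> (s + r * z')\<^sup>2" by (intro power_mono) auto
    then show "1 / (s + r * z')\<^sup>2 \<le> 1 / (s + r * z)\<^sup>2" using p
      by (intro divide_left_mono mult_pos_pos zero_less_power) auto
  next
    show "0 \<le> 1 / (s + r * 1)\<^sup>2" by simp
  qed (use n in auto)
  moreover have "H 1 - H 0 = 1 / (s * (s + r))"
  proof -
    have "H 1 - H 0 = (1 / r) * (1 / s - 1 / (s + r))" by (simp add: H_def inverse_eq_divide algebra_simps)
    also have "1 / s - 1 / (s + r) = r / (s * (s + r))" using s r by (simp add: diff_frac_eq)
    finally show ?thesis using r by simp
  qed
  ultimately show ?thesis by simp
qed

lemma sum_inverse_u:
  fixes n :: nat
  assumes n: "1 \<le> n"
  shows "(\<Sum>i\<le>n. \<theta> / n / u n i) = \<theta> * sqrt n * ((\<Sum>i\<le>n. 1 / (s + r * (i / n))) / n)"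
    and "(\<Sum>i\<le>n. (\<theta> / n / u n i)\<^sup>2 / 2) = \<theta>\<^sup>2 / 2 * ((\<Sum>i\<le>n. 1 / (s + r * (i / n))\<^sup>2) / n)"
proof -
  have e: "\<theta> / n / u n i = \<theta> * sqrt n / n * (1 / (s + r * (i / n)))" for i
    unfolding u_def by (simp only: divide_divide_eq_right times_divide_eq_right times_divide_eq_left divide_divide_eq_left mult_1_right)
  show "(\<Sum>i\<le>n. \<theta> / n / u n i) = \<theta> * sqrt n * ((\<Sum>i\<le>n. 1 / (s + r * (i / n))) / n)"
    unfolding e sum_distrib_left[symmetric] by simp
  have e2: "(\<theta> / n / u n i)\<^sup>2 / 2 = \<theta>\<^sup>2 / 2 / n * (1 / (s + r * (i / n))\<^sup>2)" for i
  proof -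
    have "(sqrt n / n)\<^sup>2 = 1 / n" using n by (simp add: power_divide power2_eq_square)
    moreover have "(\<theta> / n / u n i)\<^sup>2 = \<theta>\<^sup>2 * (sqrt n / n)\<^sup>2 * (1 / (s + r * (i / n)))\<^sup>2"
      unfolding e by (simp only: power_mult_distrib power_divide times_divide_eq_right times_divide_eq_left)
    moreover have "(1 / (s + r * (i / n)))\<^sup>2 = 1 / (s + r * (i / n))\<^sup>2" by (simp add: power_divide)
    ultimately show ?thesis by simp
  qed
  show "(\<Sum>i\<le>n. (\<theta> / n / u n i)\<^sup>2 / 2) = \<theta>\<^sup>2 / 2 * ((\<Sum>i\<le>n. 1 / (s + r * (i / n))\<^sup>2) / n)"
    unfolding e2 sum_distrib_left[symmetric] by simp
qed

text \<open>Under \<open>w\<close> the variable \<open>Z\<close> tends to a Gaussian with mean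
  \<open>- 1 / 2\<close> and variance \<open>1 / (s * (s + r))\<close>. A geometric variable has
  mean \<open>1 / u - 1 / 2\<close> to second order: the terms \<open>1 / u\<close> are removed by
  the centring, and the terms \<open>- 1 / 2\<close>, about \<open>n\<close> of them divided by
  \<open>n\<close>, remain.\<close>

lemma mgf_w:
  "\<exists>C. \<exists>A\<ge>1. \<forall>n \<theta>. A \<le> sqrt n \<longrightarrow> \<bar>\<theta>\<bar> \<le> K \<longrightarrow>
    (\<exists>M. (\<lambda>a. w n a * exp (\<theta> * Z n (Suc a))) sums M \<and>
      \<bar>M - exp (\<theta>\<^sup>2 / (2 * (s * (s + r))) - \<theta> / 2)\<bar> \<le> C / sqrt n)"
proof -
  obtain C0 A where A: "1 \<le> A" and C0: "\<And>n \<theta> i. A \<le> sqrt (real n) \<Longrightarrow> \<bar>\<theta>\<bar> \<le> K \<Longrightarrow> i \<le> n \<Longrightarrow>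
     0 < u n i - \<theta> / n \<and>
     \<bar>ln ((1 - exp (- u n i)) / (1 - exp (- (u n i - \<theta> / n))))
       - (\<theta> / n / u n i + (\<theta> / n / u n i)\<^sup>2 / 2 - \<theta> / n / 2)\<bar> \<le> C0 / (n * sqrt n)"
    using mgf_term_expansion[of K] by blast
  define C1 where "C1 = \<bar>K\<bar> + 2 * \<bar>C0\<bar> + \<bar>K\<bar> / s + K\<^sup>2 / (2 * s\<^sup>2)"
  define T where "T = K\<^sup>2 / (2 * (s * (s + r))) + \<bar>K\<bar> / 2"
  have C1: "0 \<le> C1" unfolding C1_def using s by simp
  show ?thesis
  proof (rule exI[of _ "exp (T + C1) * C1"], rule exI[of _ A], intro conjI allI impI A)
    fix n :: nat and \<theta> :: real
    assume An: "A \<le> sqrt n" and \<theta>: "\<bar>\<theta>\<bar> \<le> K"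
    define R where "R = sqrt n"
    define d where "d = \<theta> / n"
    have R1: "1 \<le> R" using An A unfolding R_def by linarith
    have Rn: "real n = R\<^sup>2" by (simp add: R_def)
    have n: "1 \<le> n" using R1 by (simp add: R_def)
    have Rn': "R \<le> real n" unfolding Rn using R1 by (simp add: power2_eq_square)
    define L where "L i = ln ((1 - exp (- u n i)) / (1 - exp (- (u n i - d))))" for i
    have ud: "0 < u n i - d" if "i \<le> n" for i using C0[OF An \<theta> that] by (simp add: d_def)
    have Lb: "\<bar>L i - (d / u n i + (d / u n i)\<^sup>2 / 2 - d / 2)\<bar> \<le> C0 / (n * R)" if "i \<le> n" for i
      using C0[OF An \<theta> that] by (simp add: L_def d_def R_def)
    have C00: "0 \<le> C0"
    proof -
      have "0 \<le> C0 / (n * R)" using Lb[of 0] by linarith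
      moreover have "0 < n * R" using n R1 by simp
      ultimately show ?thesis using divide_neg_pos[of C0 "n * R"] by linarith
    qed
    define x where "x = exp d"
    have tx: "t n * x < 1"
    proof -
      have "t n * x = exp (- s / sqrt n + d)" by (simp only: t_def x_def exp_add)
      also have "- s / sqrt n + d = - (u n 0 - d)" by (simp add: u_def)
      finally have "t n * x = exp (- (u n 0 - d))" .
      then show ?thesis using ud[of 0] by simp
    qed
    have prod: "(\<Prod>i\<le>n. (1 - exp (- u n i)) / (1 - x * exp (- u n i))) = exp (\<Sum>i\<le>n. L i)"
    proof -
      have "(1 - exp (- u n i)) / (1 - x * exp (- u n i)) = exp (L i)" if "i \<le> n" for i
      proof -
        have "x * exp (- u n i) = exp (d + - u n i)" by (simp only: x_def exp_add)
        also have "d + - u n i = - (u n i - d)" by simp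
        finally have "x * exp (- u n i) = exp (- (u n i - d))" .
        moreover have "0 < (1 - exp (- u n i)) / (1 - exp (- (u n i - d)))"
          using u_pos[OF n that] ud[OF that] by simp
        ultimately show ?thesis unfolding L_def by simp
      qed
      then show ?thesis by (simp add: exp_sum)
    qed
    \<comment> \<open>The summand \<open>d\<close> accounts for \<open>Suc a\<close> in place of
      \<open>a\<close>; the rest is the centring of \<open>Z\<close>.\<close>
    define e where "e = d - \<theta> * y0 * R / r"
    define M where "M = exp (e + (\<Sum>i\<le>n. L i))"
    have "exp (\<theta> * Z n (Suc a)) = exp e * x ^ a" for a
    proof -
      have "\<theta> * Z n (Suc a) = e + a * d"
        unfolding Z_def e_def d_def R_def using n by (simp add: field_simps)
      then show ?thesis by (simp only: exp_add exp_of_nat_mult x_def)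
    qed
    then have "(\<lambda>a. w n a * exp (\<theta> * Z n (Suc a))) = (\<lambda>a. exp e * (w n a * x ^ a))" by (simp add: mult_ac)
    moreover have "(\<lambda>a. exp e * (w n a * x ^ a)) sums M"
      using sums_mult[OF w_sums[OF n _ tx], of "exp e"] unfolding prod M_def by (simp add: exp_add x_def)
    ultimately have sums: "(\<lambda>a. w n a * exp (\<theta> * Z n (Suc a))) sums M" by simp
    define S1 where "S1 = (\<Sum>i\<le>n. 1 / (s + r * (i / n))) / n"
    define S2 where "S2 = (\<Sum>i\<le>n. 1 / (s + r * (i / n))\<^sup>2) / n"
    have R1s: "\<bar>S1 - y0 / r\<bar> \<le> 1 / s / n" unfolding S1_def by (rule riemann_1[OF n])
    have R2s: "\<bar>S2 - 1 / (s * (s + r))\<bar> \<le> 1 / s\<^sup>2 / n" unfolding S2_def by (rule riemann_2[OF n])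
    have sum1: "(\<Sum>i\<le>n. d / u n i) = \<theta> * R * S1"
      unfolding d_def R_def S1_def by (rule sum_inverse_u[OF n])
    have sum2: "(\<Sum>i\<le>n. (d / u n i)\<^sup>2 / 2) = \<theta>\<^sup>2 / 2 * S2"
      unfolding d_def S2_def by (rule sum_inverse_u[OF n])
    have sumL: "\<bar>(\<Sum>i\<le>n. L i) - (\<Sum>i\<le>n. d / u n i + (d / u n i)\<^sup>2 / 2 - d / 2)\<bar> \<le> 2 * C0 / R"
    proof -
      have "\<bar>(\<Sum>i\<le>n. L i) - (\<Sum>i\<le>n. d / u n i + (d / u n i)\<^sup>2 / 2 - d / 2)\<bar>
        \<le> (\<Sum>i\<le>n. C0 / (n * R))"
        unfolding sum_subtractf[symmetric] using Lb by (intro order.trans[OF sum_abs] sum_mono) auto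
      also have "\<dots> = (n + 1) * (C0 / (n * R))" by simp
      also have "\<dots> \<le> (2 * n) * (C0 / (n * R))"
        using n C00 R1 by (intro mult_right_mono) auto
      also have "\<dots> = 2 * C0 / R" using n by simp
      finally show ?thesis .
    qed
    have expand: "(\<Sum>i\<le>n. d / u n i + (d / u n i)\<^sup>2 / 2 - d / 2) =
       \<theta> * R * S1 + \<theta>\<^sup>2 / 2 * S2 - \<theta> / 2 - d / 2"
    proof -
      have "(\<Sum>i\<le>n. d / 2) = \<theta> / 2 + d / 2" using n by (simp add: d_def field_simps)
      then show ?thesis unfolding sum_subtractf sum.distrib sum1 sum2 by linarith
    qed
    define tgt where "tgt = \<theta>\<^sup>2 / (2 * (s * (s + r))) - \<theta> / 2"
    define E where "E = (\<Sum>i\<le>n. L i) - (\<theta> * R * S1 + \<theta>\<^sup>2 / 2 * S2 - \<theta> / 2 - d / 2)"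
    have E: "\<bar>E\<bar> \<le> 2 * C0 / R" using sumL unfolding expand E_def .
    have b1: "\<bar>\<theta> * R * (S1 - y0 / r)\<bar> \<le> \<bar>K\<bar> / s / R"
    proof -
      have K: "\<bar>\<theta>\<bar> * \<bar>R\<bar> \<le> \<bar>K\<bar> * R"
        using \<theta> R1 by (intro mult_mono) linarith+
      have "\<bar>\<theta> * R * (S1 - y0 / r)\<bar> = \<bar>\<theta>\<bar> * \<bar>R\<bar> * \<bar>S1 - y0 / r\<bar>" by (simp only: abs_mult)
      also have "\<dots> \<le> \<bar>K\<bar> * R * (1 / s / n)"
        by (rule mult_mono[OF K R1s]) (use R1 in auto)
      also have "\<dots> = \<bar>K\<bar> / s / R" unfolding Rn using R1 by (simp add: power2_eq_square)
      finally show ?thesis .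
    qed
    have b2: "\<bar>\<theta>\<^sup>2 / 2 * (S2 - 1 / (s * (s + r)))\<bar> \<le> K\<^sup>2 / (2 * s\<^sup>2) / R"
    proof -
      have "\<theta>\<^sup>2 \<le> K\<^sup>2" using \<theta> abs_le_square_iff[of \<theta> K] by linarith
      then have "\<bar>\<theta>\<^sup>2 / 2\<bar> \<le> K\<^sup>2 / 2" by simp
      from mult_mono[OF this R2s] have "\<bar>\<theta>\<^sup>2 / 2 * (S2 - 1 / (s * (s + r)))\<bar> \<le> K\<^sup>2 / 2 * (1 / s\<^sup>2 / n)"
        unfolding abs_mult by simp
      also have "\<dots> \<le> K\<^sup>2 / 2 * (1 / s\<^sup>2 / R)"
        using Rn' R1 by (intro mult_left_mono divide_left_mono) auto
      finally show ?thesis by simp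
    qed
    have b3: "\<bar>d / 2\<bar> \<le> \<bar>K\<bar> / R"
    proof -
      have "\<bar>d / 2\<bar> \<le> \<bar>d\<bar>" by simp
      also have "\<bar>d\<bar> = \<bar>\<theta>\<bar> / n" by (simp add: d_def)
      also have "\<dots> \<le> \<bar>K\<bar> / n" using \<theta> by (intro divide_right_mono) auto
      also have "\<dots> \<le> \<bar>K\<bar> / R" using Rn' R1 by (intro divide_left_mono) auto
      finally show ?thesis .
    qed
    have eq: "e + (\<Sum>i\<le>n. L i) - tgt = d / 2 + E + \<theta> * R * (S1 - y0 / r) + \<theta>\<^sup>2 / 2 * (S2 - 1 / (s * (s + r)))"
    proof -
      have "\<theta> * R * (S1 - y0 / r) = \<theta> * R * S1 - \<theta> * y0 * R / r" by (simp add: right_diff_distrib)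
      moreover have "\<theta>\<^sup>2 / 2 * (S2 - 1 / (s * (s + r))) = \<theta>\<^sup>2 / 2 * S2 - \<theta>\<^sup>2 / (2 * (s * (s + r)))"
        by (simp add: right_diff_distrib)
      ultimately show ?thesis unfolding E_def e_def tgt_def by linarith
    qed
    have "C1 / R = \<bar>K\<bar> / R + 2 * C0 / R + \<bar>K\<bar> / s / R + K\<^sup>2 / (2 * s\<^sup>2) / R"
      using C00 by (simp add: C1_def add_divide_distrib)
    then have diff: "\<bar>e + (\<Sum>i\<le>n. L i) - tgt\<bar> \<le> C1 / R"
      unfolding eq using b1 b2 b3 E by linarith
    have "C1 / R \<le> C1" using C1 R1 by (simp add: divide_le_eq mult_le_cancel_left1)
    moreover have "tgt \<le> T"
    proof -
      have "\<theta>\<^sup>2 \<le> K\<^sup>2" using \<theta> abs_le_square_iff[of \<theta> K] by linarith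
      then have "\<theta>\<^sup>2 / (2 * (s * (s + r))) \<le> K\<^sup>2 / (2 * (s * (s + r)))"
        using s r by (intro divide_right_mono) auto
      then show ?thesis unfolding tgt_def T_def using \<theta> by linarith
    qed
    ultimately have "max (e + (\<Sum>i\<le>n. L i)) tgt \<le> T + C1" using diff C1 by linarith
    then have "\<bar>M - exp tgt\<bar> \<le> exp (T + C1) * (C1 / R)"
      unfolding M_def using diff
      by (intro order.trans[OF exp_diff_le] mult_mono) auto
    then show "\<exists>M. (\<lambda>a. w n a * exp (\<theta> * Z n (Suc a))) sums M \<and>
      \<bar>M - exp (\<theta>\<^sup>2 / (2 * (s * (s + r))) - \<theta> / 2)\<bar> \<le> exp (T + C1) * C1 / sqrt n"
      using sums unfolding tgt_def R_def by (intro exI[of _ M]) simp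
  qed
qed

text \<open>The part \<open>a < a0 n\<close> of the series is negligible: \<open>\<delta>\<close> is so small that the factor
  \<open>exp (- 2 * n)\<close> of the Chernoff bound below outweighs both \<open>inverse (t n ^ a0 n)\<close> and the
  cost of the tilt.\<close>

definition \<delta> :: real where "\<delta> = 1 / (s + 2 * exp 2 * (s + r))"

definition a0 :: "nat \<Rightarrow> nat" where "a0 n = nat \<lfloor>\<delta> * n * sqrt n\<rfloor>"

lemma delta_pos: "0 < \<delta>"
  unfolding \<delta>_def using s r by (intro divide_pos_pos add_pos_pos mult_pos_pos) auto

lemma a0_le: "real (a0 n) \<le> \<delta> * n * sqrt n"
  unfolding a0_def using delta_pos by (simp add: mult_nonneg_nonneg)

lemma a0_less: "\<delta> * n * sqrt n < real (Suc (a0 n))"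
  unfolding a0_def by linarith

text \<open>A Chernoff bound: a tilt by \<open>\<theta>\<close> of order \<open>1 / sqrt n\<close> gains \<open>exp (- 2)\<close> in each of the
  \<open>n + 1\<close> factors of the generating function.\<close>

lemma low_mass:
  assumes n: "2 * exp 2 * (s + r) \<le> sqrt n"
  shows "(\<Sum>a\<le>a0 n. w n a) \<le> exp (- real n - s * \<delta> * n)"
proof -
  define R where "R = sqrt n"
  have "0 < 2 * exp 2 * (s + r)" using s r by (intro mult_pos_pos add_pos_pos) auto
  then have R0: "0 < R" using n unfolding R_def by linarith
  have n1: "1 \<le> n" using R0 unfolding R_def by (cases n) auto
  \<comment> \<open>Chosen so that \<open>\<theta> / 2 = exp 2 * ((s + r) / R)\<close>: the
    numerator of each factor is at most \<open>(s + r) / R\<close> and the denominator at least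
    \<open>\<theta> / 2\<close>. The hypothesis on \<open>n\<close> says that
    \<open>\<theta> \<le> 1\<close>.\<close>
  define \<theta> where "\<theta> = 2 * exp 2 * (s + r) / R"
  define x where "x = exp (- \<theta>)"
  have th: "0 < \<theta>" "\<theta> \<le> 1" unfolding \<theta>_def using s r R0 n by (auto simp: R_def)
  have x: "0 < x" "x < 1" using th by (auto simp: x_def)
  have tx: "t n * x < 1"
  proof -
    have "t n * x \<le> t n" using t_bounds[OF n1] x by (intro mult_left_le) auto
    then show ?thesis using t_bounds[OF n1] by linarith
  qed
  have half: "\<theta> / 2 \<le> 1 - exp (- \<theta>)"
  proof -
    have "\<theta>\<^sup>2 \<le> \<theta>" unfolding power2_eq_square using th by (intro mult_left_le) auto
    then show ?thesis using exp_minus_le[of \<theta>] th by linarith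
  qed
  have fac: "(1 - exp (- u n i)) / (1 - x * exp (- u n i)) \<le> exp (- 2)" if i: "i \<le> n" for i
  proof -
    have u: "0 < u n i" "u n i \<le> (s + r) / R" using u_pos[OF n1 i] u_bounds[OF n1 i] by (auto simp: R_def)
    have "x * exp (- u n i) \<le> x" using x u by (intro mult_left_le) auto
    then have "\<theta> / 2 \<le> 1 - x * exp (- u n i)" using half unfolding x_def[symmetric] by linarith
    moreover have "1 - exp (- u n i) \<le> (s + r) / R" using exp_ge_add_one_self[of "- u n i"] u by linarith
    ultimately have "(1 - exp (- u n i)) / (1 - x * exp (- u n i)) \<le> ((s + r) / R) / (\<theta> / 2)"
      using th u s r R0 by (intro frac_le) auto
    also have "\<theta> / 2 = (s + r) / R * exp 2" by (simp add: \<theta>_def)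
    also have "(s + r) / R / ((s + r) / R * exp 2) = exp (- 2)"
      using s r R0 by (simp add: exp_minus inverse_eq_divide)
    finally show ?thesis .
  qed
  have sums: "(\<lambda>a. w n a * x ^ a) sums (\<Prod>i\<le>n. (1 - exp (- u n i)) / (1 - x * exp (- u n i)))"
    using w_sums[OF n1 x(1) tx] .
  have nn: "0 \<le> (1 - exp (- u n i)) / (1 - x * exp (- u n i))" if "i \<le> n" for i
  proof -
    have "x * exp (- u n i) \<le> 1" using x u_pos[OF n1 that] by (intro mult_le_one) auto
    then show ?thesis using u_pos[OF n1 that] by (intro divide_nonneg_nonneg) auto
  qed
  have "x ^ a0 n * (\<Sum>a\<le>a0 n. w n a) \<le> (\<Sum>a\<le>a0 n. w n a * x ^ a)"
    unfolding sum_distrib_left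
  proof (rule sum_mono)
    fix a assume "a \<in> {..a0 n}"
    then have "x ^ a0 n \<le> x ^ a" using x by (intro power_decreasing) auto
    then show "x ^ a0 n * w n a \<le> w n a * x ^ a" unfolding mult.commute[of "x ^ a0 n"]
      using w_nonneg[OF n1, of a] by (intro mult_left_mono)
  qed
  also have "\<dots> \<le> (\<Prod>i\<le>n. (1 - exp (- u n i)) / (1 - x * exp (- u n i)))"
    unfolding sums_unique[OF sums] using x w_nonneg[OF n1] sums by (intro sum_le_suminf) (auto simp: sums_iff)
  also have "\<dots> \<le> (\<Prod>i\<le>n. exp (- 2))" using fac nn by (intro prod_mono) auto
  also have "\<dots> = exp (- 2 * real (Suc n))" by (simp only: prod_constant exp_of_nat_mult[symmetric] card_atMost mult.commute)
  also have "\<dots> \<le> exp (- 2 * real n)" by simp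
  finally have "x ^ a0 n * (\<Sum>a\<le>a0 n. w n a) \<le> exp (- 2 * real n)" .
  moreover have "x ^ a0 n = exp (- (a0 n * \<theta>))" by (simp add: x_def exp_of_nat_mult[symmetric])
  ultimately have le: "exp (- (a0 n * \<theta>)) * (\<Sum>a\<le>a0 n. w n a) \<le> exp (- 2 * real n)" by simp
  have "(\<Sum>a\<le>a0 n. w n a) = exp (a0 n * \<theta>) * (exp (- (a0 n * \<theta>)) * (\<Sum>a\<le>a0 n. w n a))"
    by (simp only: mult.assoc[symmetric] mult_exp_exp) simp
  also have "\<dots> \<le> exp (a0 n * \<theta>) * exp (- 2 * real n)"
    using le by (rule mult_left_mono) simp
  also have "\<dots> \<le> exp (\<delta> * n * R * \<theta>) * exp (- 2 * real n)"
    using a0_le[of n] th by (intro mult_right_mono) (auto simp: R_def)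
  also have "\<dots> = exp (- real n - s * \<delta> * n)"
  proof -
    \<comment> \<open>The choice of \<open>\<delta>\<close> makes the cost of the tilt equal to
      \<open>n - s * \<delta> * n\<close>, and the gain \<open>- 2 * n\<close> turns this into the
      claimed exponent.\<close>
    have "\<delta> * n * R * \<theta> = n * (\<delta> * (s + 2 * exp 2 * (s + r))) - s * \<delta> * n"
      unfolding \<theta>_def using R0 by (simp add: field_simps)
    also have "\<delta> * (s + 2 * exp 2 * (s + r)) = 1"
      using delta_pos unfolding \<delta>_def by (auto simp: zero_less_divide_iff)
    finally show ?thesis by (simp add: mult_exp_exp)
  qed
  finally show ?thesis .
qed

end

section \<open>The correction factor\<close>

lemma sum_interval_id:
  "m \<le> n \<Longrightarrow> (\<Sum>j=m..<n. real j) = ((real n)\<^sup>2 - n - ((real m)\<^sup>2 - m)) / 2"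
  by (induction n rule: dec_induct) (simp_all add: power2_eq_square field_simps)

lemma sum_interval_square:
  "m \<le> n \<Longrightarrow> (\<Sum>j=m..<n. (real j)\<^sup>2) = (2 * real n ^ 3 - 3 * (real n)\<^sup>2 + n - (2 * real m ^ 3 - 3 * (real m)\<^sup>2 + m)) / 6"
  by (induction n rule: dec_induct) (simp_all add: power2_eq_square power3_eq_cube field_simps)

context tilted
begin

definition \<epsilon> :: "nat \<Rightarrow> real" where "\<epsilon> n = r / (n * sqrt n)"

definition k :: "nat \<Rightarrow> nat \<Rightarrow> real" where "k n b = 1 / (exp (\<epsilon> n * b) - 1)"

lemma q_power: "q n ^ i = exp (- (\<epsilon> n * i))"
  by (simp add: q_def \<epsilon>_def exp_of_nat_mult[symmetric] mult.commute)

lemma eps_pos: "1 \<le> n \<Longrightarrow> 0 < \<epsilon> n"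
  using r by (simp add: \<epsilon>_def)

text \<open>With \<open>k = q ^ b / (1 - q ^ b)\<close> one has
  \<open>1 - q ^ (b + j) = (1 - q ^ b) * (1 + k * (1 - q ^ j))\<close>, which isolates the
  dependence on \<open>b\<close>; the q-integers divided by \<open>Suc j\<close> are quotients of
  exponentials of \<open>lnp\<close>.\<close>

lemma fixed_factor_eq_exp:
  assumes n: "1 \<le> n" and b: "1 \<le> b"
  shows "fixed_factor n m (q n) b =
    exp (\<Sum>j=m..<n. lnp (\<epsilon> n * Suc j) - lnp (\<epsilon> n) - ln (1 + k n b * (1 - exp (- (\<epsilon> n * j)))))"
proof -
  have e: "0 < \<epsilon> n" using eps_pos[OF n] .
  have lnp_exp: "exp (lnp x) = (1 - exp (- x)) / x" if "0 < x" for x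
    unfolding lnp_def using that by simp
  have pos: "0 < 1 - exp (- (\<epsilon> n * i))" if "1 \<le> i" for i :: nat using e that by simp
  have kpos: "0 \<le> k n b" unfolding k_def using e by simp
  have keq: "k n b * (1 - exp (- (\<epsilon> n * b))) = exp (- (\<epsilon> n * b))"
  proof -
    have "exp (\<epsilon> n * b) - 1 \<noteq> 0" using e b by simp
    then show ?thesis unfolding k_def by (simp add: field_simps exp_minus)
  qed
  have "(1 - q n ^ Suc j) / (real (Suc j) * (1 - q n)) * ((1 - q n ^ b) / (1 - q n ^ (b + j)))
    = exp (lnp (\<epsilon> n * Suc j) - lnp (\<epsilon> n) - ln (1 + k n b * (1 - exp (- (\<epsilon> n * j)))))" for j
  proof -
    have q1: "q n = exp (- \<epsilon> n)" using q_power[of n 1] by simp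
    have 1: "(1 - q n ^ Suc j) / (real (Suc j) * (1 - q n)) = exp (lnp (\<epsilon> n * Suc j)) / exp (lnp (\<epsilon> n))"
    proof -
      have "0 < \<epsilon> n * Suc j" using e by simp
      then have "exp (lnp (\<epsilon> n * Suc j)) / exp (lnp (\<epsilon> n)) = ((1 - q n ^ Suc j) / (\<epsilon> n * Suc j)) / ((1 - q n) / \<epsilon> n)"
        by (simp only: lnp_exp[OF e] lnp_exp q_power q1[symmetric])
      also have "\<dots> = (1 - q n ^ Suc j) / (real (Suc j) * (1 - q n))"
        using e by (simp del: power_Suc of_nat_Suc)
      finally show ?thesis ..
    qed
    have x0: "0 \<le> 1 - exp (- (\<epsilon> n * j))" using e by simp
    then have p: "0 < 1 + k n b * (1 - exp (- (\<epsilon> n * j)))" using kpos by (simp add: add_pos_nonneg)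
    have "1 - q n ^ (b + j) = (1 - q n ^ b) * (1 + k n b * (1 - exp (- (\<epsilon> n * j))))"
    proof -
      have "(1 - q n ^ b) * (1 + k n b * (1 - exp (- (\<epsilon> n * j))))
        = (1 - q n ^ b) + (k n b * (1 - exp (- (\<epsilon> n * b)))) * (1 - exp (- (\<epsilon> n * j)))"
        by (simp add: q_power algebra_simps)
      also have "\<dots> = 1 - q n ^ b * q n ^ j" unfolding keq by (simp add: q_power algebra_simps)
      finally show ?thesis by (simp add: power_add)
    qed
    moreover have "1 - q n ^ b \<noteq> 0" using pos[OF b] e b by (simp add: q_power)
    ultimately have 2: "(1 - q n ^ b) / (1 - q n ^ (b + j)) = 1 / exp (ln (1 + k n b * (1 - exp (- (\<epsilon> n * j)))))"
      using p by simp
    show ?thesis unfolding 1 2 by (simp add: exp_diff)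
  qed
  then show ?thesis unfolding fixed_factor_def by (simp add: exp_sum)
qed

text \<open>\<open>fixed_factor\<close> depends on \<open>b\<close> only through \<open>k n b = q n ^ b / (1 - q n ^ b)\<close>; the main term
  collects the first two orders in \<open>\<epsilon> n * j\<close>.\<close>

definition main_term :: "nat \<Rightarrow> nat \<Rightarrow> real \<Rightarrow> real" where
  "main_term n m \<kappa> = r\<^sup>2 * (1 - (m / n) ^ 3) / 3 * (1 / 24 + (\<kappa> + \<kappa>\<^sup>2) / 2)
     - r * sqrt n * (1 - (m / n)\<^sup>2) / 2 * (1 / 2 + \<kappa>)"

text \<open>All arguments are of order at most \<open>1 / sqrt n\<close>, so second-order expansions
  leave \<open>n powr (- 3 / 2)\<close> per factor. The bound \<open>k n b \<le> K\<close> excludes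
  the small \<open>b\<close> at which \<open>k n b\<close> is large.\<close>

lemma fixed_factor_term:
  assumes K: "0 \<le> K"
  shows "\<exists>C\<ge>0. \<exists>A\<ge>1. \<forall>n b j. A \<le> sqrt n \<longrightarrow> j < n \<longrightarrow> 1 \<le> b \<longrightarrow> k n b \<le> K \<longrightarrow>
    \<bar>lnp (\<epsilon> n * Suc j) - lnp (\<epsilon> n) - ln (1 + k n b * (1 - exp (- (\<epsilon> n * j))))
      - ((\<epsilon> n)\<^sup>2 * (1 / 24 + (k n b + (k n b)\<^sup>2) / 2) * (real j)\<^sup>2 - \<epsilon> n * (1 / 2 + k n b) * j)\<bar> \<le> C / (n * sqrt n)"
proof -
  obtain C0 X0 where C0: "0 < C0" "0 < X0" "\<And>x. 0 < x \<Longrightarrow> x < X0 \<Longrightarrow> \<bar>lnp x - (x\<^sup>2 / 24 - x / 2)\<bar> \<le> C0 * x ^ 3"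
    using lnp_expansion by blast
  \<comment> \<open>Two \<open>lnp\<close> errors; \<open>r\<^sup>2 / 8\<close>, made up of 1/12 for
    replacing \<open>Suc j\<close> by \<open>j\<close> in the square and 1/24 for the square of
    \<open>\<epsilon> n\<close>; \<open>r\<close> for the linear terms; and the error of
    \<open>ln_occupation_expansion\<close>.\<close>
  define C where "C = 2 * (C0 * r ^ 3) + r\<^sup>2 / 8 + r + (K + K\<^sup>2 + K ^ 3) * r ^ 3"
  define A where "A = max 1 (r / X0 + 1)"
  have C: "0 \<le> C" unfolding C_def using C0 r K by (intro add_nonneg_nonneg mult_nonneg_nonneg) auto
  show ?thesis
  proof (rule exI[of _ C], rule conjI[OF C], rule exI[of _ A], intro conjI allI impI)
    show "1 \<le> A" by (simp add: A_def)
    fix n b j :: nat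
    assume An: "A \<le> sqrt n" and j: "j < n" and b: "1 \<le> b" and kK: "k n b \<le> K"
    define R where "R = sqrt n"
    define e where "e = \<epsilon> n"
    define \<kappa> where "\<kappa> = k n b"
    have R1: "1 \<le> R" and RX: "r / X0 < R" using An by (auto simp: A_def R_def)
    have Rn: "real n = R\<^sup>2" by (simp add: R_def)
    have n: "1 \<le> n" using j by simp
    have R3: "real n * sqrt n = R ^ 3" unfolding Rn by (simp add: R_def power2_eq_square power3_eq_cube)
    have e: "0 < e" "e = r / R ^ 3" unfolding e_def using eps_pos[OF n] by (auto simp: \<epsilon>_def R3)
    have en: "e * n = r / R" unfolding e(2) Rn using R1 by (simp add: power2_eq_square power3_eq_cube)
    have R3ge: "R \<le> R ^ 3" "1 \<le> R ^ 3" using R1 power_increasing[of 1 3 R] by auto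
    have eR: "e \<le> r / R" unfolding e(2) using R3ge R1 r by (intro divide_left_mono) auto
    have rR: "r / R < X0" using RX R1 C0(2) by (simp add: field_simps)
    have bound: "x ^ 3 \<le> r ^ 3 / R ^ 3" if "0 \<le> x" "x \<le> r / R" for x
      using power_mono[OF that(2,1), of 3] by (simp add: power_divide)
    define a where "a = e * Suc j"
    have a: "0 < a" "a \<le> r / R"
    proof -
      show "0 < a" unfolding a_def using e(1) by simp
      have "a \<le> e * n" unfolding a_def using j e by (intro mult_left_mono) auto
      then show "a \<le> r / R" using en by simp
    qed
    have b1: "\<bar>lnp a - (a\<^sup>2 / 24 - a / 2)\<bar> \<le> C0 * r ^ 3 / R ^ 3"
    proof -
      have "C0 * a ^ 3 \<le> C0 * (r ^ 3 / R ^ 3)" using bound[of a] a C0 by (intro mult_left_mono) auto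
      then show ?thesis using C0(3)[OF a(1)] a rR by simp
    qed
    have b2: "\<bar>lnp e - (e\<^sup>2 / 24 - e / 2)\<bar> \<le> C0 * r ^ 3 / R ^ 3"
    proof -
      have "C0 * e ^ 3 \<le> C0 * (r ^ 3 / R ^ 3)" using bound[of e] e eR C0 by (intro mult_left_mono) auto
      then show ?thesis using C0(3)[OF e(1)] eR rR by simp
    qed
    define d where "d = e * j"
    have d: "0 \<le> d" "d \<le> r / R" 
    proof -
      show "0 \<le> d" unfolding d_def using e(1) by simp
      have "d \<le> a" unfolding d_def a_def using e(1) by (intro mult_left_mono) auto
      then show "d \<le> r / R" using a by linarith
    qed
    have kpos: "0 \<le> \<kappa>" unfolding \<kappa>_def k_def using e(1) by (simp add: e_def)
    have b3: "\<bar>ln (1 + \<kappa> * (1 - exp (- d))) - (\<kappa> * d - (\<kappa> + \<kappa>\<^sup>2) * d\<^sup>2 / 2)\<bar> \<le> (K + K\<^sup>2 + K ^ 3) * r ^ 3 / R ^ 3"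
    proof -
      have "(K + K\<^sup>2 + K ^ 3) * d ^ 3 \<le> (K + K\<^sup>2 + K ^ 3) * (r ^ 3 / R ^ 3)"
        using bound[OF d] K by (intro mult_left_mono) auto
      then show ?thesis using ln_occupation_expansion[OF kpos _ d(1), of K] kK by (simp add: \<kappa>_def)
    qed
    have e2n: "e\<^sup>2 * n \<le> r\<^sup>2 / R ^ 3"
    proof -
      have "e\<^sup>2 * n = e * (e * n)" by (simp add: power2_eq_square)
      also have "\<dots> = e * (r / R)" by (simp only: en)
      also have "\<dots> = r\<^sup>2 / R ^ 3 / R" by (simp add: e(2) power2_eq_square)
      also have "\<dots> \<le> r\<^sup>2 / R ^ 3 / 1" using R1 r by (intro divide_left_mono) auto
      finally show ?thesis by simp
    qed
    have e2: "e\<^sup>2 \<le> r\<^sup>2 / R ^ 3"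
    proof -
      have "e\<^sup>2 * 1 \<le> e\<^sup>2 * n" using n by (intro mult_left_mono) auto
      then show ?thesis using e2n by simp
    qed
    have a2: "a\<^sup>2 - d\<^sup>2 = e\<^sup>2 * (2 * real j + 1)" unfolding a_def d_def by (simp add: power2_eq_square algebra_simps)
    have a2b: "0 \<le> a\<^sup>2 - d\<^sup>2" "a\<^sup>2 - d\<^sup>2 \<le> 2 * (r\<^sup>2 / R ^ 3)"
    proof -
      show "0 \<le> a\<^sup>2 - d\<^sup>2" unfolding a2 by simp
      have "e\<^sup>2 * (2 * real j + 1) \<le> e\<^sup>2 * (2 * n)" using j by (intro mult_left_mono) auto
      then show "a\<^sup>2 - d\<^sup>2 \<le> 2 * (r\<^sup>2 / R ^ 3)" unfolding a2 using e2n by simp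
    qed
    have ad: "a - d = e" unfolding a_def d_def by (simp add: algebra_simps)
    have "\<bar>lnp a - lnp e - ln (1 + \<kappa> * (1 - exp (- d))) - ((1 / 24 + (\<kappa> + \<kappa>\<^sup>2) / 2) * d\<^sup>2 - (1 / 2 + \<kappa>) * d)\<bar>
      \<le> 2 * (C0 * r ^ 3 / R ^ 3) + r\<^sup>2 / R ^ 3 / 8 + r / R ^ 3 + (K + K\<^sup>2 + K ^ 3) * r ^ 3 / R ^ 3"
    proof -
      define Y where "Y = \<kappa> * d - (\<kappa> + \<kappa>\<^sup>2) * d\<^sup>2 / 2"
      define X where "X = ln (1 + \<kappa> * (1 - exp (- d)))"
      define c1 where "c1 = C0 * r ^ 3 / R ^ 3"
      define c2 where "c2 = r\<^sup>2 / R ^ 3"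
      define c3 where "c3 = (K + K\<^sup>2 + K ^ 3) * r ^ 3 / R ^ 3"
      have eq: "(1 / 24 + (\<kappa> + \<kappa>\<^sup>2) / 2) * d\<^sup>2 - (1 / 2 + \<kappa>) * d = d\<^sup>2 / 24 - d / 2 - Y"
        by (simp add: Y_def algebra_simps)
      have "0 \<le> e\<^sup>2" by simp
      then show ?thesis
        using b1 b2 b3 a2b ad e2 e(1) unfolding eq X_def[symmetric] Y_def[symmetric] c1_def[symmetric] c2_def[symmetric] c3_def[symmetric] e(2)[symmetric]
        by linarith
    qed
    also have "\<dots> = C / R ^ 3" unfolding C_def by (simp add: add_divide_distrib)
    also have "(1 / 24 + (\<kappa> + \<kappa>\<^sup>2) / 2) * d\<^sup>2 - (1 / 2 + \<kappa>) * d =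
      e\<^sup>2 * (1 / 24 + (\<kappa> + \<kappa>\<^sup>2) / 2) * (real j)\<^sup>2 - e * (1 / 2 + \<kappa>) * j"
      unfolding d_def by (simp add: power_mult_distrib mult_ac)
    finally show "\<bar>lnp (\<epsilon> n * Suc j) - lnp (\<epsilon> n) - ln (1 + k n b * (1 - exp (- (\<epsilon> n * j))))
      - ((\<epsilon> n)\<^sup>2 * (1 / 24 + (k n b + (k n b)\<^sup>2) / 2) * (real j)\<^sup>2 - \<epsilon> n * (1 / 2 + k n b) * j)\<bar> \<le> C / (n * sqrt n)"
      unfolding R3 a_def d_def e_def \<kappa>_def .
  qed
qed

text \<open>Closed power sums replace the sum over \<open>j\<close>. Their lower-order terms are
  smaller by a factor \<open>n\<close>; next to main parts of order \<open>sqrt n\<close> and 1 this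
  leaves at most the order \<open>1 / sqrt n\<close>.\<close>

lemma fixed_factor_main_term:
  assumes K: "0 \<le> K"
  shows "\<exists>C\<ge>0. \<exists>A\<ge>1. \<forall>n m b. A \<le> sqrt n \<longrightarrow> m \<le> n \<longrightarrow> 1 \<le> b \<longrightarrow> k n b \<le> K \<longrightarrow>
    \<bar>ln (fixed_factor n m (q n) b) - main_term n m (k n b)\<bar> \<le> C / sqrt n"
proof -
  obtain C0 A where C00: "0 \<le> C0" and A: "1 \<le> A" and C0: "\<And>n b j. A \<le> sqrt (real n) \<Longrightarrow> j < n \<Longrightarrow> 1 \<le> b \<Longrightarrow> k n b \<le> K \<Longrightarrow>
    \<bar>lnp (\<epsilon> n * Suc j) - lnp (\<epsilon> n) - ln (1 + k n b * (1 - exp (- (\<epsilon> n * j))))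
      - ((\<epsilon> n)\<^sup>2 * (1 / 24 + (k n b + (k n b)\<^sup>2) / 2) * (real j)\<^sup>2 - \<epsilon> n * (1 / 2 + k n b) * j)\<bar> \<le> C0 / (n * sqrt n)"
    using fixed_factor_term[OF K] by metis
  define P where "P = 1 / 24 + (K + K\<^sup>2) / 2"
  define Q where "Q = 1 / 2 + K"
  define C where "C = C0 + P * r\<^sup>2 + Q * r"
  have PQ: "0 \<le> P" "0 \<le> Q" using K by (auto simp: P_def Q_def)
  have C: "0 \<le> C" unfolding C_def using C00 PQ r by simp
  show ?thesis
  proof (rule exI[of _ C], rule conjI[OF C], rule exI[of _ A], intro conjI allI impI A)
    fix n m b :: nat
    assume An: "A \<le> sqrt n" and m: "m \<le> n" and b: "1 \<le> b" and kK: "k n b \<le> K"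
    define R where "R = sqrt n"
    define e where "e = \<epsilon> n"
    define \<kappa> where "\<kappa> = k n b"
    have R1: "1 \<le> R" using An A unfolding R_def by linarith
    have Rn: "real n = R\<^sup>2" by (simp add: R_def)
    have n: "1 \<le> n" using R1 unfolding R_def by (cases n) auto
    have R3: "real n * sqrt n = R ^ 3" unfolding Rn by (simp add: R_def power2_eq_square power3_eq_cube)
    have e: "0 < e" "e = r / R ^ 3" unfolding e_def using eps_pos[OF n] by (auto simp: \<epsilon>_def R3)
    have kpos: "0 \<le> \<kappa>" unfolding \<kappa>_def k_def using e(1) by (simp add: e_def)
    have kK': "\<kappa> \<le> K" using kK by (simp add: \<kappa>_def)
    define T where "T j = lnp (e * Suc j) - lnp e - ln (1 + \<kappa> * (1 - exp (- (e * j))))" for j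
    define p where "p = 1 / 24 + (\<kappa> + \<kappa>\<^sup>2) / 2"
    define p' where "p' = 1 / 2 + \<kappa>"
    have pP: "0 \<le> p" "p \<le> P" "0 \<le> p'" "p' \<le> Q"
    proof -
      have "\<kappa>\<^sup>2 \<le> K\<^sup>2" using kpos kK' by (intro power_mono)
      then show "p \<le> P" "p' \<le> Q" using kK' by (auto simp: p_def P_def p'_def Q_def)
    qed (use kpos in \<open>auto simp: p_def p'_def\<close>)
    have ln: "ln (fixed_factor n m (q n) b) = (\<Sum>j=m..<n. T j)"
      unfolding fixed_factor_eq_exp[OF n b] T_def e_def \<kappa>_def by simp
    have Tj: "\<bar>T j - (e\<^sup>2 * p * (real j)\<^sup>2 - e * p' * j)\<bar> \<le> C0 / R ^ 3" if "j < n" for j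
      using C0[OF An that b kK] unfolding T_def e_def \<kappa>_def p_def p'_def R3 .
    have "\<bar>(\<Sum>j=m..<n. T j) - (\<Sum>j=m..<n. e\<^sup>2 * p * (real j)\<^sup>2 - e * p' * j)\<bar> \<le> (\<Sum>j=m..<n. C0 / R ^ 3)"
      unfolding sum_subtractf[symmetric] using Tj by (intro order.trans[OF sum_abs] sum_mono) auto
    also have "\<dots> = (n - m) * (C0 / R ^ 3)" by simp
    also have "\<dots> \<le> n * (C0 / R ^ 3)" using C00 R1 by (intro mult_right_mono) auto
    also have "\<dots> = C0 / R" unfolding Rn using R1 by (simp add: power2_eq_square power3_eq_cube)
    finally have b1: "\<bar>(\<Sum>j=m..<n. T j) - (\<Sum>j=m..<n. e\<^sup>2 * p * (real j)\<^sup>2 - e * p' * j)\<bar> \<le> C0 / R" .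
    define S1 where "S1 = (\<Sum>j=m..<n. real j)"
    define S2 where "S2 = (\<Sum>j=m..<n. (real j)\<^sup>2)"
    have sums: "(\<Sum>j=m..<n. e\<^sup>2 * p * (real j)\<^sup>2 - e * p' * j) = p * (e\<^sup>2 * S2) - p' * (e * S1)"
      unfolding S1_def S2_def sum_subtractf sum_distrib_left[symmetric] by (simp only: mult_ac)
    have b2: "\<bar>e * S1 - r * R * (1 - (m / n)\<^sup>2) / 2\<bar> \<le> r / R"
    proof -
      have eq0: "r * R * (1 - (m / n)\<^sup>2) / 2 = e * ((real n)\<^sup>2 - (real m)\<^sup>2) / 2"
      proof -
        have "e * (real n)\<^sup>2 = r * R" unfolding e(2) Rn using R1 by (simp add: power2_eq_square power3_eq_cube)
        moreover have "(real n)\<^sup>2 - (real m)\<^sup>2 = (real n)\<^sup>2 * (1 - (m / n)\<^sup>2)"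
          using n by (simp add: power_divide right_diff_distrib)
        ultimately show ?thesis by (simp add: mult.assoc[symmetric])
      qed
      have "e * S1 - r * R * (1 - (m / n)\<^sup>2) / 2 = - (e * (real n - real m) / 2)"
        unfolding S1_def sum_interval_id[OF m] eq0 by (simp add: field_simps)
      moreover have "0 \<le> e * (real n - real m)" using e(1) m by simp
      moreover have "e * (real n - real m) \<le> e * real n" using e(1) by (intro mult_left_mono) auto
      moreover have "e * real n = r / R" unfolding e(2) Rn using R1 by (simp add: power2_eq_square power3_eq_cube)
      ultimately show ?thesis by linarith
    qed
    have b3: "\<bar>e\<^sup>2 * S2 - r\<^sup>2 * (1 - (m / n) ^ 3) / 3\<bar> \<le> r\<^sup>2 / R"
    proof -
      have eq0: "r\<^sup>2 * (1 - (m / n) ^ 3) / 3 = e\<^sup>2 * (real n ^ 3 - real m ^ 3) / 3"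
      proof -
        have "e\<^sup>2 * real n ^ 3 = r\<^sup>2" unfolding e(2) Rn using R1
          by (simp add: power_divide power_mult[symmetric])
        moreover have "real n ^ 3 - real m ^ 3 = real n ^ 3 * (1 - (m / n) ^ 3)"
          using n by (simp add: power_divide right_diff_distrib)
        ultimately show ?thesis by (simp add: mult.assoc[symmetric])
      qed
      have eq: "e\<^sup>2 * S2 - r\<^sup>2 * (1 - (m / n) ^ 3) / 3 = e\<^sup>2 * (((real n - real m) - 3 * ((real n)\<^sup>2 - (real m)\<^sup>2)) / 6)"
        unfolding S2_def sum_interval_square[OF m] eq0 by (simp add: field_simps)
      have "\<bar>((real n - real m) - 3 * ((real n)\<^sup>2 - (real m)\<^sup>2)) / 6\<bar> \<le> (real n)\<^sup>2"
      proof -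
        have "\<bar>((x - y) - 3 * (x\<^sup>2 - y\<^sup>2)) / 6\<bar> \<le> x\<^sup>2" if "1 \<le> x" "0 \<le> y" "y \<le> x" for x y :: real
        proof -
          have "x * 1 \<le> x * x" using that by (intro mult_left_mono) auto
          then have "x \<le> x\<^sup>2" by (simp add: power2_eq_square)
          moreover have "y\<^sup>2 \<le> x\<^sup>2" "0 \<le> y\<^sup>2" using that by (auto intro: power_mono)
          moreover have "\<bar>((x - y) - 3 * (X - Y)) / 6\<bar> \<le> X"
            if "x \<le> X" "Y \<le> X" "0 \<le> Y" "0 \<le> y" "y \<le> x" for X Y using that by argo
          ultimately show ?thesis using that by blast
        qed
        then show ?thesis using n m by simp
      qed
      then have "\<bar>e\<^sup>2 * S2 - r\<^sup>2 * (1 - (m / n) ^ 3) / 3\<bar> \<le> e\<^sup>2 * (real n)\<^sup>2"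
        unfolding eq abs_mult by (intro mult_mono) auto
      also have "\<dots> = (r / R)\<^sup>2" unfolding e(2) Rn using R1 by (simp add: power2_eq_square power3_eq_cube)
      also have "\<dots> = r\<^sup>2 / R / R" by (simp add: power2_eq_square)
      also have "\<dots> \<le> r\<^sup>2 / R / 1" using R1 by (intro divide_left_mono) auto
      finally show ?thesis by simp
    qed
    have c2: "\<bar>p' * (e * S1) - p' * (r * R * (1 - (m / n)\<^sup>2) / 2)\<bar> \<le> Q * (r / R)"
      unfolding right_diff_distrib[symmetric] abs_mult using b2 pP PQ by (intro mult_mono) auto
    have c3: "\<bar>p * (e\<^sup>2 * S2) - p * (r\<^sup>2 * (1 - (m / n) ^ 3) / 3)\<bar> \<le> P * (r\<^sup>2 / R)"
      unfolding right_diff_distrib[symmetric] abs_mult using b3 pP PQ by (intro mult_mono) auto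
    have "main_term n m \<kappa> = p * (r\<^sup>2 * (1 - (m / n) ^ 3) / 3) - p' * (r * R * (1 - (m / n)\<^sup>2) / 2)"
      unfolding main_term_def p_def p'_def R_def by (simp only: mult_ac)
    moreover have "C / R = C0 / R + P * (r\<^sup>2 / R) + Q * (r / R)" by (simp add: C_def add_divide_distrib)
    ultimately have "\<bar>(\<Sum>j=m..<n. T j) - main_term n m \<kappa>\<bar> \<le> C / R"
      using b1 c2 c3 unfolding sums by linarith
    then show "\<bar>ln (fixed_factor n m (q n) b) - main_term n m (k n b)\<bar> \<le> C / sqrt n"
      unfolding ln R_def \<kappa>_def .
  qed
qed

end

section \<open>Affine approximation of the correction factor\<close>

context tilted
begin

text \<open>Obtained by expanding \<open>main_term\<close> at the centre, where \<open>k n b\<close>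
  equals \<open>s / r\<close>: the term of order \<open>sqrt n\<close> is
  \<open>- shift n m\<close>, its first-order variation gives \<open>slope n m\<close>, and the
  bounded term gives \<open>const n m\<close>. As \<open>shift n m\<close> is also what the centring
  of W contributes to the exponent, the diverging terms cancel.\<close>

definition shift :: "nat \<Rightarrow> nat \<Rightarrow> real" where
  "shift n m = (1 - (m / n)\<^sup>2) * (s / 2 + r / 4) * sqrt n"

definition slope :: "nat \<Rightarrow> nat \<Rightarrow> real" where
  "slope n m = (1 - (m / n)\<^sup>2) / 2 * (s * (s + r))"

definition const :: "nat \<Rightarrow> nat \<Rightarrow> real" where
  "const n m = (1 - (m / n) ^ 3) * (r\<^sup>2 / 72 + s * (s + r) / 6)"

text \<open>The cutoff lies to the left of the centre, by \<open>\<delta> \<le> 1 / (s + r)\<close>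
  and \<open>ln x \<le> x - 1\<close> at \<open>x = s / (s + r)\<close>. Hence it can serve as left
  end point of the Taylor estimate, and \<open>Z\<close> is not positive below it.\<close>

lemma delta_le_y0: "r * \<delta> \<le> y0"
proof -
  have "1 \<le> exp (2::real)" by simp
  then have "1 * (s + r) \<le> exp 2 * (s + r)" using s r by (intro mult_right_mono) auto
  then have "s + r \<le> exp 2 * (s + r)" by simp
  moreover have "0 < exp 2 * (s + r)" using s r by (intro mult_pos_pos) auto
  moreover have "s + r \<le> s + 2 * x" if "s + r \<le> x" "0 < x" for x using that s by simp
  ultimately have "s + r \<le> s + 2 * (exp 2 * (s + r))" by blast
  then have "s + r \<le> s + 2 * exp 2 * (s + r)" by (simp only: mult.assoc)
  then have "\<delta> \<le> 1 / (s + r)" unfolding \<delta>_def using s r by (intro divide_left_mono mult_pos_pos) auto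
  then have "r * \<delta> \<le> r / (s + r)" using r mult_left_mono[of \<delta> "1 / (s + r)" r] by simp
  also have "r / (s + r) = 1 - s / (s + r)" using s r by (simp add: field_simps)
  also have "\<dots> \<le> - ln (s / (s + r))"
    using ln_le_minus_one[of "s / (s + r)"] s r by simp
  also have "\<dots> = y0"
  proof -
    have "1 + r / s = (s + r) / s" using s by (simp add: field_simps)
    then show ?thesis unfolding y0_def using s r by (simp add: ln_div)
  qed
  finally show ?thesis .
qed

lemma ratio_bounds:
  assumes "m \<le> n"
  shows "0 \<le> 1 - (real m / n) ^ i" "1 - (real m / n) ^ i \<le> 1"
proof -
  have "0 \<le> real m / n" "real m / n \<le> 1" using assms by (auto simp: divide_le_eq_1)
  then show "0 \<le> 1 - (real m / n) ^ i" "1 - (real m / n) ^ i \<le> 1" by (auto simp: power_le_one)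
qed

text \<open>Convexity of \<open>\<lambda>y. 1 / (exp y - 1)\<close> gives the one-sided bound, which is uniform in \<open>b\<close> and so
  dominates the sum far away from its centre.\<close>

lemma fixed_factor_asymp:
  "\<exists>C\<ge>0. \<exists>A\<ge>1. \<forall>n m b. A \<le> sqrt n \<longrightarrow> m \<le> n \<longrightarrow> \<delta> * n * sqrt n \<le> real b \<longrightarrow>
    \<bar>ln (fixed_factor n m (q n) b) + shift n m - (slope n m * Z n b + const n m)\<bar> \<le> C * (1 + (Z n b)\<^sup>2) / sqrt n \<and>
    ln (fixed_factor n m (q n) b) + shift n m \<le> slope n m * Z n b + C"
proof -
  \<comment> \<open>The bound for \<open>k n b\<close> beyond the cutoff, where
    \<open>\<epsilon> n * b \<ge> r * \<delta>\<close>.\<close>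
  define K where "K = 1 / (exp (r * \<delta>) - 1)"
  have rd: "0 < r * \<delta>" using r delta_pos by simp
  have K: "0 \<le> K" unfolding K_def using rd by simp
  obtain C1 A where C10: "0 \<le> C1" and A: "1 \<le> A" and C1: "\<And>n m b. A \<le> sqrt (real n) \<Longrightarrow> m \<le> n \<Longrightarrow> 1 \<le> b \<Longrightarrow> k n b \<le> K \<Longrightarrow>
    \<bar>ln (fixed_factor n m (q n) b) - main_term n m (k n b)\<bar> \<le> C1 / sqrt n"
    using fixed_factor_main_term[OF K] by metis
  define k0 where "k0 = s / r"
  define K2 where "K2 = K * (1 + K) * (1 + 2 * K)"
  define B1 where "B1 = k0 * (1 + k0) * r"
  define B2 where "B2 = K2 * r\<^sup>2"
  define C where "C = C1 + r\<^sup>2 / 6 * ((1 + 2 * K) * (B1 + B2)) + K2 * r ^ 3 / 2 + r\<^sup>2 / 6 * (K + K\<^sup>2) + r\<^sup>2 / 72 + s * (s + r) / 6"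
  have k0: "0 \<le> k0" unfolding k0_def using s r by simp
  have K2: "0 \<le> K2" unfolding K2_def using K by simp
  have B: "0 \<le> B1" "0 \<le> B2" unfolding B1_def B2_def using k0 K2 r by auto
  have C: "C1 \<le> C" "C1 + r\<^sup>2 / 6 * ((1 + 2 * K) * (B1 + B2)) + K2 * r ^ 3 / 2 \<le> C"
     "C1 + r\<^sup>2 / 6 * (K + K\<^sup>2) + r\<^sup>2 / 72 + s * (s + r) / 6 \<le> C"
  proof -
    have "0 \<le> r\<^sup>2 / 6 * ((1 + 2 * K) * (B1 + B2))" "0 \<le> K2 * r ^ 3 / 2" "0 \<le> r\<^sup>2 / 6 * (K + K\<^sup>2)" "0 \<le> r\<^sup>2 / 72" "0 \<le> s * (s + r) / 6"
      using K B K2 s r by auto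
    then show "C1 \<le> C" "C1 + r\<^sup>2 / 6 * ((1 + 2 * K) * (B1 + B2)) + K2 * r ^ 3 / 2 \<le> C"
     "C1 + r\<^sup>2 / 6 * (K + K\<^sup>2) + r\<^sup>2 / 72 + s * (s + r) / 6 \<le> C" unfolding C_def by linarith+
  qed
  have C0: "0 \<le> C" using C C10 by linarith
  show ?thesis
  proof (rule exI[of _ C], rule conjI[OF C0], rule exI[of _ A], rule conjI[OF A], intro allI impI)
    fix n m b :: nat
    assume An: "A \<le> sqrt n" and m: "m \<le> n" and b: "\<delta> * n * sqrt n \<le> real b"
    define R where "R = sqrt n"
    have R1: "1 \<le> R" using An A unfolding R_def by linarith
    have Rn: "real n = R\<^sup>2" by (simp add: R_def)
    have n: "1 \<le> n" using R1 unfolding R_def by (cases n) auto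
    have "0 < \<delta> * n * sqrt n" using delta_pos n by simp
    then have b1: "1 \<le> b" using b by (cases b) auto
    define y where "y = \<epsilon> n * b"
    have y1: "r * \<delta> \<le> y"
    proof -
      have "\<epsilon> n * (\<delta> * n * sqrt n) \<le> y" unfolding y_def using b eps_pos[OF n] by (intro mult_left_mono) auto
      moreover have "\<epsilon> n * (\<delta> * n * sqrt n) = r * \<delta>" unfolding \<epsilon>_def using n by simp
      ultimately show ?thesis by simp
    qed
    define \<kappa> where "\<kappa> = k n b"
    define z where "z = Z n b"
    have kappa: "\<kappa> = 1 / (exp y - 1)" unfolding \<kappa>_def k_def y_def ..
    have kpos: "0 \<le> \<kappa>" unfolding kappa using y1 rd by simp
    have kK: "\<kappa> \<le> K" unfolding kappa K_def using y1 rd by (intro divide_left_mono mult_pos_pos) auto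
    have y0: "0 < y0" using delta_le_y0 rd by linarith
    have k0eq: "1 / (exp y0 - 1) = k0"
    proof -
      have "0 < 1 + r / s" using s r by (simp add: add_pos_pos)
      then show ?thesis unfolding y0_def k0_def by simp
    qed
    have k0K: "k0 \<le> K" unfolding k0eq[symmetric] K_def using delta_le_y0 rd
      by (intro divide_left_mono mult_pos_pos) auto
    \<comment> \<open>The Taylor remainder of \<open>\<kappa>\<close>, nonnegative by convexity and
      of order \<open>z\<^sup>2 / n\<close>.\<close>
    define \<rho> where "\<rho> = \<kappa> - (k0 - k0 * (1 + k0) * (y - y0))"
    have rho: "0 \<le> \<rho>" "\<rho> \<le> K2 * (y - y0)\<^sup>2"
      using occupation_taylor[OF y0 rd delta_le_y0 y1 K_def] unfolding k0eq kappa[symmetric] \<rho>_def K2_def by auto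
    have D: "y - y0 = r * z / R"
      unfolding y_def z_def Z_def \<epsilon>_def R_def using n r by (simp add: field_simps)
    have D2: "(y - y0)\<^sup>2 = r\<^sup>2 * z\<^sup>2 / R / R" unfolding D by (simp add: power2_eq_square)
    have keq: "\<kappa> = k0 - B1 * z / R + \<rho>" unfolding \<rho>_def D B1_def by simp
    have rhoz: "\<rho> \<le> B2 * z\<^sup>2 / R / R" using rho(2) unfolding D2 B2_def by (simp add: mult.assoc)
    have rhoz': "\<rho> \<le> B2 * z\<^sup>2 / R"
    proof -
      have "B2 * z\<^sup>2 / R / R \<le> B2 * z\<^sup>2 / R / 1" using R1 B by (intro divide_left_mono) auto
      then show ?thesis using rhoz by simp
    qed
    define a2 where "a2 = 1 - (real m / n)\<^sup>2"
    define a3 where "a3 = 1 - (real m / n) ^ 3"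
    have a23: "0 \<le> a2" "a2 \<le> 1" "0 \<le> a3" "a3 \<le> 1" unfolding a2_def a3_def using ratio_bounds[OF m] by auto
    have rk0: "r * k0 = s" and rB1: "r * B1 = s * (s + r)" and rk02: "r\<^sup>2 * (k0 + k0\<^sup>2) = s * (s + r)"
      unfolding B1_def k0_def using r by (simp_all add: field_simps power2_eq_square)
    define M where "M = main_term n m \<kappa>"
    \<comment> \<open>The terms of order \<open>R\<close> cancel. What remains is the variation of
      the bounded part, and the remainder \<open>\<rho>\<close> amplified by \<open>R\<close> and
      carrying a minus sign.\<close>
    have ident: "M + shift n m - (slope n m * z + const n m)
       = r\<^sup>2 * a3 / 6 * ((\<kappa> + \<kappa>\<^sup>2) - (k0 + k0\<^sup>2)) - a2 / 2 * (r * R * \<rho>)"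
    proof -
      have 1: "M = a3 * (r\<^sup>2 / 72) + a3 / 6 * (r\<^sup>2 * (\<kappa> + \<kappa>\<^sup>2)) - a2 * (r * R / 4) - a2 / 2 * (r * R * \<kappa>)"
        unfolding M_def main_term_def a2_def[symmetric] a3_def[symmetric] R_def[symmetric] by (simp add: field_simps)
      have 2: "r * R * \<kappa> = s * R - s * (s + r) * z + r * R * \<rho>"
      proof -
        have "r * R * \<kappa> = (r * k0) * R - (r * B1) * (z / R * R) + r * R * \<rho>"
          unfolding keq by (simp add: algebra_simps)
        also have "z / R * R = z" using R1 by simp
        finally show ?thesis unfolding rk0 rB1 .
      qed
      have 3: "shift n m = a2 * (s / 2 + r / 4) * R" "slope n m = a2 / 2 * (s * (s + r))" "const n m = a3 * (r\<^sup>2 / 72 + s * (s + r) / 6)"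
        unfolding shift_def slope_def const_def a2_def a3_def R_def by simp_all
      have 4: "r\<^sup>2 * a3 / 6 * ((\<kappa> + \<kappa>\<^sup>2) - (k0 + k0\<^sup>2)) = a3 / 6 * (r\<^sup>2 * (\<kappa> + \<kappa>\<^sup>2)) - a3 / 6 * (s * (s + r))"
        unfolding rk02[symmetric] by (simp add: field_simps)
      show ?thesis unfolding 1 2 3 4 by (simp add: algebra_simps)
    qed
    have lnM: "\<bar>ln (fixed_factor n m (q n) b) - M\<bar> \<le> C1 / R"
      unfolding M_def \<kappa>_def R_def using C1[OF An m b1] kK by (simp add: \<kappa>_def)
    have z1: "\<bar>z\<bar> \<le> 1 + z\<^sup>2" "z\<^sup>2 \<le> 1 + z\<^sup>2"
    proof -
      have "0 \<le> (\<bar>z\<bar> - 1)\<^sup>2" by simp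
      then show "\<bar>z\<bar> \<le> 1 + z\<^sup>2" by (simp add: power2_eq_square algebra_simps)
    qed simp
    have kdiff: "\<bar>\<kappa> - k0\<bar> \<le> (B1 + B2) * (1 + z\<^sup>2) / R"
    proof -
      have "\<bar>\<kappa> - k0\<bar> \<le> \<bar>B1 * z / R\<bar> + \<rho>" unfolding keq using rho(1) by linarith
      also have "\<dots> \<le> B1 * (1 + z\<^sup>2) / R + B2 * (1 + z\<^sup>2) / R"
      proof (rule add_mono)
        have "\<bar>B1 * z / R\<bar> = B1 * \<bar>z\<bar> / R" using B R1 by (simp add: abs_mult abs_divide)
        also have "\<dots> \<le> B1 * (1 + z\<^sup>2) / R" using B R1 z1 by (intro divide_right_mono mult_left_mono) auto
        finally show "\<bar>B1 * z / R\<bar> \<le> B1 * (1 + z\<^sup>2) / R" .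
        have "B2 * z\<^sup>2 / R \<le> B2 * (1 + z\<^sup>2) / R" using B R1 z1 by (intro divide_right_mono mult_left_mono) auto
        then show "\<rho> \<le> B2 * (1 + z\<^sup>2) / R" using rhoz' by simp
      qed
      finally show ?thesis by (simp add: distrib_right add_divide_distrib)
    qed
    have t1: "\<bar>r\<^sup>2 * a3 / 6 * ((\<kappa> + \<kappa>\<^sup>2) - (k0 + k0\<^sup>2))\<bar> \<le> r\<^sup>2 / 6 * ((1 + 2 * K) * ((B1 + B2) * (1 + z\<^sup>2) / R))"
    proof -
      have "\<bar>(\<kappa> + \<kappa>\<^sup>2) - (k0 + k0\<^sup>2)\<bar> = (1 + \<kappa> + k0) * \<bar>\<kappa> - k0\<bar>"
      proof -
        have "(\<kappa> + \<kappa>\<^sup>2) - (k0 + k0\<^sup>2) = (1 + \<kappa> + k0) * (\<kappa> - k0)" by (simp add: power2_eq_square algebra_simps)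
        moreover have "\<bar>1 + \<kappa> + k0\<bar> = 1 + \<kappa> + k0" using kpos k0 by simp
        ultimately show ?thesis by (simp only: abs_mult)
      qed
      also have "\<dots> \<le> (1 + 2 * K) * ((B1 + B2) * (1 + z\<^sup>2) / R)"
        by (rule mult_mono[OF _ kdiff]) (use kK k0K K in auto)
      finally have x: "\<bar>(\<kappa> + \<kappa>\<^sup>2) - (k0 + k0\<^sup>2)\<bar> \<le> (1 + 2 * K) * ((B1 + B2) * (1 + z\<^sup>2) / R)" .
      have "\<bar>r\<^sup>2 * a3 / 6\<bar> \<le> r\<^sup>2 / 6"
      proof -
        have "r\<^sup>2 * a3 \<le> r\<^sup>2" using a23 by (intro mult_left_le) auto
        moreover have "0 \<le> r\<^sup>2 * a3" using a23 by simp
        ultimately show ?thesis by simp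
      qed
      from mult_mono[OF this x] show ?thesis unfolding abs_mult[of "r\<^sup>2 * a3 / 6"] by simp
    qed
    have t2: "0 \<le> a2 / 2 * (r * R * \<rho>)" "a2 / 2 * (r * R * \<rho>) \<le> K2 * r ^ 3 / 2 * ((1 + z\<^sup>2) / R)"
    proof -
      have x: "0 \<le> r * R * \<rho>" using r R1 rho by simp
      then show "0 \<le> a2 / 2 * (r * R * \<rho>)" using a23 by simp
      have "r * R * \<rho> \<le> r * R * (B2 * (1 + z\<^sup>2) / R / R)"
      proof -
        have "B2 * z\<^sup>2 / R / R \<le> B2 * (1 + z\<^sup>2) / R / R" using B R1 z1 by (intro divide_right_mono mult_left_mono) auto
        then show ?thesis using rhoz r R1 by (intro mult_left_mono) auto
      qed
      also have "\<dots> = K2 * r ^ 3 * ((1 + z\<^sup>2) / R)"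
        unfolding B2_def using R1 by (simp add: power2_eq_square power3_eq_cube)
      finally have "r * R * \<rho> \<le> K2 * r ^ 3 * ((1 + z\<^sup>2) / R)" .
      moreover have "a2 / 2 * (r * R * \<rho>) \<le> 1 / 2 * (r * R * \<rho>)" using a23 x by (intro mult_right_mono) auto
      ultimately show "a2 / 2 * (r * R * \<rho>) \<le> K2 * r ^ 3 / 2 * ((1 + z\<^sup>2) / R)" by simp
    qed
    let ?F = "ln (fixed_factor n m (q n) b)"
    have "\<bar>?F + shift n m - (slope n m * z + const n m)\<bar> \<le> C * (1 + z\<^sup>2) / R"
    proof -
      have "C1 / R \<le> C1 * ((1 + z\<^sup>2) / R)"
      proof -
        have "1 / R \<le> (1 + z\<^sup>2) / R" using R1 by (intro divide_right_mono) auto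
        then show ?thesis using C10 mult_left_mono[of "1 / R" "(1 + z\<^sup>2) / R" C1] by simp
      qed
      then have "\<bar>?F + shift n m - (slope n m * z + const n m)\<bar> \<le>
        C1 * ((1 + z\<^sup>2) / R) + r\<^sup>2 / 6 * ((1 + 2 * K) * ((B1 + B2) * (1 + z\<^sup>2) / R)) + K2 * r ^ 3 / 2 * ((1 + z\<^sup>2) / R)"
        using lnM ident t1 t2 by linarith
      also have "\<dots> = (C1 + r\<^sup>2 / 6 * ((1 + 2 * K) * (B1 + B2)) + K2 * r ^ 3 / 2) * ((1 + z\<^sup>2) / R)"
        proof -
        have "C1 * W + r\<^sup>2 / 6 * ((1 + 2 * K) * ((B1 + B2) * W)) + K2 * r ^ 3 / 2 * W
          = (C1 + r\<^sup>2 / 6 * ((1 + 2 * K) * (B1 + B2)) + K2 * r ^ 3 / 2) * W" for W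
          by (simp add: field_simps)
        from this[of "(1 + z\<^sup>2) / R"] show ?thesis by simp
      qed
      also have "\<dots> \<le> C * ((1 + z\<^sup>2) / R)" using C(2) R1 by (intro mult_right_mono) auto
      finally show ?thesis by simp
    qed
    \<comment> \<open>The term with \<open>\<rho>\<close> is dropped because of its sign; everything
      else besides \<open>slope n m * z\<close> is bounded independently of
      \<open>z\<close>.\<close>
    moreover have "?F + shift n m \<le> slope n m * z + C"
    proof -
      have "r\<^sup>2 * a3 / 6 * ((\<kappa> + \<kappa>\<^sup>2) - (k0 + k0\<^sup>2)) \<le> r\<^sup>2 / 6 * (K + K\<^sup>2)"
      proof -
        have "\<kappa>\<^sup>2 \<le> K\<^sup>2" using kpos kK by (intro power_mono)
        then have x: "(\<kappa> + \<kappa>\<^sup>2) - (k0 + k0\<^sup>2) \<le> K + K\<^sup>2" using k0 kK by (smt (verit) zero_le_power2)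
        have "r\<^sup>2 * a3 / 6 * ((\<kappa> + \<kappa>\<^sup>2) - (k0 + k0\<^sup>2)) \<le> r\<^sup>2 * a3 / 6 * (K + K\<^sup>2)"
          using x a23 by (intro mult_left_mono) auto
        also have "\<dots> \<le> r\<^sup>2 / 6 * (K + K\<^sup>2)"
          using a23 K by (intro mult_right_mono) (auto intro: mult_left_le)
        finally show ?thesis .
      qed
      moreover have "const n m \<le> r\<^sup>2 / 72 + s * (s + r) / 6"
        unfolding const_def a3_def[symmetric] using a23 s r by (intro mult_left_le_one_le) auto
      moreover have "C1 / R \<le> C1" using C10 R1 by (simp add: divide_le_eq mult_le_cancel_left1)
      ultimately show ?thesis using lnM ident t2(1) C(3) by linarith
    qed
    ultimately show "\<bar>ln (fixed_factor n m (q n) b) + shift n m - (slope n m * Z n b + const n m)\<bar> \<le> C * (1 + (Z n b)\<^sup>2) / sqrt n \<and>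
      ln (fixed_factor n m (q n) b) + shift n m \<le> slope n m * Z n b + C"
      unfolding z_def R_def by simp
  qed
qed

end

section \<open>Convergence of the moment generating function\<close>

context tilted
begin

lemma slope_bounds:
  assumes "m \<le> n"
  shows "0 \<le> slope n m" "slope n m \<le> s * (s + r) / 2"
proof -
  have "0 \<le> s * (s + r)" using s r by simp
  then show "0 \<le> slope n m" unfolding slope_def using ratio_bounds[OF assms, of 2] by simp
  have "(1 - (real m / n)\<^sup>2) / 2 * (s * (s + r)) \<le> 1 / 2 * (s * (s + r))"
    using ratio_bounds[OF assms, of 2] \<open>0 \<le> s * (s + r)\<close> by (intro mult_right_mono) auto
  then show "slope n m \<le> s * (s + r) / 2" unfolding slope_def by simp
qed

lemma const_bounds:
  assumes "m \<le> n"
  shows "const n m \<le> r\<^sup>2 / 72 + s * (s + r) / 6"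
  unfolding const_def using ratio_bounds[OF assms, of 3] s r by (intro mult_left_le_one_le) auto

lemma shift_bounds:
  assumes "m \<le> n"
  shows "shift n m \<le> (s / 2 + r / 4) * sqrt n"
proof -
  have "0 \<le> (s / 2 + r / 4) * sqrt n" using s r by simp
  then show ?thesis unfolding shift_def mult.assoc
    using ratio_bounds[OF assms, of 2] by (intro mult_left_le_one_le) auto
qed

text \<open>Lets a quadratic error be summed by the moment generating function at two neighbouring
  parameters, without separate moment estimates.\<close>

lemma one_plus_square_le: "1 + z\<^sup>2 \<le> 2 * (exp z + exp (- z))" for z :: real
proof -
  have "1 + \<bar>z\<bar> + \<bar>z\<bar>\<^sup>2 / 2 \<le> exp \<bar>z\<bar>" by (rule exp_lower_Taylor_quadratic) simp
  moreover have "exp \<bar>z\<bar> \<le> exp z + exp (- z)" by (cases "0 \<le> z") auto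
  ultimately show ?thesis by simp
qed

context
  fixes n m :: nat and \<sigma> :: "nat \<Rightarrow> nat"
  assumes \<sigma>: "\<sigma> permutes {1..n}" and m: "m = card {u \<in> {1..n}. \<sigma> u = u}" and n: "1 \<le> n"
begin

text \<open>The summand of the class, normalised like \<open>w n a\<close>, with which it coincides
  when \<open>\<sigma>\<close> is the identity.\<close>

definition v :: "nat \<Rightarrow> real" where
  "v a = (\<Prod>i\<le>n. 1 - t n * q n ^ i) * t n ^ a * (vgf {1..n} \<sigma> (q n) (Suc a) / fact n)"

lemma fixed_points_le: "m \<le> n"
  using card_fixed_le[OF \<sigma> _ _ m, of "q n"] q_bounds[OF n] by simp

lemma v_nonneg: "0 \<le> v a"
  unfolding v_def using norm_const_pos[OF n] t_bounds[OF n] q_bounds[OF n] vgf_nonneg[of "q n"]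
  by (intro mult_nonneg_nonneg divide_nonneg_nonneg) auto

text \<open>The quantity \<open>x\<close> bounds \<open>n / P\<close> beyond the cutoff:
  \<open>P\<close> is at least \<open>(1 - exp (- (r * \<delta>))) / \<epsilon> n\<close>, and
  \<open>n * \<epsilon> n = r / sqrt n\<close>.\<close>

lemma v_bounds:
  assumes a: "a0 n \<le> a"
  defines "x \<equiv> r / (1 - exp (- (r * \<delta>))) / sqrt n"
  shows "v a \<le> w n a * fixed_factor n m (q n) (Suc a) * exp (x\<^sup>2)"
    and "w n a * fixed_factor n m (q n) (Suc a) * (1 - x - x\<^sup>2) \<le> v a"
proof -
  define F where "F = fixed_factor n m (q n) (Suc a)"
  define P where "P = (\<Sum>y<Suc a. q n ^ y)"
  have q: "0 < q n" "q n < 1" using q_bounds[OF n] by auto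
  have D: "0 \<le> (\<Prod>i\<le>n. 1 - t n * q n ^ i) * t n ^ a" using norm_const_pos[OF n] t_bounds[OF n] by simp
  have w: "0 \<le> w n a * F" unfolding F_def using w_nonneg[OF n] fixed_factor_pos[OF q, of "Suc a" n m] by simp
  have e: "0 < \<epsilon> n" using eps_pos[OF n] .
  have rd: "0 < 1 - exp (- (r * \<delta>))" using r delta_pos by simp
  have eb: "r * \<delta> \<le> \<epsilon> n * Suc a"
  proof -
    have "\<delta> * n * sqrt n \<le> Suc a" using a0_less[of n] a by simp
    then have "\<epsilon> n * (\<delta> * n * sqrt n) \<le> \<epsilon> n * Suc a" using e by (intro mult_left_mono) auto
    moreover have "\<epsilon> n * (\<delta> * n * sqrt n) = r * \<delta>" unfolding \<epsilon>_def using n by simp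
    ultimately show ?thesis by simp
  qed
  have P: "(1 - exp (- (r * \<delta>))) / \<epsilon> n \<le> P"
  proof -
    have "1 - exp (- (r * \<delta>)) \<le> 1 - q n ^ Suc a" using eb by (simp only: q_power) simp
    moreover have "1 - q n \<le> \<epsilon> n" using exp_ge_add_one_self[of "- \<epsilon> n"] q_power[of n 1] by simp
    ultimately have "(1 - exp (- (r * \<delta>))) / \<epsilon> n \<le> (1 - q n ^ Suc a) / (1 - q n)"
      using q rd e power_le_one[of "q n" "Suc a"] by (intro frac_le) auto
    also have "\<dots> = P" unfolding P_def using q by (simp add: sum_gp_strict del: power_Suc sum.lessThan_Suc)
    finally show ?thesis .
  qed
  have P0: "0 < P" using P rd e by (smt (verit) divide_pos_pos)
  have nP: "n / P \<le> x" "0 \<le> n / P"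
  proof -
    have "n / P \<le> n / ((1 - exp (- (r * \<delta>))) / \<epsilon> n)" using P rd e P0 by (intro divide_left_mono) auto
    also have "\<dots> = x" unfolding x_def \<epsilon>_def using n by simp
    finally show "n / P \<le> x" .
  qed (use P0 in simp)
  have sq: "(n / P)\<^sup>2 \<le> x\<^sup>2" using nP by (intro power_mono)
  have "vgf {1..n} \<sigma> (q n) (Suc a) / fact n \<le> hgf n (q n) (Suc a) * F * exp ((n / P)\<^sup>2)"
    unfolding F_def P_def by (rule vgf_upper[OF \<sigma> q m]) simp
  then have "v a \<le> (\<Prod>i\<le>n. 1 - t n * q n ^ i) * t n ^ a * (hgf n (q n) (Suc a) * F * exp ((n / P)\<^sup>2))"
    unfolding v_def by (intro mult_left_mono D)
  also have "\<dots> = w n a * F * exp ((n / P)\<^sup>2)" unfolding w_def by (simp only: mult_ac)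
  also have "\<dots> \<le> w n a * F * exp (x\<^sup>2)" using sq w by (intro mult_left_mono) auto
  finally show "v a \<le> w n a * fixed_factor n m (q n) (Suc a) * exp (x\<^sup>2)" unfolding F_def .
  have "w n a * F * (1 - x - x\<^sup>2) \<le> w n a * F * (1 - n / P - (n / P)\<^sup>2)"
  proof (rule mult_left_mono[OF _ w])
    have "1 - x - X \<le> 1 - y - Y" if "Y \<le> X" "y \<le> x" for x y X Y :: real using that by simp
    then show "1 - x - x\<^sup>2 \<le> 1 - n / P - (n / P)\<^sup>2" using sq nP(1) by blast
  qed
  also have "\<dots> = (\<Prod>i\<le>n. 1 - t n * q n ^ i) * t n ^ a * (hgf n (q n) (Suc a) * F * (1 - n / P - (n / P)\<^sup>2))"
    unfolding w_def by (simp only: mult_ac)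
  also have "\<dots> \<le> v a"
    unfolding v_def F_def P_def by (intro mult_left_mono D vgf_lower[OF \<sigma> q m]) simp
  finally show "w n a * fixed_factor n m (q n) (Suc a) * (1 - x - x\<^sup>2) \<le> v a" unfolding F_def .
qed

text \<open>Below the cutoff the counting bounds are too weak, so monotonicity of \<open>vgf\<close>
  moves the estimate to the cutoff, where \<open>v_bounds\<close> and
  \<open>fixed_factor_le_1\<close> apply. The missing power of \<open>t n\<close> costs at most
  \<open>exp (s * \<delta> * n)\<close>, for which \<open>low_mass\<close> holds a reserve.\<close>

lemma v_low:
  assumes a: "a \<le> a0 n" and n': "2 * exp 2 * (s + r) \<le> sqrt n"
    and x: "r / (1 - exp (- (r * \<delta>))) \<le> sqrt n"
  shows "v a \<le> exp (1 - real n)"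
proof -
  define y where "y = r / (1 - exp (- (r * \<delta>))) / sqrt n"
  have q: "0 < q n" "q n < 1" and t: "0 < t n" "t n < 1" using q_bounds[OF n] t_bounds[OF n] by auto
  have D: "0 \<le> (\<Prod>i\<le>n. 1 - t n * q n ^ i)" using norm_const_pos[OF n] by simp
  have rd: "0 < 1 - exp (- (r * \<delta>))" using r delta_pos by simp
  have "0 < sqrt n" using n by simp
  then have y: "0 \<le> y" "y \<le> 1" unfolding y_def using x r rd
    by (intro divide_nonneg_nonneg, simp_all only: divide_le_eq_1_pos)
  then have y2: "y\<^sup>2 \<le> 1" by (simp add: power_le_one)
  have "t n ^ a0 n * v a \<le> v (a0 n)"
  proof -
    have "t n ^ a * (vgf {1..n} \<sigma> (q n) (Suc a) / fact n) \<le> 1 * (vgf {1..n} \<sigma> (q n) (Suc (a0 n)) / fact n)"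
      using t a vgf_mono[OF \<sigma> q m, of "Suc a" "Suc (a0 n)"] vgf_nonneg[of "q n" "{1..n}" \<sigma>] q
      by (intro mult_mono divide_right_mono power_le_one) auto
    then have "(\<Prod>i\<le>n. 1 - t n * q n ^ i) * t n ^ a0 n * (t n ^ a * (vgf {1..n} \<sigma> (q n) (Suc a) / fact n))
       \<le> (\<Prod>i\<le>n. 1 - t n * q n ^ i) * t n ^ a0 n * (1 * (vgf {1..n} \<sigma> (q n) (Suc (a0 n)) / fact n))"
      using D t by (intro mult_left_mono) auto
    then show ?thesis unfolding v_def by (simp only: mult_ac mult_1_left)
  qed
  also have "v (a0 n) \<le> w n (a0 n) * fixed_factor n m (q n) (Suc (a0 n)) * exp (y\<^sup>2)"
    unfolding y_def by (rule v_bounds) simp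
  also have "\<dots> \<le> w n (a0 n) * 1 * exp 1"
    using w_nonneg[OF n] fixed_factor_le_1[OF q, of "Suc (a0 n)" n m] fixed_factor_pos[OF q, of "Suc (a0 n)" n m] y2
    by (intro mult_mono mult_nonneg_nonneg) auto
  also have "w n (a0 n) \<le> (\<Sum>a\<le>a0 n. w n a)"
    using w_nonneg[OF n] by (intro member_le_sum) auto
  also have "\<dots> \<le> exp (- real n - s * \<delta> * n)" by (rule low_mass[OF n'])
  finally have le: "t n ^ a0 n * v a \<le> exp (- real n - s * \<delta> * n) * 1 * exp 1" by simp
  have "t n ^ a0 n = exp (- (s / sqrt n * a0 n))"
    by (simp add: t_def exp_of_nat_mult[symmetric] mult.commute)
  moreover have "s / sqrt n * a0 n \<le> s * \<delta> * n"
  proof -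
    have "s / sqrt n * a0 n \<le> s / sqrt n * (\<delta> * n * sqrt n)" using a0_le[of n] s by (intro mult_left_mono) auto
    also have "\<dots> = s * \<delta> * n" using n by simp
    finally show ?thesis .
  qed
  ultimately have "exp (- (s * \<delta> * n)) \<le> t n ^ a0 n" by simp
  then have "exp (- (s * \<delta> * n)) * v a \<le> exp (- real n - s * \<delta> * n) * 1 * exp 1"
    using le v_nonneg[of a] by (meson mult_right_mono order.trans)
  also have "\<dots> = exp (- (s * \<delta> * n)) * exp (1 - real n)" by (simp add: mult_exp_exp algebra_simps)
  finally show ?thesis by simp
qed

lemma v_sums:
  "v sums ((\<Sum>\<rho> | \<rho> permutes {1..n}. t n ^ card (descents n (\<rho> \<circ> \<sigma> \<circ> inv \<rho>)) * q n ^ maj n (\<rho> \<circ> \<sigma> \<circ> inv \<rho>)) / fact n)"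
  unfolding v_def[abs_def] using q_bounds[OF n] t_bounds[OF n] by (intro vgf_sums \<sigma>) auto

end

end

section \<open>Comparison of the series with its limit\<close>

context tilted
begin

text \<open>The exponential of \<open>const n m + slope n m * z\<close>, integrated against the
  Gaussian with mean \<open>- 1 / 2\<close> and variance \<open>1 / (s * (s + r))\<close>.\<close>

definition limit_mgf :: "nat \<Rightarrow> nat \<Rightarrow> real" where
  "limit_mgf n m = exp (const n m + ((slope n m)\<^sup>2 / (2 * (s * (s + r))) - slope n m / 2))"

text \<open>The extra factor \<open>t n\<close> is there because \<open>des\<close> is the number of
  descents plus 1; \<open>exp (shift n m)\<close> is the centring.\<close>

definition conj_average :: "nat \<Rightarrow> nat \<Rightarrow> (nat \<Rightarrow> nat) \<Rightarrow> real" where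
  "conj_average n m \<sigma> = exp (shift n m) * t n *
    ((\<Sum>\<rho> | \<rho> permutes {1..n}. t n ^ card (descents n (\<rho> \<circ> \<sigma> \<circ> inv \<rho>)) * q n ^ maj n (\<rho> \<circ> \<sigma> \<circ> inv \<rho>)) / fact n)"

lemma Z_low: "Suc a \<le> a0 n \<Longrightarrow> Z n (Suc a) \<le> 0"
proof -
  assume a: "Suc a \<le> a0 n"
  have "real (Suc a) \<le> \<delta> * n * sqrt n" using a a0_le[of n] by (meson le_trans of_nat_mono order.trans)
  also have "\<dots> \<le> y0 / r * n * sqrt n"
    using delta_le_y0 r by (intro mult_right_mono) (auto simp: field_simps)
  finally have "real (Suc a) - y0 * n * sqrt n / r \<le> 0" by simp
  then show ?thesis unfolding Z_def by (rule divide_nonpos_nonneg) simp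
qed

text \<open>One summand beyond the cutoff. A difference of exponentials is at most the difference of
  the exponents times the larger exponential, which the one-sided bound controls by
  \<open>exp (c * z + C)\<close>; the factor \<open>1 + z\<^sup>2\<close> then moves
  \<open>c\<close> to \<open>c + 1\<close> and \<open>c - 1\<close>.\<close>

lemma high_term_bound:
  fixes z c F V W x C D Fs sh :: real
  assumes F: "0 < F" and W: "0 \<le> W"
    and V: "V \<le> W * F * exp (x\<^sup>2)" "W * F * (1 - x - x\<^sup>2) \<le> V"
    and x: "0 \<le> x" "x \<le> 1"
    and b: "\<bar>ln F + sh - (c * z + D)\<bar> \<le> e * (1 + z\<^sup>2)" "ln F + sh \<le> c * z + C" "D \<le> C"
  shows "\<bar>exp sh * V - exp D * (W * exp (c * z))\<bar> \<le> 2 * exp C * (e + 2 * x) * (W * exp ((c + 1) * z) + W * exp ((c - 1) * z))"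
proof -
  have FW: "exp sh * (W * F) = W * exp (ln F + sh)" using F by (simp add: exp_add)
  have x2: "x\<^sup>2 \<le> x" using x by (simp add: power2_eq_square mult_left_le)
  have ex: "exp (x\<^sup>2) \<le> 1 + 2 * x"
  proof -
    have "exp (x\<^sup>2) \<le> 1 + x\<^sup>2 + (x\<^sup>2)\<^sup>2" using x by (intro exp_bound) (auto simp: power_le_one)
    moreover have "(x\<^sup>2)\<^sup>2 \<le> x\<^sup>2 * 1" unfolding power2_eq_square[of "x\<^sup>2"] using x by (intro mult_left_mono) (auto simp: power_le_one)
    ultimately show ?thesis using x2 by simp
  qed
  have WF: "0 \<le> W * F" using F W by simp
  have "W * F * exp (x\<^sup>2) \<le> W * F * (1 + 2 * x)" using ex WF by (rule mult_left_mono)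
  moreover have "W * F * (1 - 2 * x) \<le> W * F * (1 - x - x\<^sup>2)" using x2 WF by (intro mult_left_mono) auto
  ultimately have "\<bar>V - W * F\<bar> \<le> W * F * (2 * x)" using V by (simp add: abs_le_iff algebra_simps)
  then have "exp sh * \<bar>V - W * F\<bar> \<le> exp sh * (W * F * (2 * x))" by (intro mult_left_mono) auto
  also have "\<dots> = W * exp (ln F + sh) * (2 * x)" unfolding FW[symmetric] by (simp only: mult_ac)
  also have "\<dots> \<le> W * exp (c * z + C) * (2 * x)"
    using b(2) W x by (intro mult_right_mono mult_left_mono) auto
  finally have 1: "\<bar>exp sh * V - W * exp (ln F + sh)\<bar> \<le> W * exp (c * z + C) * (2 * x)"
    unfolding FW[symmetric] right_diff_distrib[symmetric] abs_mult by simp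
  have "\<bar>exp (ln F + sh) - exp (c * z + D)\<bar> \<le> exp (c * z + C) * (e * (1 + z\<^sup>2))"
    using b by (intro order.trans[OF exp_diff_le] mult_mono) auto
  then have "W * \<bar>exp (ln F + sh) - exp (c * z + D)\<bar> \<le> W * (exp (c * z + C) * (e * (1 + z\<^sup>2)))"
    using W by (rule mult_left_mono)
  then have 2: "\<bar>W * exp (ln F + sh) - W * exp (c * z + D)\<bar> \<le> W * exp (c * z + C) * (e * (1 + z\<^sup>2))"
    unfolding right_diff_distrib[symmetric] abs_mult using W by (simp add: mult.assoc)
  have e: "0 \<le> e * (1 + z\<^sup>2)" using b(1) by linarith
  then have "0 \<le> e" by (smt (verit) mult_neg_pos zero_le_power2)
  have "2 * x * 1 \<le> 2 * x * (1 + z\<^sup>2)" using x by (intro mult_left_mono) auto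
  then have 4: "W * exp (c * z + C) * (2 * x) \<le> W * exp (c * z + C) * (2 * x * (1 + z\<^sup>2))"
    using W by (intro mult_left_mono) auto
  have "exp D * (W * exp (c * z)) = W * exp (c * z + D)" by (simp add: exp_add)
  then have "\<bar>exp sh * V - exp D * (W * exp (c * z))\<bar> \<le> W * exp (c * z + C) * ((e + 2 * x) * (1 + z\<^sup>2))"
    using 1 2 4 by (simp only: distrib_right distrib_left)
  also have "\<dots> \<le> W * exp (c * z + C) * ((e + 2 * x) * (2 * (exp z + exp (- z))))"
    using one_plus_square_le[of z] W x \<open>0 \<le> e\<close> by (intro mult_left_mono) auto
  also have "\<dots> = 2 * exp C * (e + 2 * x) * (W * exp ((c + 1) * z) + W * exp ((c - 1) * z))"
  proof -
    have "exp ((c + 1) * z) = exp (c * z) * exp z" "exp ((c - 1) * z) = exp (c * z) * exp (- z)"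
      by (simp_all add: mult_exp_exp algebra_simps)
    then show ?thesis by (simp add: exp_add algebra_simps)
  qed
  finally show ?thesis .
qed

text \<open>The difference of the two series is dominated termwise by \<open>hi + lo\<close>. The
  sum of \<open>hi\<close> is of order \<open>1 / sqrt n\<close> by \<open>mgf_w\<close> at
  \<open>slope n m + 1\<close> and \<open>slope n m - 1\<close>; \<open>lo\<close> lives below the
  cutoff and is controlled by \<open>v_low\<close> and \<open>low_mass\<close>.\<close>

lemma conj_average_asymp:
  "\<exists>C\<ge>0. \<exists>A\<ge>1. \<forall>n m \<sigma>. A \<le> sqrt n \<longrightarrow> \<sigma> permutes {1..n} \<longrightarrow> m = card {u \<in> {1..n}. \<sigma> u = u} \<longrightarrow>
    \<bar>conj_average n m \<sigma> - limit_mgf n m\<bar> \<le> C / sqrt n"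
proof -
  \<comment> \<open>Large enough for \<open>c\<close>, \<open>c + 1\<close> and
    \<open>c - 1\<close>, as \<open>c = slope n m\<close> lies between 0 and
    \<open>s * (s + r) / 2\<close>.\<close>
  define K where "K = s * (s + r) / 2 + 1"
  define p where "p = r / (1 - exp (- (r * \<delta>)))"
  define B where "B = s / 2 + r / 4"
  define D where "D = r\<^sup>2 / 72 + s * (s + r) / 6"
  obtain C1 A1 where C10: "0 \<le> C1" and A1: "1 \<le> A1" and C1: "\<And>n m b. A1 \<le> sqrt (real n) \<Longrightarrow> m \<le> n \<Longrightarrow> \<delta> * n * sqrt n \<le> real b \<Longrightarrow>
    \<bar>ln (fixed_factor n m (q n) b) + shift n m - (slope n m * Z n b + const n m)\<bar> \<le> C1 * (1 + (Z n b)\<^sup>2) / sqrt n \<and>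
    ln (fixed_factor n m (q n) b) + shift n m \<le> slope n m * Z n b + C1"
    using fixed_factor_asymp by metis
  obtain C2 A2 where A2: "1 \<le> A2" and C2: "\<And>n \<theta>. A2 \<le> sqrt (real n) \<Longrightarrow> \<bar>\<theta>\<bar> \<le> K \<Longrightarrow>
    (\<exists>M. (\<lambda>a. w n a * exp (\<theta> * Z n (Suc a))) sums M \<and>
      \<bar>M - exp (\<theta>\<^sup>2 / (2 * (s * (s + r))) - \<theta> / 2)\<bar> \<le> C2 / sqrt n)"
    using mgf_w[of K] by metis
  \<comment> \<open>Below the cutoff there are at most \<open>\<delta> * R ^ 3\<close> terms of size
    at most \<open>exp (B * R + 1 - R\<^sup>2)\<close> with \<open>R = sqrt n\<close>; the fourth
    power leaves a total of order \<open>1 / R\<close>.\<close>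
  have "((\<lambda>R. R ^ 4 * exp (B * R + 1 - R\<^sup>2)) \<longlongrightarrow> 0) at_top" by real_asymp
  then have "eventually (\<lambda>R. R ^ 4 * exp (B * R + 1 - R\<^sup>2) < 1) at_top" by (rule order_tendstoD) simp
  then obtain A3 where A3: "\<And>R. A3 \<le> R \<Longrightarrow> R ^ 4 * exp (B * R + 1 - R\<^sup>2) < 1"
    unfolding eventually_at_top_linorder by blast
  define A where "A = max A1 (max A2 (max A3 (max p (2 * exp 2 * (s + r)))))"
  define C where "C = max C1 D"
  define T where "T = K\<^sup>2 / (2 * (s * (s + r))) + K / 2"
  define C4 where "C4 = 2 * exp C * (C1 + 2 * p)"
  define C5 where "C5 = C4 * (2 * (exp T + \<bar>C2\<bar>)) + \<delta> + exp D"
  define C6 where "C6 = C5 + exp D * \<bar>C2\<bar> + exp (D + T) * s"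
  have K: "0 \<le> s * (s + r)" "1 \<le> K" unfolding K_def using s r by auto
  have rd: "0 < 1 - exp (- (r * \<delta>))" using r delta_pos by simp
  have p: "0 \<le> p" unfolding p_def using r rd by simp
  have C45: "0 \<le> C4" unfolding C4_def using C10 p by simp
  have C5: "0 \<le> C5" unfolding C5_def using C45 delta_pos by (intro add_nonneg_nonneg mult_nonneg_nonneg) auto
  have C6: "0 \<le> C6" unfolding C6_def using C5 s by (intro add_nonneg_nonneg mult_nonneg_nonneg) auto
  show ?thesis
  proof (rule exI[of _ C6], rule conjI[OF C6], rule exI[of _ A], intro conjI allI impI)
    show "1 \<le> A" using A1 by (simp add: A_def)
    fix n m :: nat and \<sigma>
    assume An: "A \<le> sqrt n" and \<sigma>: "\<sigma> permutes {1..n}" and m: "m = card {u \<in> {1..n}. \<sigma> u = u}"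
    define R where "R = sqrt n"
    have "A1 \<le> A" by (simp add: A_def)
    then have "1 \<le> R" using An A1 unfolding R_def by linarith
    moreover have "A1 \<le> R" "A2 \<le> R" "A3 \<le> R" "p \<le> R" "2 * exp 2 * (s + r) \<le> R"
      using An unfolding A_def R_def by auto
    ultimately have R: "1 \<le> R" "A1 \<le> R" "A2 \<le> R" "A3 \<le> R" "p \<le> R" "2 * exp 2 * (s + r) \<le> R" by blast+
    have Rn: "real n = R\<^sup>2" by (simp add: R_def)
    have n: "1 \<le> n" using R(1) unfolding R_def by (cases n) auto
    note mn = fixed_points_le[OF \<sigma> m n]
    define c where "c = slope n m"
    define k' where "k' = const n m"
    define sh where "sh = shift n m"
    have c: "0 \<le> c" "c + 1 \<le> K" using slope_bounds[OF mn] by (auto simp: c_def K_def)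
    have kD: "k' \<le> D" using const_bounds[OF mn] by (simp add: k'_def D_def)
    have sh: "sh \<le> B * R" using shift_bounds[OF mn] by (simp add: sh_def B_def R_def)
    define vv where "vv = v n \<sigma>"
    define E where "E = (\<Sum>\<rho> | \<rho> permutes {1..n}. t n ^ card (descents n (\<rho> \<circ> \<sigma> \<circ> inv \<rho>)) * q n ^ maj n (\<rho> \<circ> \<sigma> \<circ> inv \<rho>)) / fact n"
    have vE: "vv sums E" unfolding vv_def E_def by (rule v_sums[OF \<sigma> m n])
    define x where "x = p / R"
    have x: "0 \<le> x" "x \<le> 1" unfolding x_def using p R by (auto simp: divide_le_eq_1)
    have A2n: "A2 \<le> sqrt n" using R(3) by (simp add: R_def)
    have Mb: "\<exists>M. (\<lambda>a. w n a * exp (\<theta> * Z n (Suc a))) sums M \<and> M \<le> exp T + \<bar>C2\<bar>" if th: "\<bar>\<theta>\<bar> \<le> K" for \<theta>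
    proof -
      obtain M where M: "(\<lambda>a. w n a * exp (\<theta> * Z n (Suc a))) sums M"
        "\<bar>M - exp (\<theta>\<^sup>2 / (2 * (s * (s + r))) - \<theta> / 2)\<bar> \<le> C2 / R"
        using C2[OF A2n th] unfolding R_def by blast
      have "C2 / R \<le> \<bar>C2\<bar> / R" using R by (intro divide_right_mono) auto
      also have "\<dots> \<le> \<bar>C2\<bar> / 1" using R by (intro divide_left_mono) auto
      finally have 1: "C2 / R \<le> \<bar>C2\<bar>" by simp
      have "\<theta>\<^sup>2 \<le> K\<^sup>2" using th abs_le_square_iff[of \<theta> K] by linarith
      then have "\<theta>\<^sup>2 / (2 * (s * (s + r))) \<le> K\<^sup>2 / (2 * (s * (s + r)))" using K by (intro divide_right_mono) auto
      then have "\<theta>\<^sup>2 / (2 * (s * (s + r))) - \<theta> / 2 \<le> T" unfolding T_def using th by linarith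
      then have "exp (\<theta>\<^sup>2 / (2 * (s * (s + r))) - \<theta> / 2) \<le> exp T" by (simp only: exp_le_cancel_iff)
      then have "M \<le> exp T + \<bar>C2\<bar>" using M(2) 1 by linarith
      then show ?thesis using M(1) by blast
    qed
    have cK: "\<bar>c\<bar> \<le> K" "\<bar>c + 1\<bar> \<le> K" "\<bar>c - 1\<bar> \<le> K" using c K by auto
    obtain M0 where M0: "(\<lambda>a. w n a * exp (c * Z n (Suc a))) sums M0"
        "\<bar>M0 - exp (c\<^sup>2 / (2 * (s * (s + r))) - c / 2)\<bar> \<le> C2 / R"
      using C2[OF A2n cK(1)] unfolding R_def by blast
    obtain M1 where M1: "(\<lambda>a. w n a * exp ((c + 1) * Z n (Suc a))) sums M1" "M1 \<le> exp T + \<bar>C2\<bar>"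
      using Mb[OF cK(2)] by blast
    obtain M2 where M2: "(\<lambda>a. w n a * exp ((c - 1) * Z n (Suc a))) sums M2" "M2 \<le> exp T + \<bar>C2\<bar>"
      using Mb[OF cK(3)] by blast
    define g where "g a = exp sh * vv a - exp k' * (w n a * exp (c * Z n (Suc a)))" for a
    have g_sums: "g sums (exp sh * E - exp k' * M0)"
      unfolding g_def by (intro sums_diff sums_mult vE M0)
    define hi where "hi a = C4 / R * (w n a * exp ((c + 1) * Z n (Suc a)) + w n a * exp ((c - 1) * Z n (Suc a)))" for a
    define lo where "lo a = (if a \<in> {..<a0 n} then exp (sh + 1 - R\<^sup>2) + exp D * w n a else 0)" for a
    have w0: "0 \<le> w n a" for a using w_nonneg[OF n] .
    have hi0: "0 \<le> hi a" for a unfolding hi_def using C45 R w0 by simp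
    have g_le: "\<bar>g a\<bar> \<le> hi a + lo a" for a
    proof (cases "a < a0 n")
      case True
      have "vv a \<le> exp (1 - real n)"
        unfolding vv_def using True R by (intro v_low[OF \<sigma> m n]) (auto simp: R_def p_def)
      then have "exp sh * vv a \<le> exp sh * exp (1 - real n)" by (intro mult_left_mono) auto
      also have "\<dots> = exp (sh + 1 - R\<^sup>2)" by (simp add: mult_exp_exp Rn algebra_simps)
      finally have 1: "exp sh * vv a \<le> exp (sh + 1 - R\<^sup>2)" .
      have "c * Z n (Suc a) \<le> 0" using Z_low[of a n] True c by (intro mult_nonneg_nonpos) auto
      then have "exp k' * (w n a * exp (c * Z n (Suc a))) \<le> exp D * (w n a * 1)"
        using kD w0 by (intro mult_mono mult_nonneg_nonneg) auto
      moreover have "0 \<le> exp sh * vv a" "0 \<le> exp k' * (w n a * exp (c * Z n (Suc a)))"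
        using v_nonneg[OF \<sigma> m n] w0 by (auto simp: vv_def)
      ultimately have "\<bar>g a\<bar> \<le> lo a" unfolding g_def lo_def using 1 True by (simp add: abs_le_iff)
      then show ?thesis using hi0[of a] by simp
    next
      case False
      define F where "F = fixed_factor n m (q n) (Suc a)"
      have q: "0 < q n" "q n < 1" using q_bounds[OF n] by auto
      have F: "0 < F" unfolding F_def by (rule fixed_factor_pos[OF q]) simp
      have ab: "\<delta> * n * sqrt n \<le> real (Suc a)" using a0_less[of n] False by simp
      have V: "vv a \<le> w n a * F * exp (x\<^sup>2)" "w n a * F * (1 - x - x\<^sup>2) \<le> vv a"
      proof -
        have "a0 n \<le> a" using False by simp
        from v_bounds[OF \<sigma> m n this]
        show "vv a \<le> w n a * F * exp (x\<^sup>2)" "w n a * F * (1 - x - x\<^sup>2) \<le> vv a"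
          unfolding vv_def F_def x_def p_def R_def .
      qed
      have "\<bar>ln F + sh - (c * Z n (Suc a) + k')\<bar> \<le> C1 / R * (1 + (Z n (Suc a))\<^sup>2)"
        "ln F + sh \<le> c * Z n (Suc a) + C1"
        using C1[OF _ mn ab] R unfolding F_def sh_def c_def k'_def R_def by auto
      then have "\<bar>g a\<bar> \<le> 2 * exp C * (C1 / R + 2 * x) * (w n a * exp ((c + 1) * Z n (Suc a)) + w n a * exp ((c - 1) * Z n (Suc a)))"
        unfolding g_def using kD by (intro high_term_bound[OF F w0 V x]) (auto simp: C_def)
      also have "2 * exp C * (C1 / R + 2 * x) = C4 / R" by (simp add: C4_def x_def add_divide_distrib[symmetric])
      finally show ?thesis using False by (simp add: hi_def lo_def)
    qed
    have gl: "g a \<le> hi a + lo a" "- g a \<le> hi a + lo a" for a using g_le[of a] by linarith+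
    have hi_sums: "hi sums (C4 / R * (M1 + M2))"
      unfolding hi_def by (intro sums_mult sums_add M1 M2)
    have lo_sums: "lo sums (\<Sum>a<a0 n. exp (sh + 1 - R\<^sup>2) + exp D * w n a)"
      unfolding lo_def by (rule sums_If_finite_set) simp
    have "exp sh * E - exp k' * M0 \<le> C4 / R * (M1 + M2) + (\<Sum>a<a0 n. exp (sh + 1 - R\<^sup>2) + exp D * w n a)"
      by (rule sums_le[OF gl(1) g_sums sums_add[OF hi_sums lo_sums]])
    moreover have "- (exp sh * E - exp k' * M0) \<le> C4 / R * (M1 + M2) + (\<Sum>a<a0 n. exp (sh + 1 - R\<^sup>2) + exp D * w n a)"
      by (rule sums_le[OF gl(2) sums_minus[OF g_sums] sums_add[OF hi_sums lo_sums]])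
    ultimately have G: "\<bar>exp sh * E - exp k' * M0\<bar> \<le> C4 / R * (M1 + M2) + (\<Sum>a<a0 n. exp (sh + 1 - R\<^sup>2) + exp D * w n a)"
      by (simp add: abs_le_iff)
    also have "\<dots> \<le> C5 / R"
    proof -
      have 1: "C4 / R * (M1 + M2) \<le> C4 / R * (2 * (exp T + \<bar>C2\<bar>))"
        using M1(2) M2(2) C45 R by (intro mult_left_mono) auto
      have "(\<Sum>a<a0 n. exp (sh + 1 - R\<^sup>2) + exp D * w n a) = a0 n * exp (sh + 1 - R\<^sup>2) + exp D * (\<Sum>a<a0 n. w n a)"
        by (simp add: sum.distrib sum_distrib_left)
      also have "\<dots> \<le> \<delta> / R + exp D * (1 / R)"
      proof (intro add_mono mult_left_mono)
        have R4: "R ^ 4 * exp (B * R + 1 - R\<^sup>2) \<le> 1" using A3[OF R(4)] by simp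
        have "a0 n * exp (sh + 1 - R\<^sup>2) \<le> (\<delta> * R ^ 3) * exp (B * R + 1 - R\<^sup>2)"
        proof (rule mult_mono)
          show "real (a0 n) \<le> \<delta> * R ^ 3" using a0_le[of n] unfolding Rn using R(1)
            by (simp add: power2_eq_square power3_eq_cube mult.assoc)
        qed (use sh delta_pos R in auto)
        also have "\<dots> = \<delta> / R * (R ^ 4 * exp (B * R + 1 - R\<^sup>2))"
          using R(1) by (simp add: power2_eq_square power3_eq_cube power4_eq_xxxx)
        also have "\<dots> \<le> \<delta> / R * 1" using R4 delta_pos R by (intro mult_left_mono) auto
        finally show "a0 n * exp (sh + 1 - R\<^sup>2) \<le> \<delta> / R" by simp
        have "(\<Sum>a<a0 n. w n a) \<le> (\<Sum>a\<le>a0 n. w n a)" using w0 by (intro sum_mono2) auto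
        also have "\<dots> \<le> exp (- real n - s * \<delta> * n)" using R(6) by (intro low_mass) (simp add: R_def)
        also have "\<dots> \<le> exp (- real n)" using s delta_pos by simp
        also have "\<dots> \<le> exp (- R)" unfolding Rn using R(1) by (simp add: power2_eq_square mult_le_cancel_left1)
        also have "\<dots> \<le> 1 / R"
        proof -
          have "R \<le> exp R" using exp_ge_add_one_self[of R] by linarith
          then show ?thesis using R(1) by (simp add: exp_minus inverse_eq_divide frac_le)
        qed
        finally show "(\<Sum>a<a0 n. w n a) \<le> 1 / R" .
      qed auto
      finally have 2: "(\<Sum>a<a0 n. exp (sh + 1 - R\<^sup>2) + exp D * w n a) \<le> \<delta> / R + exp D * (1 / R)" .
      have "C5 / R = C4 / R * (2 * (exp T + \<bar>C2\<bar>)) + (\<delta> / R + exp D * (1 / R))"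
        unfolding C5_def by (simp add: add_divide_distrib)
      then show ?thesis using 1 2 by linarith
    qed
    finally have G: "\<bar>exp sh * E - exp k' * M0\<bar> \<le> C5 / R" .
    define X where "X = c\<^sup>2 / (2 * (s * (s + r))) - c / 2"
    have G2: "\<bar>exp k' * M0 - exp (k' + X)\<bar> \<le> exp D * (\<bar>C2\<bar> / R)"
    proof -
      have "\<bar>exp k' * M0 - exp (k' + X)\<bar> = exp k' * \<bar>M0 - exp X\<bar>"
        unfolding exp_add right_diff_distrib[symmetric] abs_mult by simp
      also have "\<dots> \<le> exp D * (\<bar>C2\<bar> / R)"
      proof (rule mult_mono)
        have "C2 / R \<le> \<bar>C2\<bar> / R" using R by (intro divide_right_mono) auto
        then show "\<bar>M0 - exp X\<bar> \<le> \<bar>C2\<bar> / R" using M0(2) by (simp add: X_def)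
      qed (use kD in auto)
      finally show ?thesis .
    qed
    have XT: "exp (k' + X) \<le> exp (D + T)"
    proof -
      have "c\<^sup>2 \<le> K\<^sup>2" using c by (intro power_mono) auto
      then have "c\<^sup>2 / (2 * (s * (s + r))) \<le> K\<^sup>2 / (2 * (s * (s + r)))" using K by (intro divide_right_mono) auto
      then show ?thesis unfolding X_def T_def using kD c K by simp
    qed
    have tn: "0 \<le> t n" "t n \<le> 1" "1 - t n \<le> s / R"
      using t_bounds[OF n] exp_ge_add_one_self[of "- s / R"] by (auto simp: t_def R_def)
    have t1: "\<bar>t n * (exp sh * E) - exp (k' + X)\<bar> \<le> \<bar>t n * (exp sh * E - exp (k' + X))\<bar> + \<bar>(1 - t n) * exp (k' + X)\<bar>"
    proof -
      have "t n * (exp sh * E) - exp (k' + X) = t n * (exp sh * E - exp (k' + X)) - (1 - t n) * exp (k' + X)"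
        by (simp add: algebra_simps)
      then show ?thesis by (simp only: abs_triangle_ineq4)
    qed
    have t2: "\<bar>t n * (exp sh * E - exp (k' + X))\<bar> \<le> 1 * \<bar>exp sh * E - exp (k' + X)\<bar>"
      unfolding abs_mult using tn by (intro mult_right_mono) auto
    have t3: "\<bar>(1 - t n) * exp (k' + X)\<bar> \<le> s / R * exp (D + T)"
      unfolding abs_mult using tn XT s R by (intro mult_mono) auto
    have "exp sh * E - exp (k' + X) = (exp sh * E - exp k' * M0) + (exp k' * M0 - exp (k' + X))" by simp
    then have "\<bar>exp sh * E - exp (k' + X)\<bar> \<le> \<bar>exp sh * E - exp k' * M0\<bar> + \<bar>exp k' * M0 - exp (k' + X)\<bar>"
      by (simp only: abs_triangle_ineq)
    then have t4: "\<bar>exp sh * E - exp (k' + X)\<bar> \<le> C5 / R + exp D * (\<bar>C2\<bar> / R)"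
      by (rule order.trans[OF _ add_mono[OF G G2]])
    have t5: "\<bar>t n * (exp sh * E - exp (k' + X))\<bar> \<le> C5 / R + exp D * (\<bar>C2\<bar> / R)"
      by (rule order.trans[OF t2]) (simp only: mult_1_left t4)
    have "\<bar>t n * (exp sh * E) - exp (k' + X)\<bar> \<le> C5 / R + exp D * (\<bar>C2\<bar> / R) + s / R * exp (D + T)"
      by (rule order.trans[OF t1 add_mono[OF t5 t3]])
    also have "\<dots> = C6 / R" unfolding C6_def by (simp add: add_divide_distrib mult.commute)
    finally show "\<bar>conj_average n m \<sigma> - limit_mgf n m\<bar> \<le> C6 / sqrt n"
      unfolding conj_average_def limit_mgf_def E_def sh_def k'_def X_def c_def R_def by (simp only: mult_ac)
  qed
qed

end

section \<open>Uniformity in n and return to the random vector\<close>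

context tilted
begin

text \<open>Both \<open>t n\<close> and \<open>q n\<close> are below 1, so each conjugate
  contributes at most 1 and only the centring can grow. This crude bound serves for small
  \<open>n\<close>.\<close>

lemma conj_average_bounds:
  assumes n: "1 \<le> n" and m: "m \<le> n"
  shows "0 \<le> conj_average n m \<sigma>" "conj_average n m \<sigma> \<le> exp ((s / 2 + r / 4) * sqrt n)"
proof -
  let ?g = "\<lambda>\<rho>. t n ^ card (descents n (\<rho> \<circ> \<sigma> \<circ> inv \<rho>)) * q n ^ maj n (\<rho> \<circ> \<sigma> \<circ> inv \<rho>)"
  have tq: "0 < t n" "t n < 1" "0 < q n" "q n < 1" using t_bounds[OF n] q_bounds[OF n] by auto
  have g: "0 \<le> ?g \<rho>" "?g \<rho> \<le> 1" for \<rho> using tq by (auto intro!: mult_le_one simp: power_le_one)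
  have "(\<Sum>\<rho> | \<rho> permutes {1..n}. ?g \<rho>) \<le> (\<Sum>\<rho> | \<rho> permutes {1..n}. 1)" using g by (intro sum_mono) auto
  also have "\<dots> = fact n" using card_permutations[of "{1..n}" n] by simp
  finally have 1: "(\<Sum>\<rho> | \<rho> permutes {1..n}. ?g \<rho>) / fact n \<le> 1" by simp
  have 0: "0 \<le> (\<Sum>\<rho> | \<rho> permutes {1..n}. ?g \<rho>) / fact n" using g by (intro divide_nonneg_nonneg sum_nonneg) auto
  show "0 \<le> conj_average n m \<sigma>" unfolding conj_average_def using 0 tq by (intro mult_nonneg_nonneg) auto
  have "conj_average n m \<sigma> \<le> exp ((s / 2 + r / 4) * sqrt n) * 1 * 1"
    unfolding conj_average_def using 0 1 tq shift_bounds[OF m] by (intro mult_mono mult_nonneg_nonneg) auto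
  then show "conj_average n m \<sigma> \<le> exp ((s / 2 + r / 4) * sqrt n)" by simp
qed

lemma limit_mgf_le:
  assumes m: "m \<le> n"
  shows "limit_mgf n m \<le> exp (r\<^sup>2 / 72 + s * (s + r) / 6 + s * (s + r) / 8)"
proof -
  have p: "0 < s * (s + r)" using s r by simp
  have "(slope n m)\<^sup>2 \<le> (s * (s + r) / 2)\<^sup>2" using slope_bounds[OF m] by (intro power_mono) auto
  then have "(slope n m)\<^sup>2 / (2 * (s * (s + r))) \<le> (s * (s + r) / 2)\<^sup>2 / (2 * (s * (s + r)))"
    using p by (intro divide_right_mono) auto
  also have "\<dots> = s * (s + r) / 8"
  proof -
    have "(x / 2)\<^sup>2 / (2 * x) = x / 8" if "0 < x" for x :: real using that by (simp add: power2_eq_square)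
    then show ?thesis using p by blast
  qed
  finally show ?thesis unfolding limit_mgf_def exp_le_cancel_iff
    using const_bounds[OF m] slope_bounds(1)[OF m] by linarith
qed

text \<open>For \<open>A \<le> sqrt n\<close> the asymptotic bound of order
  \<open>n powr (- 1 / 2)\<close> is stronger than required. For smaller \<open>n\<close> both
  quantities are bounded, and \<open>n powr (1 / 6) \<le> sqrt n < A\<close> keeps the right-hand
  side away from 0.\<close>

lemma conj_average_uniform:
  "\<exists>C>0. \<forall>n\<ge>1. \<forall>\<sigma>. \<sigma> permutes {1..n} \<longrightarrow>
    \<bar>conj_average n (card {u \<in> {1..n}. \<sigma> u = u}) \<sigma> - limit_mgf n (card {u \<in> {1..n}. \<sigma> u = u})\<bar> \<le> C * real n powr (-1/6)"
proof -
  obtain C0 A where C0: "0 \<le> C0" and A: "1 \<le> A" and asymp: "\<forall>n m \<sigma>. A \<le> sqrt (real n) \<longrightarrow> \<sigma> permutes {1..n} \<longrightarrow>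
    m = card {u \<in> {1..n}. \<sigma> u = u} \<longrightarrow> \<bar>conj_average n m \<sigma> - limit_mgf n m\<bar> \<le> C0 / sqrt n"
    using conj_average_asymp by blast
  define D where "D = exp ((s / 2 + r / 4) * A) + exp (r\<^sup>2 / 72 + s * (s + r) / 6 + s * (s + r) / 8)"
  have D: "0 < D" unfolding D_def by (simp add: add_pos_pos)
  have "\<bar>conj_average n m \<sigma> - limit_mgf n m\<bar> \<le> (C0 + A * D) * real n powr (-1/6)"
    if n: "1 \<le> n" and \<sigma>: "\<sigma> permutes {1..n}" and m: "m = card {u \<in> {1..n}. \<sigma> u = u}" for n m \<sigma>
  proof -
    have n0: "1 \<le> real n" using n by simp
    have mn: "m \<le> n" using fixed_points_le[OF \<sigma> m n] .
    show ?thesis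
    proof (cases "A \<le> sqrt n")
      case True
      have "1 / sqrt n = real n powr (-1/2)" using n by (simp add: powr_minus powr_half_sqrt inverse_eq_divide)
      also have "\<dots> \<le> real n powr (-1/6)" using n0 by (intro powr_mono) auto
      finally have "C0 * (1 / sqrt n) \<le> C0 * real n powr (-1/6)" using C0 by (rule mult_left_mono)
      then have "\<bar>conj_average n m \<sigma> - limit_mgf n m\<bar> \<le> C0 * real n powr (-1/6)" using asymp[rule_format, OF True \<sigma> m] by simp
      also have "\<dots> \<le> (C0 + A * D) * real n powr (-1/6)" using A D by (intro mult_right_mono) auto
      finally show ?thesis .
    next
      case False
      have "\<bar>conj_average n m \<sigma> - limit_mgf n m\<bar> \<le> D"
      proof -
        have "(s / 2 + r / 4) * sqrt n \<le> (s / 2 + r / 4) * A" using False s r by (intro mult_left_mono) auto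
        then have "exp ((s / 2 + r / 4) * sqrt n) \<le> exp ((s / 2 + r / 4) * A)" by simp
        moreover have "0 \<le> limit_mgf n m" by (simp add: limit_mgf_def)
        ultimately show ?thesis unfolding D_def
          using conj_average_bounds[OF n mn, of \<sigma>] limit_mgf_le[OF mn] by linarith
      qed
      also have "D \<le> A * D * real n powr (-1/6)"
      proof -
        have "real n powr (1/6) \<le> real n powr (1/2)" using n0 by (intro powr_mono) auto
        also have "\<dots> = sqrt n" by (simp add: powr_half_sqrt)
        also have "\<dots> \<le> A" using False by simp
        finally have "real n powr (1/6) * real n powr (-1/6) \<le> A * real n powr (-1/6)" by (rule mult_right_mono) simp
        moreover have "real n powr (1/6) * real n powr (-1/6) = 1" using n by (simp add: powr_add[symmetric])
        ultimately have "D * 1 \<le> D * (A * real n powr (-1/6))" using D by (intro mult_left_mono) auto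
        then show ?thesis by (simp add: mult_ac)
      qed
      also have "\<dots> \<le> (C0 + A * D) * real n powr (-1/6)" using C0 by (intro mult_right_mono) auto
      finally show ?thesis .
    qed
  qed
  moreover have "0 < C0 + A * D" using C0 A D by (simp add: add_nonneg_pos)
  ultimately show ?thesis by blast
qed

text \<open>With \<open>a = m / n\<close>, the slope terms combine by \<open>(1 - a\<^sup>2)\<^sup>2
  / 8 - (1 - a\<^sup>2) / 4 = (a ^ 4 - 1) / 8\<close>. Together with \<open>(1 - a ^ 3) / 6\<close>
  from \<open>const n m\<close>, the coefficient of \<open>s * (s + r)\<close> becomes
  \<open>(1 - 4 * a ^ 3 + 3 * a ^ 4) / 24\<close>.\<close>

lemma limit_mgf_eq:
  "limit_mgf n m = exp (1/2 * Sigma_form (real m / real n) s r)"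
proof -
  define a where "a = real m / real n"
  have ne: "s * (s + r) \<noteq> 0" using s r by simp
  have 1: "Sigma_form a s r = s * (1/12 * (1 - 4 * a^3 + 3 * a^4) * s + 1/24 * (1 - 4 * a^3 + 3 * a^4) * r)
      + r * (1/24 * (1 - 4 * a^3 + 3 * a^4) * s + 1/36 * (1 - a^3) * r)"
    unfolding Sigma_form_def Sigma_mat_def Let_def
    by (simp add: inner_vec_def matrix_vector_mult_def UNIV_2 sum_2)
  have 2: "(slope n m)\<^sup>2 / (2 * (s * (s + r))) = (1 - a\<^sup>2)\<^sup>2 / 8 * (s * (s + r))"
  proof -
    have "(y / 2 * x)\<^sup>2 / (2 * x) = y\<^sup>2 / 8 * x" if "x \<noteq> 0" for x y :: real using that by (simp add: power2_eq_square)
    then show ?thesis unfolding slope_def a_def[symmetric] using ne by blast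
  qed
  have 3: "const n m = (1 - a ^ 3) * (r\<^sup>2 / 72 + s * (s + r) / 6)" "slope n m = (1 - a\<^sup>2) / 2 * (s * (s + r))"
    by (simp_all add: const_def slope_def a_def)
  have "const n m + ((slope n m)\<^sup>2 / (2 * (s * (s + r))) - slope n m / 2) = 1/2 * Sigma_form a s r"
    unfolding 2 unfolding 1 3 by (simp add: field_simps power2_eq_square power3_eq_cube power4_eq_xxxx)
  then show ?thesis unfolding limit_mgf_def a_def by simp
qed

text \<open>After normalisation the centring terms of both coordinates are multiples of
  \<open>sqrt n\<close>, with \<open>s / 2\<close> from the descents and \<open>r / 4\<close> from
  the major index; together they form \<open>shift n (l 1)\<close>.\<close>

lemma exp_W:
  assumes n: "1 \<le> n"
  shows "exp (vector [- s, - r] \<bullet> W n l p) = exp (shift n (l 1)) * t n * (t n ^ card (descents n p) * q n ^ maj n p)"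
proof -
  define a where "a = alpha1 n l"
  define R where "R = sqrt n"
  have R: "0 < R" and Rn: "real n = R\<^sup>2" using n by (auto simp: R_def)
  have p1: "real n powr (1/2) = R" using powr_half_sqrt[of "real n"] by (simp add: R_def)
  have p2: "real n powr (3/2) = R ^ 3"
  proof -
    have "real n powr (3/2) = real n powr (1 + 1/2)" by simp
    also have "\<dots> = real n * R" unfolding powr_add p1 using n by simp
    finally show ?thesis unfolding Rn by (simp add: power2_eq_square power3_eq_cube)
  qed
  have "vector [- s, - r] \<bullet> W n l p =
    - s * ((real (des n p) - (1 - a\<^sup>2) / 2 * R\<^sup>2) / R) - r * ((real (maj n p) - (1 - a\<^sup>2) / 4 * (R\<^sup>2)\<^sup>2) / R ^ 3)"
    unfolding W_def p1 p2 a_def[symmetric] Rn[symmetric]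
    by (simp add: inner_vec_def UNIV_2 sum_2)
  also have "\<dots> = (1 - a\<^sup>2) * (s / 2 + r / 4) * R + (real (des n p) * (- s / R) + real (maj n p) * (- r / R ^ 3))"
    using R by (simp add: field_simps power2_eq_square power3_eq_cube)
  also have "(1 - a\<^sup>2) * (s / 2 + r / 4) * R = shift n (l 1)" by (simp add: shift_def a_def alpha1_def R_def)
  finally have "exp (vector [- s, - r] \<bullet> W n l p)
    = exp (shift n (l 1)) * (exp (- s / R) ^ des n p * exp (- r / R ^ 3) ^ maj n p)"
    by (simp only: exp_add exp_of_nat_mult)
  moreover have "exp (- s / R) = t n" by (simp add: t_def R_def)
  moreover have "exp (- r / R ^ 3) = q n"
  proof -
    have "real n * sqrt n = R ^ 3" unfolding Rn by (simp add: R_def power2_eq_square power3_eq_cube)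
    then show ?thesis by (simp add: q_def)
  qed
  ultimately show ?thesis by (simp add: des_def mult_ac)
qed

end

theorem theorem4p1:
  fixes s r :: real
  assumes "s > 0" and "r > 0"
  shows "\<exists>C::real>0. \<forall>n::nat\<ge>1. \<forall>l. partition_of n l \<longrightarrow>
    \<bar>mgf (measure_pmf (pmf_of_set (conj_class n l))) (W n l) (vector [- s, - r])
       - exp (1/2 * Sigma_form (alpha1 n l) s r)\<bar> \<le> C * real n powr (-1/6)"
proof -
  interpret tilted s r using assms by unfold_locales
  obtain C where C: "0 < C" and bound: "\<And>n \<sigma>. 1 \<le> n \<Longrightarrow> \<sigma> permutes {1..n} \<Longrightarrow>
    \<bar>conj_average n (card {u \<in> {1..n}. \<sigma> u = u}) \<sigma> - limit_mgf n (card {u \<in> {1..n}. \<sigma> u = u})\<bar> \<le> C * real n powr (-1/6)"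
    using conj_average_uniform by blast
  have "\<bar>mgf (measure_pmf (pmf_of_set (conj_class n l))) (W n l) (vector [- s, - r])
       - exp (1/2 * Sigma_form (alpha1 n l) s r)\<bar> \<le> C * real n powr (-1/6)"
    if n: "1 \<le> n" and l: "partition_of n l" for n l
  proof -
    let ?f = "\<lambda>p. exp (vector [- s, - r] \<bullet> W n l p)"
    have ne: "conj_class n l \<noteq> {}" using conj_class_nonempty[OF l] .
    have "mgf (measure_pmf (pmf_of_set (conj_class n l))) (W n l) (vector [- s, - r])
      = (\<Sum>p\<in>conj_class n l. ?f p) / card (conj_class n l)"
      unfolding mgf_def by (rule integral_pmf_of_set[OF ne finite_conj_class])
    moreover have "\<bar>(\<Sum>p\<in>conj_class n l. ?f p) / card (conj_class n l) - limit_mgf n (l 1)\<bar> \<le> C * real n powr (-1/6)"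
    proof (rule conj_class_average[OF ne])
      fix \<sigma> assume "\<sigma> \<in> conj_class n l"
      \<comment> \<open>Every member of the class has \<open>l 1\<close> fixed points, so one bound
        serves all of them; \<open>n \<ge> 1\<close> puts the cycle length 1 in range.\<close>
      then have \<sigma>: "\<sigma> permutes {1..n}" and "card (cycles_of_length n \<sigma> 1) = l 1"
        using n by (auto simp: conj_class_def)
      then have l1: "card {u \<in> {1..n}. \<sigma> u = u} = l 1" using cycles_of_length_1[OF \<sigma>] by simp
      have "(\<Sum>\<rho> | \<rho> permutes {1..n}. ?f (\<rho> \<circ> \<sigma> \<circ> inv \<rho>)) / fact n = conj_average n (l 1) \<sigma>"
        unfolding exp_W[OF n] conj_average_def sum_distrib_left[symmetric] by simp
      then show "\<bar>(\<Sum>\<rho> | \<rho> permutes {1..n}. ?f (\<rho> \<circ> \<sigma> \<circ> inv \<rho>)) / fact n - limit_mgf n (l 1)\<bar> \<le> C * real n powr (-1/6)"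
        using bound[OF n \<sigma>] unfolding l1 by simp
    qed
    ultimately show ?thesis unfolding limit_mgf_eq alpha1_def by simp
  qed
  then show ?thesis using C by blast
qed

end
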